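(* Let $\sigma>0$ and let $\lambda\in\mathcal D$ be superlinear and satisfy $\rho_\sigma(\lambda)<1$. Then for every $m>1$, $T>0$ and starting state $x\in\mathbb R$, $$\mathbb E^{\mathbb P^x}\big[Z_{0,T}^m\big]=\infty.$$ Thus, although $Z$ is a true $\mathbb P^x$-martingale, its terminal density $Z_{0,T}$ belongs to no $L^m(\mathbb P^x)$ with $m>1$.
   Context: Class $\mathcal D$: all $\lambda\in C^1(\mathbb R)$ that are strictly decreasing with $\lambda(\theta)=0$ for some (unique) $\theta\in\mathbb R$; $q:=-\lambda'\ge0$. $\lambda$ is superlinear if $|\lambda(y)|/|y-\theta|\to\infty$ as $|y-\theta|\to\infty$. Set $\rho_\sigma(\lambda):=\limsup_{|y|\to\infty}\sigma^2q(y)/\lambda(y)^2\in[0,\infty]$. For $\lambda\in\mathcal D$ the SDE $\mathrm dX_t=\lambda(X_t)\,\mathrm dt+\sigma\,\mathrm dW_t$, $X_0=x$ ($W$ a standard Brownian motion) has a unique non-explosive strong solution, whose law is $\mathbb P^x$, and with $\eta=\lambda/\sigma$, $$Z_{0,s}:=\exp\Big(-\int_0^s\eta(X_r)\,\mathrm dW_r-\frac12\int_0^s\eta(X_r)^2\,\mathrm dr\Big),\qquad 0\le s\le T.$$ *)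

theory Defs
  imports "HOL-Probability.Probability"
begin

section \<open>The class of drifts\<close>

definition classD :: "(real \<Rightarrow> real) set" where
  "classD = {lam. lam C1_differentiable_on UNIV \<and> strict_antimono_on UNIV lam \<and> (\<exists>\<theta>. lam \<theta> = 0)}"

text \<open>Meaningful for drifts in \<open>classD\<close>, which have exactly one zero.\<close>

definition zero_of :: "(real \<Rightarrow> real) \<Rightarrow> real" where
  "zero_of lam = (THE \<theta>. lam \<theta> = 0)"

definition superlinear :: "(real \<Rightarrow> real) \<Rightarrow> bool" where
  "superlinear lam \<longleftrightarrow>
    filterlim (\<lambda>y. \<bar>lam y\<bar> / \<bar>y - zero_of lam\<bar>) at_top at_infinity"

definition neg_deriv :: "(real \<Rightarrow> real) \<Rightarrow> real \<Rightarrow> real" where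
  "neg_deriv lam y = - deriv lam y"

definition rho :: "real \<Rightarrow> (real \<Rightarrow> real) \<Rightarrow> ereal" where
  "rho \<sigma> lam = Limsup at_infinity (\<lambda>y. ereal (\<sigma>\<^sup>2 * neg_deriv lam y / (lam y)\<^sup>2))"


section \<open>Filtered probability spaces, Brownian motion, martingales\<close>

text \<open>
  Time is the half-line of nonnegative reals inside \<^typ>\<open>real\<close>. The library's filtrations are
  indexed by the whole type; the members with negative index play no role.
\<close>

locale filtered_prob_space = prob_space M + filtration "space M" F
  for M :: "'a measure" and F :: "real \<Rightarrow> 'a measure" +
  assumes subalgebra_F: "\<And>t. subalgebra M (F t)"

definition continuous_adapted ::
  "'a measure \<Rightarrow> (real \<Rightarrow> 'a measure) \<Rightarrow> (real \<Rightarrow> 'a \<Rightarrow> real) \<Rightarrow> bool" where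
  "continuous_adapted M F X \<longleftrightarrow>
    (\<forall>t\<ge>0. X t \<in> borel_measurable (F t)) \<and>
    (\<forall>\<omega>\<in>space M. continuous_on {0..} (\<lambda>t. X t \<omega>))"

definition brownian_motion ::
  "'a measure \<Rightarrow> (real \<Rightarrow> 'a measure) \<Rightarrow> (real \<Rightarrow> 'a \<Rightarrow> real) \<Rightarrow> bool" where
  "brownian_motion M F W \<longleftrightarrow>
    continuous_adapted M F W \<and>
    (AE \<omega> in M. W 0 \<omega> = 0) \<and>
    (\<forall>s t. 0 \<le> s \<and> s < t \<longrightarrow>
      distributed M lborel (\<lambda>\<omega>. W t \<omega> - W s \<omega>) (\<lambda>x. ennreal (normal_density 0 (sqrt (t - s)) x)) \<and>
      prob_space.indep_set M (sets (F s))
        (sets (vimage_algebra (space M) (\<lambda>\<omega>. W t \<omega> - W s \<omega>) borel)))"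

definition martingale_upto ::
  "'a measure \<Rightarrow> (real \<Rightarrow> 'a measure) \<Rightarrow> real \<Rightarrow> (real \<Rightarrow> 'a \<Rightarrow> real) \<Rightarrow> bool" where
  "martingale_upto M F T Z \<longleftrightarrow>
    (\<forall>t\<in>{0..T}. Z t \<in> borel_measurable (F t) \<and> integrable M (Z t)) \<and>
    (\<forall>s t. 0 \<le> s \<and> s \<le> t \<and> t \<le> T \<longrightarrow>
      (AE \<omega> in M. real_cond_exp M (F s) (Z t) \<omega> = Z s \<omega>))"

definition in_Lp :: "'a measure \<Rightarrow> real \<Rightarrow> ('a \<Rightarrow> real) \<Rightarrow> bool" where
  "in_Lp M p f \<longleftrightarrow> f \<in> borel_measurable M \<and> integrable M (\<lambda>\<omega>. \<bar>f \<omega>\<bar> powr p)"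


section \<open>The Ito integral\<close>

text \<open>Measurability is required explicitly because \<^const>\<open>measure\<close> is zero on non-measurable sets.\<close>

definition null_in_prob :: "'a measure \<Rightarrow> (nat \<Rightarrow> 'a \<Rightarrow> ennreal) \<Rightarrow> bool" where
  "null_in_prob M Y \<longleftrightarrow>
    (\<forall>n. Y n \<in> borel_measurable M) \<and>
    (\<forall>\<epsilon>>0::real. (\<lambda>n. measure M {\<omega> \<in> space M. Y n \<omega> > ennreal \<epsilon>}) \<longlonglongrightarrow> 0)"

text \<open>
  The data \<open>(k, \<tau>, \<xi>)\<close> stand for the simple process that equals the bounded,
  \<open>F (\<tau> i)\<close>-measurable variable \<open>\<xi> i\<close> on \<open>(\<tau> i, \<tau> (i + 1)]\<close> for \<open>i < k\<close>, and zero elsewhere.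
\<close>

definition simple_data ::
  "(real \<Rightarrow> 'a measure) \<Rightarrow> nat \<Rightarrow> (nat \<Rightarrow> real) \<Rightarrow> (nat \<Rightarrow> 'a \<Rightarrow> real) \<Rightarrow> bool" where
  "simple_data F k \<tau> \<xi> \<longleftrightarrow>
    0 \<le> \<tau> 0 \<and> (\<forall>i<k. \<tau> i < \<tau> (Suc i)) \<and>
    (\<forall>i<k. \<xi> i \<in> borel_measurable (F (\<tau> i)) \<and>
      (\<exists>C. \<forall>\<omega>\<in>space (F (\<tau> i)). \<bar>\<xi> i \<omega>\<bar> \<le> C))"

definition simple_process ::
  "nat \<Rightarrow> (nat \<Rightarrow> real) \<Rightarrow> (nat \<Rightarrow> 'a \<Rightarrow> real) \<Rightarrow> real \<Rightarrow> 'a \<Rightarrow> real" where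
  "simple_process k \<tau> \<xi> r \<omega> = (\<Sum>i<k. \<xi> i \<omega> * indicator {\<tau> i<..\<tau> (Suc i)} r)"

definition simple_integral ::
  "(real \<Rightarrow> 'a \<Rightarrow> real) \<Rightarrow> nat \<Rightarrow> (nat \<Rightarrow> real) \<Rightarrow> (nat \<Rightarrow> 'a \<Rightarrow> real) \<Rightarrow> real \<Rightarrow> 'a \<Rightarrow> real" where
  "simple_integral W k \<tau> \<xi> t \<omega> =
    (\<Sum>i<k. \<xi> i \<omega> * (W (min t (\<tau> (Suc i))) \<omega> - W (min t (\<tau> i)) \<omega>))"

text \<open>
  \<open>Y\<close> is a version of the stochastic integral of \<open>H\<close> against \<open>W\<close> over \<open>[0, t]\<close>: the limit in
  probability of integrals of simple processes that approximate \<open>H\<close> in \<open>L\<^sup>2(0, t)\<close>, in probability.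
  The approximation condition forces \<open>H\<close> to be almost surely square integrable on \<open>[0, t]\<close>.
  The integral is determined only up to null sets, hence a predicate.
\<close>

definition ito_integral ::
  "'a measure \<Rightarrow> (real \<Rightarrow> 'a measure) \<Rightarrow> (real \<Rightarrow> 'a \<Rightarrow> real) \<Rightarrow> (real \<Rightarrow> 'a \<Rightarrow> real) \<Rightarrow>
    real \<Rightarrow> ('a \<Rightarrow> real) \<Rightarrow> bool" where
  "ito_integral M F W H t Y \<longleftrightarrow>
    (\<lambda>(r, \<omega>). H r \<omega>) \<in> borel_measurable (restrict_space borel {0..t} \<Otimes>\<^sub>M F t) \<and>
    Y \<in> borel_measurable (F t) \<and>
    (\<exists>k \<tau> \<xi>.
      (\<forall>n. simple_data F (k n) (\<tau> n) (\<xi> n)) \<and>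
      null_in_prob M (\<lambda>n \<omega>. \<integral>\<^sup>+ r \<in> {0..t}.
        ennreal ((simple_process (k n) (\<tau> n) (\<xi> n) r \<omega> - H r \<omega>)\<^sup>2) \<partial>lborel) \<and>
      null_in_prob M (\<lambda>n \<omega>. ennreal \<bar>simple_integral W (k n) (\<tau> n) (\<xi> n) t \<omega> - Y \<omega>\<bar>))"


section \<open>The SDE and the exponential density\<close>

definition sde_solution ::
  "'a measure \<Rightarrow> (real \<Rightarrow> 'a measure) \<Rightarrow> (real \<Rightarrow> 'a \<Rightarrow> real) \<Rightarrow> (real \<Rightarrow> real) \<Rightarrow> real \<Rightarrow> real \<Rightarrow>
    (real \<Rightarrow> 'a \<Rightarrow> real) \<Rightarrow> bool" where
  "sde_solution M F W lam \<sigma> x X \<longleftrightarrow>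
    continuous_adapted M F X \<and>
    (AE \<omega> in M. \<forall>t\<ge>0. X t \<omega> = x + (LBINT r:{0..t}. lam (X r \<omega>)) + \<sigma> * W t \<omega>)"

text \<open>In \<open>dens\<close>, the argument \<open>I\<close> is the stochastic integral process of \<open>\<eta>(X)\<close> against \<open>W\<close>.\<close>

definition eta :: "(real \<Rightarrow> real) \<Rightarrow> real \<Rightarrow> real \<Rightarrow> real" where
  "eta lam \<sigma> y = lam y / \<sigma>"

definition dens ::
  "(real \<Rightarrow> real) \<Rightarrow> real \<Rightarrow> (real \<Rightarrow> 'a \<Rightarrow> real) \<Rightarrow> (real \<Rightarrow> 'a \<Rightarrow> real) \<Rightarrow> real \<Rightarrow> 'a \<Rightarrow> real" where
  "dens lam \<sigma> X I s \<omega> = exp (- I s \<omega> - 1 / 2 * (LBINT r:{0..s}. (eta lam \<sigma> (X r \<omega>))\<^sup>2))"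

end

theory Submission
  imports Defs
begin

text \<open>
  By Ito's formula for an antiderivative \<open>L\<close> of \<open>lam\<close>, the density is an explicit functional of
  the path,
  \<open>Z_T = exp (- (L (X_T) - L x) / \<sigma>\<^sup>2 + 1/2 \<integral> V (X_r) dr)\<close> with \<open>V = lam\<^sup>2 / \<sigma>\<^sup>2 + lam'\<close>. Let \<open>Y = x + \<sigma> W\<close>.
  The Euler scheme for \<open>X\<close> has an explicit density with respect to the random walk underlying \<open>Y\<close>,
  and in the limit Fatou's lemma gives
  \<open>E[Z_T^m] \<ge> E[G^(m-1)]\<close>, where \<open>G\<close> is the functional above evaluated at \<open>Y\<close>. For \<open>m = 1\<close> this says
  that no mass is lost, so the supermartingale \<open>Z\<close> is a martingale. For \<open>m > 1\<close> the right-hand side is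
  infinite: \<open>\<rho> < 1\<close> bounds \<open>V\<close> from below, and superlinearity makes \<open>- L\<close> grow faster than any quadratic,
  which defeats the Gaussian tail of \<open>Y_T\<close>.

  The Ito formula is used pathwise, in Foellmer's form: almost every Brownian path has quadratic
  variation \<open>t\<close> along dyadic partitions, and along such a path the Riemann sums of the stochastic
  integral converge.
\<close>

section \<open>Dyadic partitions\<close>

definition dpt :: "real \<Rightarrow> real \<Rightarrow> nat \<Rightarrow> nat \<Rightarrow> real" where
  "dpt a b n i = a + (b - a) * real i / 2 ^ n"

lemma dpt_0 [simp]: "dpt a b n 0 = a"
  by (simp add: dpt_def)

lemma dpt_end [simp]: "dpt a b n (2 ^ n) = b"
  by (simp add: dpt_def)

lemma dpt_Suc: "dpt a b n (Suc i) = dpt a b n i + (b - a) / 2 ^ n"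
  by (simp add: dpt_def field_simps)

lemma dpt_refine: "dpt a b (m + n) (j * 2 ^ n) = dpt a b m j"
  by (simp add: dpt_def power_add)

lemma dpt_mono: "a \<le> b \<Longrightarrow> i \<le> j \<Longrightarrow> dpt a b n i \<le> dpt a b n j"
  by (simp add: dpt_def divide_right_mono mult_left_mono)

lemma dpt_strict_mono: "a < b \<Longrightarrow> i < j \<Longrightarrow> dpt a b n i < dpt a b n j"
  by (simp add: dpt_def divide_strict_right_mono)

lemma dpt_ge: "a \<le> b \<Longrightarrow> a \<le> dpt a b n i"
  using dpt_mono[of a b 0 i n] by simp

lemma dpt_le: "a \<le> b \<Longrightarrow> i \<le> 2 ^ n \<Longrightarrow> dpt a b n i \<le> b"
  using dpt_mono[of a b i "2 ^ n" n] by simp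

lemma dpt_cell_subset:
  assumes "a \<le> b" "i < 2 ^ n"
  shows "{dpt a b n i..dpt a b n (Suc i)} \<subseteq> {a..b}"
  using dpt_ge[OF assms(1)] dpt_le[OF assms(1), of "Suc i" n] assms(2)
  by (auto intro: order_trans)

lemma mesh_tendsto_0: "(\<lambda>n. c / 2 ^ n :: real) \<longlonglongrightarrow> 0"
  using LIMSEQ_divide_realpow_zero[of 2 c] by simp

lemma dyadic_oscillation:
  fixes f :: "real \<Rightarrow> real"
  assumes "a \<le> b" "continuous_on {a..b} f" "\<epsilon> > 0"
  shows "\<forall>\<^sub>F n in sequentially. \<forall>i<2 ^ n. \<forall>r\<in>{dpt a b n i..dpt a b n (Suc i)}.
           \<forall>r'\<in>{dpt a b n i..dpt a b n (Suc i)}. \<bar>f r - f r'\<bar> < \<epsilon>"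
proof -
  have "uniformly_continuous_on {a..b} f"
    using assms by (intro compact_uniformly_continuous) auto
  then obtain d where d: "d > 0"
    "\<And>x y. x \<in> {a..b} \<Longrightarrow> y \<in> {a..b} \<Longrightarrow> dist y x < d \<Longrightarrow> dist (f y) (f x) < \<epsilon>"
    using assms(3) unfolding uniformly_continuous_on_def by metis
  have "\<forall>\<^sub>F n in sequentially. (b - a) / 2 ^ n < d"
    using mesh_tendsto_0 d(1) by (rule order_tendstoD)
  then show ?thesis
  proof eventually_elim
    case (elim n)
    show ?case
    proof (intro allI impI ballI)
      fix i r r' assume *: "i < 2 ^ n" "r \<in> {dpt a b n i..dpt a b n (Suc i)}"
        "r' \<in> {dpt a b n i..dpt a b n (Suc i)}"
      have "dist r r' < d"
        using * elim by (auto simp: dpt_Suc dist_real_def)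
      moreover have "r \<in> {a..b}" "r' \<in> {a..b}"
        using * dpt_cell_subset[OF assms(1) *(1)] by auto
      ultimately show "\<bar>f r - f r'\<bar> < \<epsilon>"
        using d(2)[of r' r] by (simp add: dist_real_def)
    qed
  qed
qed

lemma sum_integral_cells:
  fixes f :: "real \<Rightarrow> real" and p :: "nat \<Rightarrow> real"
  assumes "\<And>i. i < N \<Longrightarrow> p i \<le> p (Suc i)" "continuous_on {p 0..p N} f"
  shows "(\<Sum>i<N. integral {p i..p (Suc i)} f) = integral {p 0..p N} f"
  using assms
proof (induction N)
  case (Suc N)
  have "p 0 \<le> p k" if "k \<le> N" for k
    using that
  proof (induction k)
    case (Suc k)
    then show ?case using Suc.prems Suc.IH \<open>\<And>i. i < Suc N \<Longrightarrow> p i \<le> p (Suc i)\<close>[of k] by simp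
  qed simp
  then have le: "p 0 \<le> p N" "p N \<le> p (Suc N)"
    using Suc.prems(1) by auto
  have c: "continuous_on {p 0..p N} f"
    using Suc.prems(2) le by (elim continuous_on_subset) auto
  have "(\<Sum>i<Suc N. integral {p i..p (Suc i)} f) = integral {p 0..p N} f + integral {p N..p (Suc N)} f"
    using Suc.IH[OF _ c] Suc.prems(1) by simp
  also have "\<dots> = integral {p 0..p (Suc N)} f"
    using le Suc.prems(2) by (intro Henstock_Kurzweil_Integration.integral_combine integrable_continuous_interval) auto
  finally show ?case .
qed simp

lemma sum_integral_dyadic:
  fixes f :: "real \<Rightarrow> real"
  assumes "a \<le> b" "continuous_on {a..b} f"
  shows "(\<Sum>i<2 ^ n. integral {dpt a b n i..dpt a b n (Suc i)} f) = integral {a..b} f"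
  using sum_integral_cells[of "2 ^ n" "dpt a b n" f] assms by (simp add: dpt_mono)

lemma weighted_riemann_sum_tendsto:
  fixes f g :: "real \<Rightarrow> real"
  assumes ab: "a \<le> b" and f: "continuous_on {a..b} f" and g: "continuous_on {a..b} g"
  shows "(\<lambda>n. \<Sum>i<2 ^ n. f (dpt a b n i) * integral {dpt a b n i..dpt a b n (Suc i)} g)
           \<longlonglongrightarrow> integral {a..b} (\<lambda>r. f r * g r)"
proof (rule LIMSEQ_I)
  fix e :: real assume e: "e > 0"
  define C where "C = integral {a..b} (\<lambda>r. \<bar>g r\<bar>)"
  have C: "C \<ge> 0"
    unfolding C_def using g by (intro integral_nonneg integrable_continuous_interval continuous_intros) auto
  define \<epsilon> where "\<epsilon> = e / (C + 1)"
  have \<epsilon>: "\<epsilon> > 0" "\<epsilon> * C < e"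
    using e C by (auto simp: \<epsilon>_def field_simps)
  have "\<forall>\<^sub>F n in sequentially. norm ((\<Sum>i<2 ^ n. f (dpt a b n i) * integral {dpt a b n i..dpt a b n (Suc i)} g)
           - integral {a..b} (\<lambda>r. f r * g r)) < e"
    using dyadic_oscillation[OF ab f \<epsilon>(1)]
  proof eventually_elim
    case (elim n)
    let ?I = "\<lambda>i. {dpt a b n i..dpt a b n (Suc i)}"
    have sub: "?I i \<subseteq> {a..b}" if "i < 2 ^ n" for i
      using dpt_cell_subset[OF ab that] .
    have "\<bar>f (dpt a b n i) * integral (?I i) g - integral (?I i) (\<lambda>r. f r * g r)\<bar>
        \<le> integral (?I i) (\<lambda>r. \<epsilon> * \<bar>g r\<bar>)" if i: "i < 2 ^ n" for i
    proof -
      note cs = continuous_on_subset[OF f sub[OF i]] continuous_on_subset[OF g sub[OF i]]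
      have "f (dpt a b n i) * integral (?I i) g - integral (?I i) (\<lambda>r. f r * g r)
          = integral (?I i) (\<lambda>r. (f (dpt a b n i) - f r) * g r)"
        using cs by (simp add: left_diff_distrib Henstock_Kurzweil_Integration.integral_diff
            integrable_continuous_interval continuous_intros)
      also have "norm \<dots> \<le> integral (?I i) (\<lambda>r. \<epsilon> * \<bar>g r\<bar>)"
      proof (rule integral_norm_bound_integral)
        fix r assume r: "r \<in> ?I i"
        have "dpt a b n i \<in> ?I i"
          using dpt_mono[OF ab, of i "Suc i" n] by auto
        then have "\<bar>f (dpt a b n i) - f r\<bar> \<le> \<epsilon>"
          using elim i r by (meson less_imp_le)
        then show "norm ((f (dpt a b n i) - f r) * g r) \<le> \<epsilon> * \<bar>g r\<bar>"
          by (simp add: abs_mult mult_right_mono)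
      qed (use cs in \<open>auto intro!: integrable_continuous_interval continuous_intros\<close>)
      finally show ?thesis by simp
    qed
    then have "\<bar>\<Sum>i<2 ^ n. f (dpt a b n i) * integral (?I i) g - integral (?I i) (\<lambda>r. f r * g r)\<bar>
        \<le> (\<Sum>i<2 ^ n. integral (?I i) (\<lambda>r. \<epsilon> * \<bar>g r\<bar>))"
      by (intro order_trans[OF sum_abs] sum_mono) auto
    also have "\<dots> = integral {a..b} (\<lambda>r. \<epsilon> * \<bar>g r\<bar>)"
      using g by (intro sum_integral_dyadic ab continuous_intros) auto
    also have "\<dots> < e"
      using \<epsilon>(2) by (simp add: C_def)
    finally show ?case
      using sum_integral_dyadic[OF ab continuous_on_mult[OF f g], of n] by (simp add: sum_subtractf)
  qed
  then show "\<exists>no. \<forall>n\<ge>no. norm ((\<Sum>i<2 ^ n. f (dpt a b n i) * integral {dpt a b n i..dpt a b n (Suc i)} g)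
           - integral {a..b} (\<lambda>r. f r * g r)) < e"
    by (simp add: eventually_sequentially)
qed

lemma riemann_sum_tendsto:
  fixes f :: "real \<Rightarrow> real"
  assumes ab: "a \<le> b" and f: "continuous_on {a..b} f"
  shows "(\<lambda>n. \<Sum>i<2 ^ n. f (dpt a b n i) * ((b - a) / 2 ^ n)) \<longlonglongrightarrow> integral {a..b} f"
proof -
  have "integral {dpt a b n i..dpt a b n (Suc i)} (\<lambda>_. 1) = (b - a) / 2 ^ n" for n i
    using dpt_mono[OF ab, of i "Suc i" n] by (simp add: dpt_Suc)
  then show ?thesis
    using weighted_riemann_sum_tendsto[OF ab f, of "\<lambda>_. 1"] by simp
qed

section \<open>Quadratic variation along dyadic partitions\<close>

definition has_qv :: "real \<Rightarrow> real \<Rightarrow> (real \<Rightarrow> real) \<Rightarrow> real \<Rightarrow> bool" where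
  "has_qv a b y c \<longleftrightarrow> (\<forall>m j. j \<le> 2 ^ m \<longrightarrow>
     (\<lambda>n. \<Sum>i<j * 2 ^ n. (y (dpt a b (m + n) (Suc i)) - y (dpt a b (m + n) i))\<^sup>2)
       \<longlonglongrightarrow> c * (b - a) * real j / 2 ^ m)"

lemma has_qv_weighted:
  fixes f y :: "real \<Rightarrow> real"
  assumes ab: "a \<le> b" and f: "continuous_on {a..b} f" and qv: "has_qv a b y c"
    and tag: "\<And>n i. i < 2 ^ n \<Longrightarrow> r n i \<in> {dpt a b n i..dpt a b n (Suc i)}"
  shows "(\<lambda>n. \<Sum>i<2 ^ n. f (r n i) * (y (dpt a b n (Suc i)) - y (dpt a b n i))\<^sup>2)
           \<longlonglongrightarrow> c * integral {a..b} f"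
proof (rule LIMSEQ_I)
  fix e :: real assume e: "e > 0"
  define u where "u n i = (y (dpt a b n (Suc i)) - y (dpt a b n i))\<^sup>2" for n i
  define C where "C = \<bar>c * (b - a)\<bar> + 1"
  have C: "C > 0" by (simp add: C_def)
  have "(\<lambda>m. c * (\<Sum>j<2 ^ m. f (dpt a b m j) * ((b - a) / 2 ^ m))) \<longlonglongrightarrow> c * integral {a..b} f"
    by (intro tendsto_intros riemann_sum_tendsto ab f)
  from tendstoD[OF this, of "e / 3"] have "\<forall>\<^sub>F m in sequentially.
      \<bar>c * (\<Sum>j<2 ^ m. f (dpt a b m j) * ((b - a) / 2 ^ m)) - c * integral {a..b} f\<bar> < e / 3"
    using e unfolding dist_real_def by simp
  moreover have "e / (3 * C) > 0" using e C by simp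
  ultimately have "\<forall>\<^sub>F m in sequentially.
      \<bar>c * (\<Sum>j<2 ^ m. f (dpt a b m j) * ((b - a) / 2 ^ m)) - c * integral {a..b} f\<bar> < e / 3 \<and>
      (\<forall>i<2 ^ m. \<forall>r\<in>{dpt a b m i..dpt a b m (Suc i)}.
           \<forall>r'\<in>{dpt a b m i..dpt a b m (Suc i)}. \<bar>f r - f r'\<bar> < e / (3 * C))"
    using dyadic_oscillation[OF ab f] by (intro eventually_conj) auto
  then obtain m where m:
    "\<bar>c * (\<Sum>j<2 ^ m. f (dpt a b m j) * ((b - a) / 2 ^ m)) - c * integral {a..b} f\<bar> < e / 3"
    "\<And>i r r'. i < 2 ^ m \<Longrightarrow> r \<in> {dpt a b m i..dpt a b m (Suc i)} \<Longrightarrow>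
       r' \<in> {dpt a b m i..dpt a b m (Suc i)} \<Longrightarrow> \<bar>f r - f r'\<bar> < e / (3 * C)"
    unfolding eventually_sequentially by (metis order_refl)
  define U where "U n j = (\<Sum>i = j * 2 ^ n..<j * 2 ^ n + 2 ^ n. u (m + n) i)" for n j
  have U_eq: "U n j = (\<Sum>i<Suc j * 2 ^ n. u (m + n) i) - (\<Sum>i<j * 2 ^ n. u (m + n) i)" for n j
    using sum.atLeastLessThan_concat[of 0 "j * 2 ^ n" "j * 2 ^ n + 2 ^ n" "u (m + n)"]
    unfolding U_def lessThan_atLeast0 by (simp add: add.commute)
  have part: "(\<lambda>n. \<Sum>i<j * 2 ^ n. u (m + n) i) \<longlonglongrightarrow> c * (b - a) * real j / 2 ^ m" if "j \<le> 2 ^ m" for j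
    using qv that unfolding has_qv_def u_def by blast
  have U: "(\<lambda>n. U n j) \<longlonglongrightarrow> c * ((b - a) / 2 ^ m)" if "j < 2 ^ m" for j
  proof -
    have "(\<lambda>n. U n j) \<longlonglongrightarrow> c * (b - a) * real (Suc j) / 2 ^ m - c * (b - a) * real j / 2 ^ m"
      unfolding U_eq using that by (intro tendsto_diff part) auto
    also have "c * (b - a) * real (Suc j) / 2 ^ m - c * (b - a) * real j / 2 ^ m = c * ((b - a) / 2 ^ m)"
      unfolding diff_divide_distrib[symmetric] by (simp add: algebra_simps)
    finally show ?thesis .
  qed
  have "(\<lambda>n. \<Sum>j<2 ^ m. f (dpt a b m j) * U n j)
      \<longlonglongrightarrow> (\<Sum>j<2 ^ m. f (dpt a b m j) * (c * ((b - a) / 2 ^ m)))"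
    by (intro tendsto_sum tendsto_mult tendsto_const U) auto
  also have "(\<Sum>j<2 ^ m. f (dpt a b m j) * (c * ((b - a) / 2 ^ m)))
      = c * (\<Sum>j<2 ^ m. f (dpt a b m j) * ((b - a) / 2 ^ m))"
    by (simp add: sum_distrib_left algebra_simps)
  finally have conv: "(\<lambda>n. \<Sum>j<2 ^ m. f (dpt a b m j) * U n j)
      \<longlonglongrightarrow> c * (\<Sum>j<2 ^ m. f (dpt a b m j) * ((b - a) / 2 ^ m))" .
  have "\<forall>\<^sub>F n in sequentially. \<bar>(\<Sum>j<2 ^ m. f (dpt a b m j) * U n j)
      - c * (\<Sum>j<2 ^ m. f (dpt a b m j) * ((b - a) / 2 ^ m))\<bar> < e / 3"
    using tendstoD[OF conv, of "e / 3"] e unfolding dist_real_def by simp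
  moreover have "\<forall>\<^sub>F n in sequentially. (\<Sum>i<2 ^ m * 2 ^ n. u (m + n) i) < C"
    using part[of "2 ^ m"] by (rule order_tendstoD) (auto simp: C_def)
  ultimately have "\<forall>\<^sub>F n in sequentially.
      \<bar>(\<Sum>i<2 ^ (m + n). f (r (m + n) i) * u (m + n) i) - c * integral {a..b} f\<bar> < e"
  proof eventually_elim
    case (elim n)
    have tag': "r (m + n) i \<in> {dpt a b m j..dpt a b m (Suc j)}"
      if "j < 2 ^ m" "i \<in> {j * 2 ^ n..<j * 2 ^ n + 2 ^ n}" for i j
    proof -
      have le: "Suc j * 2 ^ n \<le> (2 ^ m * 2 ^ n :: nat)"
        using that(1) by (intro mult_right_mono) auto
      then have "i < 2 ^ (m + n)"
        using that(2) by (auto simp: power_add)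
      then have "r (m + n) i \<in> {dpt a b (m + n) i..dpt a b (m + n) (Suc i)}"
        by (rule tag)
      moreover have "dpt a b m j \<le> dpt a b (m + n) i"
        using that(2) unfolding dpt_refine[of a b m n j, symmetric] by (intro dpt_mono ab) auto
      moreover have "dpt a b (m + n) (Suc i) \<le> dpt a b m (Suc j)"
        using that(2) unfolding dpt_refine[of a b m n "Suc j", symmetric] by (intro dpt_mono ab) auto
      ultimately show ?thesis by auto
    qed
    have "(\<Sum>i<2 ^ (m + n). f (r (m + n) i) * u (m + n) i)
        = (\<Sum>j<2 ^ m. \<Sum>i = j * 2 ^ n..<j * 2 ^ n + 2 ^ n. f (r (m + n) i) * u (m + n) i)"
      unfolding sum.nat_group by (simp add: power_add)
    then have "\<bar>(\<Sum>i<2 ^ (m + n). f (r (m + n) i) * u (m + n) i) - (\<Sum>j<2 ^ m. f (dpt a b m j) * U n j)\<bar>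
        = \<bar>\<Sum>j<2 ^ m. \<Sum>i = j * 2 ^ n..<j * 2 ^ n + 2 ^ n. (f (r (m + n) i) - f (dpt a b m j)) * u (m + n) i\<bar>"
      by (simp add: U_def sum_subtractf left_diff_distrib sum_distrib_left)
    also have "\<dots> \<le> (\<Sum>j<2 ^ m. \<Sum>i = j * 2 ^ n..<j * 2 ^ n + 2 ^ n. e / (3 * C) * u (m + n) i)"
    proof (intro order_trans[OF sum_abs] sum_mono)
      fix j i :: nat assume j: "j \<in> {..<2 ^ m}" and i: "i \<in> {j * 2 ^ n..<j * 2 ^ n + 2 ^ n}"
      have "dpt a b m j \<in> {dpt a b m j..dpt a b m (Suc j)}"
        using dpt_mono[OF ab, of j "Suc j" m] by auto
      then have "\<bar>f (r (m + n) i) - f (dpt a b m j)\<bar> \<le> e / (3 * C)"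
        using m(2)[OF _ tag'[OF _ i]] j by (auto intro: less_imp_le)
      then show "\<bar>(f (r (m + n) i) - f (dpt a b m j)) * u (m + n) i\<bar> \<le> e / (3 * C) * u (m + n) i"
        unfolding abs_mult u_def abs_power2 by (rule mult_right_mono) simp
    qed
    also have "\<dots> = e / (3 * C) * (\<Sum>i<2 ^ m * 2 ^ n. u (m + n) i)"
      unfolding sum.nat_group by (simp add: sum_distrib_left)
    also have "\<dots> \<le> e / (3 * C) * C"
      using elim(2) e C by (intro mult_left_mono) auto
    also have "\<dots> = e / 3" using C by simp
    finally show ?case
      using elim(1) m(1) by linarith
  qed
  then obtain n0 where n0: "\<And>n. n \<ge> n0 \<Longrightarrow>
      \<bar>(\<Sum>i<2 ^ (m + n). f (r (m + n) i) * u (m + n) i) - c * integral {a..b} f\<bar> < e"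
    unfolding eventually_sequentially by blast
  show "\<exists>no. \<forall>n\<ge>no. norm ((\<Sum>i<2 ^ n. f (r n i) * (y (dpt a b n (Suc i)) - y (dpt a b n i))\<^sup>2)
      - c * integral {a..b} f) < e"
  proof (intro exI allI impI)
    fix n assume "m + n0 \<le> n"
    then show "norm ((\<Sum>i<2 ^ n. f (r n i) * (y (dpt a b n (Suc i)) - y (dpt a b n i))\<^sup>2)
      - c * integral {a..b} f) < e"
      using n0[of "n - m"] by (simp add: u_def)
  qed
qed

lemma foellmer_ito:
  fixes L l l' y :: "real \<Rightarrow> real"
  assumes ab: "a \<le> b" and y: "continuous_on {a..b} y" and qv: "has_qv a b y c"
    and L: "\<And>v. (L has_real_derivative l v) (at v)"
    and l: "\<And>v. (l has_real_derivative l' v) (at v)"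
    and l': "continuous_on UNIV l'"
  shows "(\<lambda>n. \<Sum>i<2 ^ n. l (y (dpt a b n i)) * (y (dpt a b n (Suc i)) - y (dpt a b n i)))
           \<longlonglongrightarrow> L (y b) - L (y a) - c / 2 * integral {a..b} (\<lambda>r. l' (y r))"
proof -
  let ?dy = "\<lambda>n i. y (dpt a b n (Suc i)) - y (dpt a b n i)"
  have taylor: "\<exists>\<xi>\<in>closed_segment u v. L v = L u + l u * (v - u) + l' \<xi> / 2 * (v - u)\<^sup>2" for u v
  proof (cases "u = v")
    case False
    define diff where "diff m = (if m = 0 then L else if m = 1 then l else l')" for m :: nat
    have "\<exists>t. (if v < u then v < t \<and> t < u else u < t \<and> t < v) \<and>
        L v = (\<Sum>m<2. diff m u / fact m * (v - u) ^ m) + diff 2 t / fact 2 * (v - u) ^ 2"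
    proof (rule Taylor[where a="min u v" and b="max u v"])
      show "\<forall>m t. m < 2 \<and> min u v \<le> t \<and> t \<le> max u v \<longrightarrow> DERIV (diff m) t :> diff (Suc m) t"
        using L l by (auto simp: diff_def less_2_cases_iff)
    qed (use False in \<open>auto simp: diff_def\<close>)
    then obtain t where t: "if v < u then v < t \<and> t < u else u < t \<and> t < v"
      "L v = (\<Sum>m<2. diff m u / fact m * (v - u) ^ m) + diff 2 t / fact 2 * (v - u) ^ 2"
      by blast
    then show ?thesis
      by (intro bexI[of _ t])
        (auto simp: diff_def closed_segment_eq_real_ivl numeral_2_eq_2 lessThan_Suc split: if_splits)
  qed auto
  have ex: "\<exists>r\<in>{dpt a b n i..dpt a b n (Suc i)}.
      L (y (dpt a b n (Suc i))) = L (y (dpt a b n i))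
        + l (y (dpt a b n i)) * (?dy n i)
        + l' (y r) / 2 * (?dy n i)\<^sup>2" if i: "i < 2 ^ n" for n i
  proof -
    obtain \<xi> where \<xi>: "\<xi> \<in> closed_segment (y (dpt a b n i)) (y (dpt a b n (Suc i)))"
      "L (y (dpt a b n (Suc i))) = L (y (dpt a b n i))
        + l (y (dpt a b n i)) * (?dy n i)
        + l' \<xi> / 2 * (?dy n i)\<^sup>2"
      using taylor by blast
    have le: "dpt a b n i \<le> dpt a b n (Suc i)"
      by (intro dpt_mono ab) auto
    have "continuous_on (closed_segment (dpt a b n i) (dpt a b n (Suc i))) y"
      unfolding closed_segment_eq_real_ivl1[OF le] using y dpt_cell_subset[OF ab i] by (rule continuous_on_subset)
    from IVT'_closed_segment_real[OF \<xi>(1) this]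
    obtain r where "r \<in> {dpt a b n i..dpt a b n (Suc i)}" "y r = \<xi>"
      unfolding closed_segment_eq_real_ivl1[OF le] by blast
    then show ?thesis using \<xi>(2) by blast
  qed
  define Q where "Q n i r \<longleftrightarrow> r \<in> {dpt a b n i..dpt a b n (Suc i)} \<and>
      L (y (dpt a b n (Suc i))) = L (y (dpt a b n i))
        + l (y (dpt a b n i)) * (?dy n i)
        + l' (y r) / 2 * (?dy n i)\<^sup>2" for n i r
  define r where "r n i = (SOME r. Q n i r)" for n i
  have Q: "Q n i (r n i)" if "i < 2 ^ n" for n i
    unfolding r_def using ex[OF that] by (intro someI_ex[of "Q n i"]) (auto simp: Q_def)
  have r: "\<And>n i. i < 2 ^ n \<Longrightarrow> r n i \<in> {dpt a b n i..dpt a b n (Suc i)}"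
    "\<And>n i. i < 2 ^ n \<Longrightarrow> L (y (dpt a b n (Suc i))) = L (y (dpt a b n i))
        + l (y (dpt a b n i)) * (?dy n i)
        + l' (y (r n i)) / 2 * (?dy n i)\<^sup>2"
    using Q unfolding Q_def by blast+
  have "(\<lambda>n. \<Sum>i<2 ^ n. l' (y (r n i)) * (?dy n i)\<^sup>2)
      \<longlonglongrightarrow> c * integral {a..b} (\<lambda>r. l' (y r))"
    by (intro has_qv_weighted[OF ab _ qv r(1)] continuous_on_compose2[OF l' y]) auto
  then have "(\<lambda>n. L (y b) - L (y a)
        - 1 / 2 * (\<Sum>i<2 ^ n. l' (y (r n i)) * (?dy n i)\<^sup>2))
      \<longlonglongrightarrow> L (y b) - L (y a) - 1 / 2 * (c * integral {a..b} (\<lambda>r. l' (y r)))"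
    by (intro tendsto_intros)
  moreover have "L (y b) - L (y a)
        - 1 / 2 * (\<Sum>i<2 ^ n. l' (y (r n i)) * (?dy n i)\<^sup>2)
      = (\<Sum>i<2 ^ n. l (y (dpt a b n i)) * (?dy n i))" for n
  proof -
    have "L (y b) - L (y a) = (\<Sum>i<2 ^ n. L (y (dpt a b n (Suc i))) - L (y (dpt a b n i)))"
      using sum_lessThan_telescope[of "\<lambda>i. L (y (dpt a b n i))" "2 ^ n"] by simp
    also have "\<dots> = (\<Sum>i<2 ^ n. l (y (dpt a b n i)) * (?dy n i)
        + 1 / 2 * (l' (y (r n i)) * (?dy n i)\<^sup>2))"
      using r(2) by (intro sum.cong) auto
    finally show ?thesis
      by (simp add: sum.distrib sum_distrib_left)
  qed
  ultimately show ?thesis by simp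
qed

lemma has_qv_add_lipschitz:
  fixes w g y :: "real \<Rightarrow> real"
  assumes ab: "a \<le> b" and w: "continuous_on {a..b} w" and qv: "has_qv a b w c"
    and g: "K-lipschitz_on {a..b} g" and y: "\<And>t. t \<in> {a..b} \<Longrightarrow> y t = g t + s * w t"
  shows "has_qv a b y (s\<^sup>2 * c)"
  unfolding has_qv_def
proof (intro allI impI)
  fix m j :: nat assume j: "j \<le> 2 ^ m"
  have K: "K \<ge> 0" using g by (rule lipschitz_on_nonneg)
  let ?D = "\<lambda>h n i. h (dpt a b (m + n) (Suc i)) - h (dpt a b (m + n) i)"
  have jn: "j * 2 ^ n \<le> 2 ^ (m + n)" for n
    using j by (simp add: power_add)
  have gb: "\<bar>?D g n i\<bar> \<le> K * (b - a) / 2 ^ (m + n)" if "i < j * 2 ^ n" for n i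
  proof -
    have "i < 2 ^ (m + n)" using that jn[of n] by linarith
    then have "{dpt a b (m + n) i..dpt a b (m + n) (Suc i)} \<subseteq> {a..b}"
      by (rule dpt_cell_subset[OF ab])
    then have "dist (g (dpt a b (m + n) (Suc i))) (g (dpt a b (m + n) i))
        \<le> K * dist (dpt a b (m + n) (Suc i)) (dpt a b (m + n) i)"
      using dpt_mono[OF ab, of i "Suc i" "m + n"] by (intro lipschitz_onD[OF g]) auto
    then show ?thesis
      using ab by (simp add: dist_real_def dpt_Suc)
  qed
  have "(\<lambda>n. s\<^sup>2 * (\<Sum>i<j * 2 ^ n. (?D w n i)\<^sup>2)
      + ((\<Sum>i<j * 2 ^ n. (?D y n i)\<^sup>2) - s\<^sup>2 * (\<Sum>i<j * 2 ^ n. (?D w n i)\<^sup>2)))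
      \<longlonglongrightarrow> s\<^sup>2 * (c * (b - a) * real j / 2 ^ m) + 0"
  proof (intro tendsto_add tendsto_mult tendsto_const)
    show "(\<lambda>n. \<Sum>i<j * 2 ^ n. (?D w n i)\<^sup>2) \<longlonglongrightarrow> c * (b - a) * real j / 2 ^ m"
      using qv j unfolding has_qv_def by blast
    show "(\<lambda>n. (\<Sum>i<j * 2 ^ n. (?D y n i)\<^sup>2) - s\<^sup>2 * (\<Sum>i<j * 2 ^ n. (?D w n i)\<^sup>2)) \<longlonglongrightarrow> 0"
    proof (rule LIMSEQ_I)
      fix e :: real assume e: "e > 0"
      define B where "B = K * (b - a)"
      have B: "B \<ge> 0" using K ab by (simp add: B_def)
      define E where "E = \<bar>s\<bar> * B + 1"
      have E: "E > 0" using B by (simp add: E_def add_nonneg_pos)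
      define \<epsilon> where "\<epsilon> = e / 4 / E"
      have \<epsilon>: "\<epsilon> > 0" using e E by (simp add: \<epsilon>_def)
      have "\<epsilon> * (\<bar>s\<bar> * B) \<le> \<epsilon> * E"
        using \<epsilon> by (intro mult_left_mono) (auto simp: E_def)
      also have "\<dots> = e / 4"
        using E by (simp add: \<epsilon>_def)
      finally have "2 * (\<epsilon> * (\<bar>s\<bar> * B)) \<le> e / 2"
        by simp
      have shift: "\<forall>\<^sub>F n in sequentially. P (m + n)" if "\<forall>\<^sub>F n in sequentially. P n" for P
        using that by (subst add.commute, subst eventually_sequentially_seg)
      have "(\<lambda>n. B\<^sup>2 / 2 ^ n) \<longlonglongrightarrow> 0" by (rule mesh_tendsto_0)
      then have "\<forall>\<^sub>F n in sequentially. B\<^sup>2 / 2 ^ n < e / 2"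
        by (rule order_tendstoD) (use e in auto)
      then have "\<forall>\<^sub>F n in sequentially. B\<^sup>2 / 2 ^ (m + n) < e / 2"
        by (rule shift)
      moreover have "\<forall>\<^sub>F n in sequentially. \<forall>i<2 ^ (m + n). \<forall>r\<in>{dpt a b (m + n) i..dpt a b (m + n) (Suc i)}.
           \<forall>r'\<in>{dpt a b (m + n) i..dpt a b (m + n) (Suc i)}. \<bar>w r - w r'\<bar> < \<epsilon>"
        using shift[OF dyadic_oscillation[OF ab w \<epsilon>]] .
      ultimately have "\<forall>\<^sub>F n in sequentially.
        norm ((\<Sum>i<j * 2 ^ n. (?D y n i)\<^sup>2) - s\<^sup>2 * (\<Sum>i<j * 2 ^ n. (?D w n i)\<^sup>2)) < e"
      proof eventually_elim
        case (elim n)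
        let ?N = "2 ^ (m + n) :: real"
        have "\<bar>(?D y n i)\<^sup>2 - s\<^sup>2 * (?D w n i)\<^sup>2\<bar> \<le> 2 * (\<epsilon> * (\<bar>s\<bar> * B)) / ?N + B\<^sup>2 / ?N\<^sup>2"
          if i: "i < j * 2 ^ n" for i
        proof -
          have i': "i < 2 ^ (m + n)" using i jn[of n] by linarith
          have mem: "dpt a b (m + n) i \<in> {a..b}" "dpt a b (m + n) (Suc i) \<in> {a..b}"
            using dpt_ge[OF ab] dpt_le[OF ab, of i "m + n"] dpt_le[OF ab, of "Suc i" "m + n"] i' by auto
          have sq: "(p + s * q)\<^sup>2 - s\<^sup>2 * q\<^sup>2 = 2 * (q * (s * p)) + p\<^sup>2" for p q :: real
            by (simp add: power2_eq_square algebra_simps)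
          have eq: "?D y n i = ?D g n i + s * ?D w n i"
            using y mem by (simp add: algebra_simps)
          have "(?D y n i)\<^sup>2 - s\<^sup>2 * (?D w n i)\<^sup>2 = 2 * (?D w n i * (s * ?D g n i)) + (?D g n i)\<^sup>2"
            unfolding eq by (rule sq)
          also have "\<bar>\<dots>\<bar> \<le> 2 * (\<bar>?D w n i\<bar> * (\<bar>s\<bar> * \<bar>?D g n i\<bar>)) + \<bar>?D g n i\<bar>\<^sup>2"
            by (rule order_trans[OF abs_triangle_ineq]) (simp add: abs_mult)
          also have "\<dots> \<le> 2 * (\<epsilon> * (\<bar>s\<bar> * (B / ?N))) + (B / ?N)\<^sup>2"
          proof -
            have "\<bar>?D w n i\<bar> \<le> \<epsilon>"
              using elim(2) i' dpt_mono[OF ab, of i "Suc i" "m + n"] by (auto intro!: less_imp_le)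
            moreover have "\<bar>?D g n i\<bar> \<le> B / ?N"
              using gb[OF i] by (simp add: B_def)
            ultimately show ?thesis
              using \<epsilon> B by (intro add_mono mult_left_mono mult_mono power_mono) auto
          qed
          finally show ?thesis by (simp add: power_divide)
        qed
        then have "\<bar>\<Sum>i<j * 2 ^ n. (?D y n i)\<^sup>2 - s\<^sup>2 * (?D w n i)\<^sup>2\<bar>
            \<le> (\<Sum>i<j * 2 ^ n. 2 * (\<epsilon> * (\<bar>s\<bar> * B)) / ?N + B\<^sup>2 / ?N\<^sup>2)"
          by (intro order_trans[OF sum_abs] sum_mono) auto
        also have "\<dots> \<le> ?N * (2 * (\<epsilon> * (\<bar>s\<bar> * B)) / ?N + B\<^sup>2 / ?N\<^sup>2)"
        proof -
          have "real (j * 2 ^ n) \<le> ?N"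
            using jn[of n] by (metis of_nat_le_iff of_nat_numeral of_nat_power)
          moreover have "0 \<le> 2 * (\<epsilon> * (\<bar>s\<bar> * B)) / ?N + B\<^sup>2 / ?N\<^sup>2"
            using \<epsilon> B by simp
          ultimately show ?thesis
            unfolding sum_constant card_lessThan by (rule mult_right_mono)
        qed
        also have "\<dots> = 2 * (\<epsilon> * (\<bar>s\<bar> * B)) + B\<^sup>2 / ?N"
          by (simp add: field_simps power2_eq_square)
        also have "\<dots> < e"
          using elim(1) \<open>2 * (\<epsilon> * (\<bar>s\<bar> * B)) \<le> e / 2\<close> by linarith
        finally show ?case by (simp add: sum_subtractf sum_distrib_left)
      qed
      then show "\<exists>no. \<forall>n\<ge>no. norm ((\<Sum>i<j * 2 ^ n. (?D y n i)\<^sup>2)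
          - s\<^sup>2 * (\<Sum>i<j * 2 ^ n. (?D w n i)\<^sup>2) - 0) < e"
        by (simp add: eventually_sequentially)
    qed
  qed
  then show "(\<lambda>n. \<Sum>i<j * 2 ^ n. (?D y n i)\<^sup>2) \<longlonglongrightarrow> s\<^sup>2 * c * (b - a) * real j / 2 ^ m"
    by (simp add: algebra_simps)
qed

section \<open>Convergence of the Euler scheme\<close>

lemma continuous_on_compact_abs_bound:
  fixes f :: "'b::topological_space \<Rightarrow> real"
  assumes "continuous_on S f" "compact S"
  obtains B where "B > 0" "\<And>x. x \<in> S \<Longrightarrow> \<bar>f x\<bar> \<le> B"
proof -
  have "bounded (f ` S)"
    using assms by (intro compact_imp_bounded compact_continuous_image)
  then show ?thesis
    using that unfolding bounded_pos by force
qed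

lemma C1_lipschitz_on_compact:
  fixes f f' :: "real \<Rightarrow> real"
  assumes f: "\<And>v. (f has_real_derivative f' v) (at v)" and f': "continuous_on UNIV f'"
  shows "\<exists>K\<ge>0. \<forall>u\<in>{a..b}. \<forall>v\<in>{a..b}. \<bar>f u - f v\<bar> \<le> K * \<bar>u - v\<bar>"
proof -
  obtain K where K: "K > 0" "\<And>v. v \<in> {a..b} \<Longrightarrow> \<bar>f' v\<bar> \<le> K"
    using continuous_on_compact_abs_bound[OF continuous_on_subset[OF f'] compact_Icc, of a b] by blast
  have "norm (f u - f v) \<le> K * norm (u - v)" if "u \<in> {a..b}" "v \<in> {a..b}" for u v
  proof (rule field_differentiable_bound[of "{a..b}" f f' K u v])
    fix z assume "z \<in> {a..b}"
    then show "(f has_field_derivative f' z) (at z within {a..b})" "norm (f' z) \<le> K"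
      using f K by (auto intro: has_field_derivative_at_within)
  qed (use that in auto)
  then show ?thesis using K(1) by (intro exI[of _ K]) auto
qed

lemma euler_scheme_converges:
  fixes lam lam' X w :: "real \<Rightarrow> real" and \<sigma> T :: real and E :: "nat \<Rightarrow> nat \<Rightarrow> real"
  assumes T: "T \<ge> 0" and lam: "\<And>v. (lam has_real_derivative lam' v) (at v)"
    and lam': "continuous_on UNIV lam'"
    and X: "continuous_on {0..T} X"
    and incr: "\<And>s t. 0 \<le> s \<Longrightarrow> s \<le> t \<Longrightarrow> t \<le> T \<Longrightarrow>
        X t - X s = integral {s..t} (\<lambda>r. lam (X r)) + \<sigma> * (w t - w s)"
    and E0: "\<And>n. E n 0 = X 0"
    and ES: "\<And>n i. i < 2 ^ n \<Longrightarrow> E n (Suc i) = E n i + lam (E n i) * (T / 2 ^ n)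
        + \<sigma> * (w (dpt 0 T n (Suc i)) - w (dpt 0 T n i))"
    and \<epsilon>: "\<epsilon> > 0"
  shows "\<forall>\<^sub>F n in sequentially. \<forall>i\<le>2 ^ n. \<bar>E n i - X (dpt 0 T n i)\<bar> < \<epsilon>"
proof -
  obtain R where R: "R > 0" "\<And>t. t \<in> {0..T} \<Longrightarrow> \<bar>X t\<bar> \<le> R"
    by (rule continuous_on_compact_abs_bound[OF X compact_Icc]) (rule that)
  from C1_lipschitz_on_compact[OF lam lam', of "-R-1" "R+1"]
  obtain K where K0: "K \<ge> 0"
    "\<forall>u\<in>{-R-1..R+1}. \<forall>v\<in>{-R-1..R+1}. \<bar>lam u - lam v\<bar> \<le> K * \<bar>u - v\<bar>"
    by (elim exE conjE)
  note K = K0(1) K0(2)[rule_format]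
  define \<delta> where "\<delta> = min 1 \<epsilon> / (2 * ((T + 1) * exp (K * T)))"
  have \<delta>: "\<delta> > 0" using \<epsilon> T by (auto simp: \<delta>_def)
  have "\<delta> * (T * exp (K * T)) \<le> \<delta> * ((T + 1) * exp (K * T))"
    using \<delta> by (intro mult_left_mono mult_right_mono) auto
  also have "\<dots> = min 1 \<epsilon> / 2"
    using add_nonneg_pos[OF T zero_less_one] by (simp add: \<delta>_def)
  finally have bnd: "\<delta> * (T * exp (K * T)) \<le> min 1 \<epsilon> / 2" .
  have contl: "continuous_on {0..T} (\<lambda>r. lam (X r))"
    by (rule continuous_on_compose2[OF DERIV_continuous_on[of UNIV lam lam'] X]) (auto simp: lam)
  show ?thesis
    using dyadic_oscillation[OF T contl \<delta>]
  proof eventually_elim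
    case (elim n)
    define h where "h = T / 2 ^ n"
    have h: "h \<ge> 0" using T by (simp add: h_def)
    have hi: "real i * h \<le> T" if "i \<le> 2 ^ n" for i
    proof -
      have "real i \<le> 2 ^ n" using that by (metis of_nat_le_iff of_nat_numeral of_nat_power)
      then have "real i * h \<le> 2 ^ n * h" by (rule mult_right_mono) (rule h)
      then show ?thesis by (simp add: h_def)
    qed
    let ?t = "dpt 0 T n"
    have main: "\<bar>E n i - X (?t i)\<bar> \<le> \<delta> * (real i * h * exp (K * (real i * h)))" if "i \<le> 2 ^ n" for i
      using that
    proof (induction i)
      case 0
      then show ?case by (simp add: E0)
    next
      case (Suc i)
      then have i: "i < 2 ^ n" by simp
      note IH = Suc.IH[OF less_imp_le[OF i]]
      have sub: "{?t i..?t (Suc i)} \<subseteq> {0..T}" by (rule dpt_cell_subset[OF T i])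
      have le: "?t i \<le> ?t (Suc i)" by (intro dpt_mono T) auto
      have ti: "?t i \<in> {0..T}" "?t (Suc i) \<in> {0..T}" using sub le by auto
      have "real i * h * exp (K * (real i * h)) \<le> T * exp (K * T)"
        using hi[OF less_imp_le[OF i]] K(1) h T by (intro mult_mono) (auto intro: mult_left_mono)
      then have "\<bar>E n i - X (?t i)\<bar> \<le> \<delta> * (T * exp (K * T))"
        using IH \<delta> by (meson mult_left_mono less_imp_le order_trans)
      then have e1: "\<bar>E n i - X (?t i)\<bar> \<le> 1" using bnd by linarith
      have lip: "\<bar>lam (E n i) - lam (X (?t i))\<bar> \<le> K * \<bar>E n i - X (?t i)\<bar>"
        using R(2)[OF ti(1)] e1 by (intro K(2)) auto
      have c: "continuous_on {?t i..?t (Suc i)} (\<lambda>r. lam (X r))"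
        by (rule continuous_on_subset[OF contl sub])
      have int: "integral {?t i..?t (Suc i)} (\<lambda>r. lam (X (?t i)) - lam (X r))
          = lam (X (?t i)) * h - integral {?t i..?t (Suc i)} (\<lambda>r. lam (X r))"
        using c le by (subst Henstock_Kurzweil_Integration.integral_diff)
          (auto simp: h_def dpt_Suc intro!: integrable_continuous_interval)
      have "norm (integral {?t i..?t (Suc i)} (\<lambda>r. lam (X (?t i)) - lam (X r))) \<le> \<delta> * (?t (Suc i) - ?t i)"
        using elim i le by (intro integral_bound continuous_intros c ballI) (auto intro!: less_imp_le)
      then have r: "\<bar>lam (X (?t i)) * h - integral {?t i..?t (Suc i)} (\<lambda>r. lam (X r))\<bar> \<le> \<delta> * h"
        unfolding int by (simp add: h_def dpt_Suc)
      have "E n (Suc i) - X (?t (Suc i)) = (E n i - X (?t i)) + (lam (E n i) - lam (X (?t i))) * h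
          + (lam (X (?t i)) * h - integral {?t i..?t (Suc i)} (\<lambda>r. lam (X r)))"
        using incr[of "?t i" "?t (Suc i)"] ti le ES[OF i] by (simp add: h_def algebra_simps)
      also have "\<bar>\<dots>\<bar> \<le> \<bar>E n i - X (?t i)\<bar> + \<bar>lam (E n i) - lam (X (?t i))\<bar> * h + \<delta> * h"
        using r h by (intro order_trans[OF abs_triangle_ineq] add_mono) (auto simp: abs_mult)
      also have "\<dots> \<le> \<bar>E n i - X (?t i)\<bar> + K * \<bar>E n i - X (?t i)\<bar> * h + \<delta> * h"
        using lip h by (intro add_mono mult_right_mono) auto
      also have "\<dots> = (1 + K * h) * \<bar>E n i - X (?t i)\<bar> + \<delta> * h"
        by (simp add: algebra_simps)
      also have "\<dots> \<le> exp (K * h) * (\<delta> * (real i * h * exp (K * (real i * h)))) + \<delta> * h * exp (K * (real (Suc i) * h))"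
      proof (rule add_mono)
        show "(1 + K * h) * \<bar>E n i - X (?t i)\<bar> \<le> exp (K * h) * (\<delta> * (real i * h * exp (K * (real i * h))))"
          using IH by (intro mult_mono exp_ge_add_one_self) auto
        have "\<delta> * h * 1 \<le> \<delta> * h * exp (K * (real (Suc i) * h))"
          using K(1) h \<delta> by (intro mult_left_mono) auto
        then show "\<delta> * h \<le> \<delta> * h * exp (K * (real (Suc i) * h))" by simp
      qed
      also have "\<dots> = \<delta> * (real i * h * (exp (K * h) * exp (K * (real i * h)))) + \<delta> * h * exp (K * (real (Suc i) * h))"
        by (simp add: algebra_simps)
      also have "exp (K * h) * exp (K * (real i * h)) = exp (K * (real (Suc i) * h))"
        by (simp add: exp_add[symmetric] algebra_simps)
      finally show ?case by (simp add: algebra_simps)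
    qed
    show ?case
    proof (intro allI impI)
      fix i :: nat assume i: "i \<le> 2 ^ n"
      have "real i * h * exp (K * (real i * h)) \<le> T * exp (K * T)"
        using hi[OF i] K(1) h T by (intro mult_mono) (auto intro: mult_left_mono)
      then have "\<bar>E n i - X (?t i)\<bar> \<le> \<delta> * (T * exp (K * T))"
        using main[OF i] \<delta> by (meson mult_left_mono less_imp_le order_trans)
      then show "\<bar>E n i - X (?t i)\<bar> < \<epsilon>" using bnd \<epsilon> by linarith
    qed
  qed
qed

lemma euler_riemann_sum_tendsto:
  fixes X V :: "real \<Rightarrow> real" and E :: "nat \<Rightarrow> nat \<Rightarrow> real"
  assumes T: "T \<ge> 0" and X: "continuous_on {0..T} X" and V: "continuous_on UNIV V"
    and E: "\<And>\<epsilon>. \<epsilon> > 0 \<Longrightarrow> \<forall>\<^sub>F n in sequentially. \<forall>i\<le>2 ^ n. \<bar>E n i - X (dpt 0 T n i)\<bar> < \<epsilon>"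
  shows "(\<lambda>n. \<Sum>i<2 ^ n. V (E n i) * (T / 2 ^ n)) \<longlonglongrightarrow> integral {0..T} (\<lambda>r. V (X r))"
proof -
  let ?S = "\<lambda>n. \<Sum>i<2 ^ n. V (E n i) * (T / 2 ^ n)"
  let ?R = "\<lambda>n. \<Sum>i<2 ^ n. V (X (dpt 0 T n i)) * (T / 2 ^ n)"
  obtain R where R: "R > 0" "\<And>t. t \<in> {0..T} \<Longrightarrow> \<bar>X t\<bar> \<le> R"
    by (rule continuous_on_compact_abs_bound[OF X compact_Icc]) (rule that)
  have uc: "uniformly_continuous_on {-R-1..R+1} V"
    using continuous_on_subset[OF V] by (intro compact_uniformly_continuous) auto
  have "(\<lambda>n. \<Sum>i<2 ^ n. V (X (dpt 0 T n i)) * (T / 2 ^ n)) \<longlonglongrightarrow> integral {0..T} (\<lambda>r. V (X r))"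
    using riemann_sum_tendsto[OF T continuous_on_compose2[OF V X]] by simp
  moreover have "(\<lambda>n. ?S n - ?R n) \<longlonglongrightarrow> 0"
  proof (rule LIMSEQ_I)
    fix e :: real assume e: "e > 0"
    define \<epsilon> where "\<epsilon> = e / (T + 1)"
    have \<epsilon>: "\<epsilon> > 0" "\<epsilon> * T < e" using e T by (auto simp: \<epsilon>_def field_simps)
    obtain d where d: "d > 0" "\<And>u v. u \<in> {-R-1..R+1} \<Longrightarrow> v \<in> {-R-1..R+1} \<Longrightarrow> \<bar>v - u\<bar> < d \<Longrightarrow> \<bar>V v - V u\<bar> < \<epsilon>"
      using uc \<epsilon>(1) unfolding uniformly_continuous_on_def dist_real_def by metis
    have "\<forall>\<^sub>F n in sequentially. norm (?S n - ?R n - 0) < e"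
      using E[OF d(1)] E[OF zero_less_one]
    proof eventually_elim
      case (elim n)
      have "\<bar>\<Sum>i<2 ^ n. (V (E n i) - V (X (dpt 0 T n i))) * (T / 2 ^ n)\<bar> \<le> (\<Sum>i<(2::nat) ^ n. \<epsilon> * (T / 2 ^ n))"
      proof (intro order_trans[OF sum_abs] sum_mono)
        fix i :: nat assume "i \<in> {..<2 ^ n}"
        then have i: "i \<le> 2 ^ n" by simp
        then have "\<bar>E n i - X (dpt 0 T n i)\<bar> < d" "\<bar>E n i - X (dpt 0 T n i)\<bar> < 1" using elim by auto
        moreover have "\<bar>X (dpt 0 T n i)\<bar> \<le> R" using R(2) dpt_ge[OF T] dpt_le[OF T i] by auto
        ultimately have "\<bar>V (E n i) - V (X (dpt 0 T n i))\<bar> \<le> \<epsilon>" by (intro less_imp_le d(2)) auto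
        then show "\<bar>(V (E n i) - V (X (dpt 0 T n i))) * (T / 2 ^ n)\<bar> \<le> \<epsilon> * (T / 2 ^ n)"
          using T unfolding abs_mult by (simp add: mult_right_mono divide_right_mono)
      qed
      moreover have "?S n - ?R n
          = (\<Sum>i<2 ^ n. (V (E n i) - V (X (dpt 0 T n i))) * (T / 2 ^ n))"
        by (simp only: sum_subtractf left_diff_distrib)
      moreover have "(\<Sum>i<(2::nat) ^ n. \<epsilon> * (T / 2 ^ n)) < e"
        using \<epsilon>(2) by simp
      ultimately show ?case unfolding real_norm_def diff_0_right by linarith
    qed
    then show "\<exists>no. \<forall>n\<ge>no. norm (?S n - ?R n - 0) < e"
      by (simp add: eventually_sequentially)
  qed
  ultimately have "(\<lambda>n. ?R n + (?S n - ?R n))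
      \<longlonglongrightarrow> integral {0..T} (\<lambda>r. V (X r)) + 0"
    by (rule tendsto_add)
  then show ?thesis by simp
qed

section \<open>Growth of the potential\<close>

lemma classD_derivative:
  assumes "lam \<in> classD"
  shows "(lam has_real_derivative deriv lam v) (at v)" "continuous_on UNIV (deriv lam)"
proof -
  from assms obtain D where D: "\<And>v. (lam has_vector_derivative D v) (at v)" "continuous_on UNIV D"
    unfolding classD_def C1_differentiable_on_def by auto
  then have "\<And>v. (lam has_real_derivative D v) (at v)"
    by (simp add: has_real_derivative_iff_has_vector_derivative)
  moreover from this have "deriv lam = D"
    by (intro ext DERIV_imp_deriv)
  ultimately show "(lam has_real_derivative deriv lam v) (at v)" "continuous_on UNIV (deriv lam)"
    using D by simp_all
qed

lemma classD_zero:
  assumes "lam \<in> classD"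
  shows "lam (zero_of lam) = 0" "y > zero_of lam \<Longrightarrow> lam y < 0" "y < zero_of lam \<Longrightarrow> lam y > 0"
proof -
  have anti: "\<And>u v. u < v \<Longrightarrow> lam v < lam u"
    using assms unfolding classD_def monotone_on_def by auto
  obtain \<theta> where \<theta>: "lam \<theta> = 0" using assms unfolding classD_def by auto
  have "z = \<theta>" if "lam z = 0" for z
    using anti[of z \<theta>] anti[of \<theta> z] \<theta> that by (metis less_irrefl neqE)
  with \<theta> have "zero_of lam = \<theta>"
    unfolding zero_of_def by (intro the_equality)
  with \<theta> show z: "lam (zero_of lam) = 0" by simp
  show "lam y < 0" if "y > zero_of lam"
    using anti[OF that] z by simp
  show "lam y > 0" if "y < zero_of lam"
    using anti[OF that] z by simp
qed

lemma continuous_eventually_ge_imp_bounded_below: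
  fixes f :: "real \<Rightarrow> real"
  assumes f: "continuous_on UNIV f" and ev: "\<forall>\<^sub>F y in at_infinity. f y \<ge> c"
  shows "\<exists>C. \<forall>y. f y \<ge> C"
proof -
  obtain R where R: "\<And>y. norm y \<ge> R \<Longrightarrow> f y \<ge> c"
    using ev unfolding eventually_at_infinity by blast
  obtain B where B: "\<And>y. norm y \<le> R \<Longrightarrow> \<bar>f y\<bar> \<le> B"
    using continuous_on_compact_abs_bound[OF continuous_on_subset[OF f] compact_cball, of 0 R]
    by (metis UNIV_I mem_cball_0 subsetI)
  have "f y \<ge> min c (- B)" for y
    using R[of y] B[of y] by (cases "norm y \<le> R") auto
  then show ?thesis by blast
qed

lemma killing_rate_bounded_below:
  assumes s: "\<sigma> > 0" and lam: "lam \<in> classD" and rho: "rho \<sigma> lam < 1"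
  shows "\<exists>C. \<forall>y. (lam y)\<^sup>2 / \<sigma>\<^sup>2 + deriv lam y \<ge> C"
proof (rule continuous_eventually_ge_imp_bounded_below)
  have "continuous_on UNIV lam"
    using classD_derivative(1)[OF lam] by (auto intro!: DERIV_continuous_on)
  then show "continuous_on UNIV (\<lambda>y. (lam y)\<^sup>2 / \<sigma>\<^sup>2 + deriv lam y)"
    using s classD_derivative(2)[OF lam] by (intro continuous_intros) auto
  have "\<forall>\<^sub>F y in at_infinity. ereal (\<sigma>\<^sup>2 * neg_deriv lam y / (lam y)\<^sup>2) < 1"
    using rho unfolding rho_def by (rule Limsup_lessD)
  moreover have "\<forall>\<^sub>F y in at_infinity. norm y \<ge> \<bar>zero_of lam\<bar> + 1"
    by (auto simp: eventually_at_infinity)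
  ultimately show "\<forall>\<^sub>F y in at_infinity. (lam y)\<^sup>2 / \<sigma>\<^sup>2 + deriv lam y \<ge> 0"
  proof eventually_elim
    case (elim y)
    then have "y \<noteq> zero_of lam" by auto
    then have "lam y \<noteq> 0"
      using classD_zero(2,3)[OF lam, of y] by (metis less_irrefl neqE)
    then have pos: "(lam y)\<^sup>2 > 0" by simp
    have "\<sigma>\<^sup>2 * (- deriv lam y) / (lam y)\<^sup>2 < 1"
      using elim(1) by (simp only: neg_deriv_def one_ereal_def less_ereal.simps)
    then have "\<sigma>\<^sup>2 * (- deriv lam y) < (lam y)\<^sup>2"
      unfolding pos_divide_less_eq[OF pos] by simp
    then have "- deriv lam y < (lam y)\<^sup>2 / \<sigma>\<^sup>2"
      using s by (subst pos_less_divide_eq) (auto simp: mult.commute)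
    then show ?case by simp
  qed
qed

lemma potential_superquadratic:
  assumes lam: "lam \<in> classD" and sup: "superlinear lam" and A: "A > 0"
    and L: "\<And>v. (L has_real_derivative lam v) (at v)"
  shows "\<exists>C. \<forall>y. - L y \<ge> A * (y - zero_of lam)\<^sup>2 + C"
proof -
  define \<theta> where "\<theta> = zero_of lam"
  define G where "G y = - L y - A * (y - \<theta>)\<^sup>2" for y
  have G: "(G has_real_derivative (- lam y - A * (2 * (y - \<theta>)))) (at y)" for y
  proof -
    have "((\<lambda>y. A * (y - \<theta>)\<^sup>2) has_real_derivative A * (2 * (y - \<theta>))) (at y)"
      by (auto intro!: derivative_eq_intros)
    from DERIV_diff[OF DERIV_minus[OF L[of y]] this] show ?thesis
      unfolding G_def .
  qed
  have contG: "continuous_on UNIV G"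
    by (rule DERIV_continuous_on) (rule has_field_derivative_at_within[OF G])
  have "\<forall>\<^sub>F y in at_infinity. 2 * A \<le> \<bar>lam y\<bar> / \<bar>y - \<theta>\<bar>"
    using sup unfolding superlinear_def filterlim_at_top \<theta>_def by blast
  then obtain R0 where R0: "\<And>y. norm y \<ge> R0 \<Longrightarrow> 2 * A \<le> \<bar>lam y\<bar> / \<bar>y - \<theta>\<bar>"
    unfolding eventually_at_infinity by blast
  define R where "R = max R0 (\<bar>\<theta>\<bar> + 1)"
  have big: "2 * A * \<bar>y - \<theta>\<bar> \<le> \<bar>lam y\<bar>" if "\<bar>y\<bar> \<ge> R" for y
  proof -
    have "\<bar>y - \<theta>\<bar> > 0" using that by (auto simp: R_def)
    then show ?thesis
      using R0[of y] that by (simp add: R_def pos_le_divide_eq)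
  qed
  have right: "G R \<le> G y" if "y \<ge> R" for y
  proof (rule DERIV_nonneg_imp_nondecreasing[OF that])
    fix z assume z: "R \<le> z" "z \<le> y"
    then have "z > \<theta>" by (auto simp: R_def)
    moreover have "lam z < 0" using calculation classD_zero(2)[OF lam] by (simp add: \<theta>_def)
    ultimately have "0 \<le> - lam z - A * (2 * (z - \<theta>))"
      using big[of z] z by (simp add: algebra_simps)
    then show "\<exists>d. (G has_real_derivative d) (at z) \<and> 0 \<le> d" using G by blast
  qed
  have left: "G (- R) \<le> G y" if "y \<le> - R" for y
  proof (rule DERIV_nonpos_imp_nonincreasing[OF that])
    fix z assume z: "y \<le> z" "z \<le> - R"
    then have "z < \<theta>" by (auto simp: R_def)
    moreover have "lam z > 0" using calculation classD_zero(3)[OF lam] by (simp add: \<theta>_def)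
    ultimately have "- lam z - A * (2 * (z - \<theta>)) \<le> 0"
      using big[of z] z by (simp add: algebra_simps)
    then show "\<exists>d. (G has_real_derivative d) (at z) \<and> d \<le> 0" using G by blast
  qed
  have "\<forall>\<^sub>F y in at_infinity. G y \<ge> min (G R) (G (- R))"
    unfolding eventually_at_infinity
  proof (intro exI allI impI)
    fix y :: real assume "R \<le> norm y"
    then have "R \<le> y \<or> y \<le> - R" by auto
    then show "min (G R) (G (- R)) \<le> G y"
      using left[of y] right[of y] by (auto simp: min_le_iff_disj)
  qed
  from continuous_eventually_ge_imp_bounded_below[OF contG this] obtain C where "\<And>y. G y \<ge> C" by blast
  then have "- L y \<ge> A * (y - zero_of lam)\<^sup>2 + C" for y
    unfolding G_def \<theta>_def by (simp add: algebra_simps)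
  then show ?thesis by blast
qed

lemma antiderivative_exists:
  fixes f :: "real \<Rightarrow> real"
  assumes "continuous_on UNIV f"
  shows "\<exists>L. \<forall>v. (L has_real_derivative f v) (at v)"
proof -
  have "\<exists>L. \<forall>v::real. -\<infinity> < ereal v \<longrightarrow> ereal v < \<infinity> \<longrightarrow> (L has_vector_derivative f v) (at v)"
    using assms by (intro einterval_antiderivative) (auto simp: continuous_on_eq_continuous_at)
  then show ?thesis
    by (auto simp: has_real_derivative_iff_has_vector_derivative)
qed

section \<open>Gaussian increments\<close>

definition gauss :: "real \<Rightarrow> real measure" where
  "gauss h = density lborel (\<lambda>z. ennreal (normal_density 0 (sqrt h) z))"

lemma sets_gauss [simp, measurable_cong]: "sets (gauss h) = sets borel"
  by (simp add: gauss_def)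

lemma space_gauss [simp]: "space (gauss h) = UNIV"
  by (simp add: gauss_def)

lemma prob_space_gauss: "h > 0 \<Longrightarrow> prob_space (gauss h)"
  unfolding gauss_def by (intro prob_space_normal_density) simp

lemma nn_integral_gauss:
  assumes "f \<in> borel_measurable borel"
  shows "(\<integral>\<^sup>+z. f z \<partial>gauss h) = (\<integral>\<^sup>+z. ennreal (normal_density 0 (sqrt h) z) * f z \<partial>lborel)"
  unfolding gauss_def using assms by (intro nn_integral_density) auto

lemma gauss_shift:
  assumes h: "h > 0" and f [measurable]: "f \<in> borel_measurable borel"
  shows "(\<integral>\<^sup>+z. f (z + a * h) \<partial>gauss h) = (\<integral>\<^sup>+z. f z * ennreal (exp (a * z - a\<^sup>2 * h / 2)) \<partial>gauss h)"
proof -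
  have dens: "normal_density 0 (sqrt h) (a * h + z) * exp (a * (a * h + z) - a\<^sup>2 * h / 2)
      = normal_density 0 (sqrt h) z" for z
  proof -
    have "- ((a * h + z)\<^sup>2 / (2 * h)) + (a * (a * h + z) - a\<^sup>2 * h / 2) = - (z\<^sup>2 / (2 * h))"
      using h by (simp add: field_simps power2_eq_square)
    then have "exp (- ((a * h + z)\<^sup>2 / (2 * h))) * exp (a * (a * h + z) - a\<^sup>2 * h / 2) = exp (- (z\<^sup>2 / (2 * h)))"
      by (simp only: exp_add[symmetric])
    then show ?thesis
      using h by (simp add: normal_density_def)
  qed
  have "(\<integral>\<^sup>+z. f z * ennreal (exp (a * z - a\<^sup>2 * h / 2)) \<partial>gauss h)
      = (\<integral>\<^sup>+z. ennreal (normal_density 0 (sqrt h) z) * (f z * ennreal (exp (a * z - a\<^sup>2 * h / 2))) \<partial>lborel)"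
    by (intro nn_integral_gauss) measurable
  also have "\<dots> = (\<integral>\<^sup>+z. ennreal (normal_density 0 (sqrt h) (a * h + z))
      * (f (a * h + z) * ennreal (exp (a * (a * h + z) - a\<^sup>2 * h / 2))) \<partial>lborel)"
    by (subst nn_integral_real_affine[of _ 1 "a * h"]) auto
  also have "\<dots> = (\<integral>\<^sup>+z. ennreal (normal_density 0 (sqrt h) z) * f (z + a * h) \<partial>lborel)"
  proof (intro nn_integral_cong)
    fix z
    have "ennreal (normal_density 0 (sqrt h) (a * h + z)) * ennreal (exp (a * (a * h + z) - a\<^sup>2 * h / 2))
        = ennreal (normal_density 0 (sqrt h) z)"
      using dens[of z] by (simp add: ennreal_mult[symmetric])
    then have "(ennreal (normal_density 0 (sqrt h) (a * h + z)) * ennreal (exp (a * (a * h + z) - a\<^sup>2 * h / 2))) * f (a * h + z)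
        = ennreal (normal_density 0 (sqrt h) z) * f (z + a * h)"
      by (simp only: add.commute[of z])
    then show "ennreal (normal_density 0 (sqrt h) (a * h + z)) * (f (a * h + z) * ennreal (exp (a * (a * h + z) - a\<^sup>2 * h / 2)))
        = ennreal (normal_density 0 (sqrt h) z) * f (z + a * h)"
      by (simp only: mult_ac)
  qed
  also have "\<dots> = (\<integral>\<^sup>+z. f (z + a * h) \<partial>gauss h)"
    by (intro nn_integral_gauss[symmetric]) measurable
  finally show ?thesis ..
qed

lemma gauss_exp_martingale:
  assumes h: "h > 0"
  shows "(\<integral>\<^sup>+z. ennreal (exp (a * z - a\<^sup>2 * h / 2)) \<partial>gauss h) = 1"
  using gauss_shift[OF h, of "\<lambda>_. 1" a] prob_space.emeasure_space_1[OF prob_space_gauss[OF h]] by simp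

lemma gauss_centered_square_moment:
  assumes h: "h > 0"
  shows "(\<integral>\<^sup>+z. ennreal ((q + (z\<^sup>2 - h))\<^sup>2) \<partial>gauss h) = ennreal (q\<^sup>2 + 2 * h\<^sup>2)"
proof -
  let ?n = "normal_density 0 (sqrt h)"
  have s: "sqrt h > 0" using h by simp
  have m0: "has_bochner_integral lborel ?n 1"
    using normal_moment_even[OF s, of 0 0] by simp
  have m2: "has_bochner_integral lborel (\<lambda>x. ?n x * x\<^sup>2) h"
    using normal_moment_even[OF s, of 0 1] h by (simp add: fact_numeral)
  have m4: "has_bochner_integral lborel (\<lambda>x. ?n x * x ^ 4) (3 * h\<^sup>2)"
    using normal_moment_even[OF s, of 0 2] h by (simp add: fact_numeral power_divide power2_eq_square)
  have "has_bochner_integral lborel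
      (\<lambda>x. ?n x * x ^ 4 + (2 * (q - h)) * (?n x * x\<^sup>2) + (q - h)\<^sup>2 * ?n x)
      (3 * h\<^sup>2 + (2 * (q - h)) * h + (q - h)\<^sup>2 * 1)"
    by (intro has_bochner_integral_add has_bochner_integral_mult_right m0 m2 m4)
  also have "(\<lambda>x. ?n x * x ^ 4 + (2 * (q - h)) * (?n x * x\<^sup>2) + (q - h)\<^sup>2 * ?n x)
      = (\<lambda>x. ?n x * (q + (x\<^sup>2 - h))\<^sup>2)"
    by (rule ext) (simp add: power2_eq_square power4_eq_xxxx algebra_simps)
  also have "3 * h\<^sup>2 + (2 * (q - h)) * h + (q - h)\<^sup>2 * 1 = q\<^sup>2 + 2 * h\<^sup>2"
    by (simp add: power2_eq_square algebra_simps)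
  finally have I: "has_bochner_integral lborel (\<lambda>x. ?n x * (q + (x\<^sup>2 - h))\<^sup>2) (q\<^sup>2 + 2 * h\<^sup>2)" .
  have "(\<integral>\<^sup>+z. ennreal ((q + (z\<^sup>2 - h))\<^sup>2) \<partial>gauss h)
      = (\<integral>\<^sup>+z. ennreal (?n z) * ennreal ((q + (z\<^sup>2 - h))\<^sup>2) \<partial>lborel)"
    by (intro nn_integral_gauss) measurable
  also have "\<dots> = (\<integral>\<^sup>+z. ennreal (?n z * (q + (z\<^sup>2 - h))\<^sup>2) \<partial>lborel)"
    by (simp add: ennreal_mult)
  also have "\<dots> = ennreal (q\<^sup>2 + 2 * h\<^sup>2)"
    using I by (subst nn_integral_eq_integral) (auto simp: has_bochner_integral_iff)
  finally show ?thesis .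
qed

locale brownian = filtered_prob_space M F
  for M :: "'a measure" and F :: "real \<Rightarrow> 'a measure" +
  fixes W :: "real \<Rightarrow> 'a \<Rightarrow> real"
  assumes brownian: "brownian_motion M F W"
begin

lemma measurable_F_mono: "f \<in> measurable (F s) N \<Longrightarrow> s \<le> t \<Longrightarrow> f \<in> measurable (F t) N"
  by (rule measurable_from_subalg) (use sets_F_mono space_F in \<open>auto simp: subalgebra_def\<close>)

lemma measurable_F_M: "f \<in> measurable (F s) N \<Longrightarrow> f \<in> measurable M N"
  by (rule measurable_from_subalg[OF subalgebra_F])

lemma W_measurable: "0 \<le> t \<Longrightarrow> W t \<in> borel_measurable (F t)"
  using brownian unfolding brownian_motion_def continuous_adapted_def by blast

lemma W_measurable': "0 \<le> s \<Longrightarrow> s \<le> t \<Longrightarrow> W s \<in> borel_measurable (F t)"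
  by (rule measurable_F_mono[OF W_measurable])

lemma W_measurable_M [measurable]: "0 \<le> t \<Longrightarrow> W t \<in> borel_measurable M"
  by (rule measurable_F_M[OF W_measurable])

lemma W_continuous: "\<omega> \<in> space M \<Longrightarrow> continuous_on {0..} (\<lambda>t. W t \<omega>)"
  using brownian unfolding brownian_motion_def continuous_adapted_def by blast

lemma increment_distr:
  assumes "0 \<le> s" "s < t"
  shows "distr M borel (\<lambda>\<omega>. W t \<omega> - W s \<omega>) = gauss (t - s)"
proof -
  have "distributed M lborel (\<lambda>\<omega>. W t \<omega> - W s \<omega>) (\<lambda>x. ennreal (normal_density 0 (sqrt (t - s)) x))"
    using brownian assms unfolding brownian_motion_def by blast
  then have "distr M lborel (\<lambda>\<omega>. W t \<omega> - W s \<omega>) = gauss (t - s)"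
    unfolding gauss_def by (rule distributed_distr_eq_density)
  moreover have "distr M lborel (\<lambda>\<omega>. W t \<omega> - W s \<omega>) = distr M borel (\<lambda>\<omega>. W t \<omega> - W s \<omega>)"
    by (rule distr_cong) auto
  ultimately show ?thesis by simp
qed

lemma increment_indep:
  assumes st: "0 \<le> s" "s < t" and R: "R \<in> measurable (F s) N"
  shows "distr M N R \<Otimes>\<^sub>M gauss (t - s) = distr M (N \<Otimes>\<^sub>M borel) (\<lambda>\<omega>. (R \<omega>, W t \<omega> - W s \<omega>))"
proof (rule pair_measure_eqI)
  interpret g: prob_space "gauss (t - s)" using st by (intro prob_space_gauss) auto
  have RM [measurable]: "R \<in> measurable M N" by (rule measurable_F_M[OF R])
  have [measurable]: "W s \<in> borel_measurable M" "W t \<in> borel_measurable M" using st by auto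
  show "sigma_finite_measure (distr M N R)"
    by (intro prob_space_imp_sigma_finite prob_space_distr RM)
  show "sigma_finite_measure (gauss (t - s))" by unfold_locales
  show "sets (distr M N R \<Otimes>\<^sub>M gauss (t - s)) = sets (distr M (N \<Otimes>\<^sub>M borel) (\<lambda>\<omega>. (R \<omega>, W t \<omega> - W s \<omega>)))"
    unfolding sets_distr by (intro sets_pair_measure_cong) auto
  fix A B assume A: "A \<in> sets (distr M N R)" and B: "B \<in> sets (gauss (t - s))"
  then have [measurable]: "A \<in> sets N" "B \<in> sets borel" by auto
  let ?D = "\<lambda>\<omega>. W t \<omega> - W s \<omega>"
  have ind: "indep_set (sets (F s)) (sets (vimage_algebra (space M) ?D borel))"
    using brownian st unfolding brownian_motion_def by blast
  have "R -` A \<inter> space M \<in> sets (F s)"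
    using measurable_sets[OF R, of A] space_F[of s] by simp
  moreover have "?D -` B \<inter> space M \<in> sets (vimage_algebra (space M) ?D borel)"
    by (rule in_vimage_algebra) simp
  ultimately have prob: "prob ((R -` A \<inter> space M) \<inter> (?D -` B \<inter> space M)) = prob (R -` A \<inter> space M) * prob (?D -` B \<inter> space M)"
    by (rule indep_setD[OF ind])
  have "emeasure (distr M N R) A * emeasure (gauss (t - s)) B
      = emeasure M (R -` A \<inter> space M) * emeasure M (?D -` B \<inter> space M)"
    unfolding increment_distr[OF st, symmetric] by (simp add: emeasure_distr)
  also have "\<dots> = emeasure M ((R -` A \<inter> space M) \<inter> (?D -` B \<inter> space M))"
    unfolding emeasure_eq_measure prob by (simp add: ennreal_mult)
  also have "\<dots> = emeasure (distr M (N \<Otimes>\<^sub>M borel) (\<lambda>\<omega>. (R \<omega>, ?D \<omega>))) (A \<times> B)"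
    by (subst emeasure_distr) (auto intro!: arg_cong[where f="emeasure M"])
  finally show "emeasure (distr M N R) A * emeasure (gauss (t - s)) B
      = emeasure (distr M (N \<Otimes>\<^sub>M borel) (\<lambda>\<omega>. (R \<omega>, ?D \<omega>))) (A \<times> B)" .
qed

lemma nn_integral_increment:
  assumes st: "0 \<le> s" "s < t" and R: "R \<in> measurable (F s) N"
    and k [measurable]: "k \<in> borel_measurable (N \<Otimes>\<^sub>M borel)"
  shows "(\<integral>\<^sup>+\<omega>. k (R \<omega>, W t \<omega> - W s \<omega>) \<partial>M) = (\<integral>\<^sup>+\<omega>. (\<integral>\<^sup>+z. k (R \<omega>, z) \<partial>gauss (t - s)) \<partial>M)"
proof -
  interpret g: prob_space "gauss (t - s)" using st by (intro prob_space_gauss) auto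
  have [measurable]: "R \<in> measurable M N" by (rule measurable_F_M[OF R])
  have [measurable]: "W s \<in> borel_measurable M" "W t \<in> borel_measurable M" using st by auto
  have "k \<in> borel_measurable (N \<Otimes>\<^sub>M gauss (t - s))" by measurable
  note k' = this
  have "(\<integral>\<^sup>+\<omega>. k (R \<omega>, W t \<omega> - W s \<omega>) \<partial>M) = integral\<^sup>N (distr M N R \<Otimes>\<^sub>M gauss (t - s)) k"
    unfolding increment_indep[OF st R] by (subst nn_integral_distr) auto
  also have "\<dots> = (\<integral>\<^sup>+r. \<integral>\<^sup>+z. k (r, z) \<partial>gauss (t - s) \<partial>distr M N R)"
    by (subst g.nn_integral_fst) auto
  also have "\<dots> = (\<integral>\<^sup>+\<omega>. (\<integral>\<^sup>+z. k (R \<omega>, z) \<partial>gauss (t - s)) \<partial>M)"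
    using g.borel_measurable_nn_integral_fst[OF k'] by (subst nn_integral_distr) auto
  finally show ?thesis .
qed

section \<open>Exponential martingales of simple integrands\<close>

lemma adapted_sums_measurable:
  fixes p :: "nat \<Rightarrow> real"
  assumes p0: "0 \<le> p 0" and p: "\<And>i. i < N \<Longrightarrow> p i < p (Suc i)"
    and G: "\<And>i. i < N \<Longrightarrow> G i \<in> borel_measurable (F (p i))"
  shows "(\<lambda>\<omega>. \<Sum>i<N. G i \<omega> * (W (p (Suc i)) \<omega> - W (p i) \<omega>)) \<in> borel_measurable (F (p N))"
    and "(\<lambda>\<omega>. \<Sum>i<N. (G i \<omega>)\<^sup>2 * (p (Suc i) - p i)) \<in> borel_measurable (F (p N))"
proof -
  have mono: "p i \<le> p j" if "i \<le> j" "j \<le> N" for i j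
    using that
  proof (induction j)
    case (Suc j)
    then show ?case using p[of j] by (cases "i = Suc j") auto
  qed simp
  have G': "G i \<in> borel_measurable (F (p N))" if "i < N" for i
    using that by (intro measurable_F_mono[OF G] mono) auto
  have W': "W (p i) \<in> borel_measurable (F (p N))" if "i \<le> N" for i
    using that p0 mono[of 0 i] by (intro W_measurable' mono) auto
  show "(\<lambda>\<omega>. \<Sum>i<N. G i \<omega> * (W (p (Suc i)) \<omega> - W (p i) \<omega>)) \<in> borel_measurable (F (p N))"
    by (intro borel_measurable_sum borel_measurable_times borel_measurable_diff G' W') auto
  show "(\<lambda>\<omega>. \<Sum>i<N. (G i \<omega>)\<^sup>2 * (p (Suc i) - p i)) \<in> borel_measurable (F (p N))"
    by (intro borel_measurable_sum borel_measurable_times borel_measurable_power G' measurable_const) auto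
qed

lemma nn_integral_exp_martingale:
  fixes p :: "nat \<Rightarrow> real"
  assumes p0: "0 \<le> p 0" and p: "\<And>i. i < N \<Longrightarrow> p i < p (Suc i)"
    and G: "\<And>i. i < N \<Longrightarrow> G i \<in> borel_measurable (F (p i))"
    and H: "H \<in> borel_measurable (F (p 0))"
  shows "(\<integral>\<^sup>+\<omega>. H \<omega> * ennreal (exp ((\<Sum>i<N. G i \<omega> * (W (p (Suc i)) \<omega> - W (p i) \<omega>))
            - (\<Sum>i<N. (G i \<omega>)\<^sup>2 * (p (Suc i) - p i)) / 2)) \<partial>M) = (\<integral>\<^sup>+\<omega>. H \<omega> \<partial>M)"
  using p G
proof (induction N)
  case (Suc N)
  define S where "S \<omega> = (\<Sum>i<N. G i \<omega> * (W (p (Suc i)) \<omega> - W (p i) \<omega>))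
      - (\<Sum>i<N. (G i \<omega>)\<^sup>2 * (p (Suc i) - p i)) / 2" for \<omega>
  define h where "h = p (Suc N) - p N"
  let ?S = "\<lambda>\<omega>. (\<Sum>i<Suc N. G i \<omega> * (W (p (Suc i)) \<omega> - W (p i) \<omega>))
            - (\<Sum>i<Suc N. (G i \<omega>)\<^sup>2 * (p (Suc i) - p i)) / 2"
  let ?k = "\<lambda>x. fst (fst x) * ennreal (exp (snd (fst x) * snd x - (snd (fst x))\<^sup>2 * h / 2))"
  have h: "h > 0" using Suc.prems(1)[of N] by (simp add: h_def)
  have mono: "p 0 \<le> p j" if "j \<le> N" for j
    using that
  proof (induction j)
    case (Suc j)
    then show ?case using Suc.prems \<open>\<And>i. i < Suc N \<Longrightarrow> p i < p (Suc i)\<close>[of j] by auto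
  qed simp
  have S [measurable]: "S \<in> borel_measurable (F (p N))"
    unfolding S_def using adapted_sums_measurable[where p=p and N=N and G=G, OF p0] Suc.prems
    by (intro borel_measurable_diff borel_measurable_divide measurable_const) auto
  have [measurable]: "H \<in> borel_measurable (F (p N))" by (rule measurable_F_mono[OF H mono]) simp
  have [measurable]: "G N \<in> borel_measurable (F (p N))" using Suc.prems(2) by simp
  have "(\<integral>\<^sup>+\<omega>. H \<omega> * ennreal (exp (?S \<omega>)) \<partial>M)
      = (\<integral>\<^sup>+\<omega>. ?k
          ((H \<omega> * ennreal (exp (S \<omega>)), G N \<omega>), W (p (Suc N)) \<omega> - W (p N) \<omega>) \<partial>M)"
  proof (intro nn_integral_cong)
    fix \<omega>
    have eq: "?S \<omega>
        = S \<omega> + (G N \<omega> * (W (p (Suc N)) \<omega> - W (p N) \<omega>) - (G N \<omega>)\<^sup>2 * h / 2)"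
      by (simp add: S_def h_def add_divide_distrib)
    show "H \<omega> * ennreal (exp (?S \<omega>))
        = ?k
          ((H \<omega> * ennreal (exp (S \<omega>)), G N \<omega>), W (p (Suc N)) \<omega> - W (p N) \<omega>)"
      unfolding eq exp_add by (simp add: ennreal_mult mult.assoc)
  qed
  also have "\<dots> = (\<integral>\<^sup>+\<omega>. (\<integral>\<^sup>+z. ?k
          ((H \<omega> * ennreal (exp (S \<omega>)), G N \<omega>), z) \<partial>gauss (p (Suc N) - p N)) \<partial>M)"
  proof (rule nn_integral_increment[where N="borel \<Otimes>\<^sub>M borel"])
    show "0 \<le> p N" using p0 mono[of N] by simp
    show "p N < p (Suc N)" using Suc.prems(1) by simp
  qed measurable
  also have "\<dots> = (\<integral>\<^sup>+\<omega>. H \<omega> * ennreal (exp (S \<omega>)) \<partial>M)"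
    using gauss_exp_martingale[OF h] by (simp add: h_def[symmetric] nn_integral_cmult)
  also have "\<dots> = (\<integral>\<^sup>+\<omega>. H \<omega> \<partial>M)"
    unfolding S_def using Suc.prems by (intro Suc.IH) auto
  finally show ?case .
qed simp

lemma exponential_chebyshev:
  fixes p :: "nat \<Rightarrow> real"
  assumes p0: "0 \<le> p 0" and p: "\<And>i. i < N \<Longrightarrow> p i < p (Suc i)"
    and G: "\<And>i. i < N \<Longrightarrow> G i \<in> borel_measurable (F (p i))"
    and e: "e > 0" and d: "d > 0"
  shows "prob {\<omega>\<in>space M. \<bar>\<Sum>i<N. G i \<omega> * (W (p (Suc i)) \<omega> - W (p i) \<omega>)\<bar> > e \<and>
      (\<Sum>i<N. (G i \<omega>)\<^sup>2 * (p (Suc i) - p i)) \<le> d} \<le> 2 * exp (- (e\<^sup>2 / (2 * d)))"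
proof -
  define S where "S G \<omega> = (\<Sum>i<N. G i \<omega> * (W (p (Suc i)) \<omega> - W (p i) \<omega>))" for G and \<omega> :: 'a
  define A where "A G \<omega> = (\<Sum>i<N. (G i \<omega>)\<^sup>2 * (p (Suc i) - p i))" for G and \<omega> :: 'a
  have one: "prob {\<omega>\<in>space M. S G \<omega> > e \<and> A G \<omega> \<le> d} \<le> exp (- (e\<^sup>2 / (2 * d)))"
    if G: "\<And>i. i < N \<Longrightarrow> G i \<in> borel_measurable (F (p i))" for G
  proof -
    define a where "a = e / d"
    define c where "c = exp (- (e\<^sup>2 / (2 * d)))"
    have a: "a > 0" using e d by (simp add: a_def)
    have [measurable]: "S G \<in> borel_measurable M" "A G \<in> borel_measurable M"
      using adapted_sums_measurable[where p=p and N=N and G=G, OF p0 p G] unfolding S_def A_def by (auto intro: measurable_F_M)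
    have aG: "(\<lambda>\<omega>. a * G i \<omega>) \<in> borel_measurable (F (p i))" if "i < N" for i
      using G[OF that] by measurable
    have sums: "(\<Sum>i<N. (a * G i \<omega>) * (W (p (Suc i)) \<omega> - W (p i) \<omega>)) = a * S G \<omega>"
      "(\<Sum>i<N. (a * G i \<omega>)\<^sup>2 * (p (Suc i) - p i)) = a\<^sup>2 * A G \<omega>" for \<omega>
      by (simp_all add: S_def A_def sum_distrib_left power_mult_distrib mult.assoc)
    have E1: "(\<integral>\<^sup>+\<omega>. ennreal (exp (a * S G \<omega> - a\<^sup>2 * A G \<omega> / 2)) \<partial>M) = 1"
      using nn_integral_exp_martingale[where p=p and N=N and H="\<lambda>_. 1", OF p0 p aG] emeasure_space_1
      unfolding sums by simp
    have "emeasure M {\<omega>\<in>space M. S G \<omega> > e \<and> A G \<omega> \<le> d}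
        = (\<integral>\<^sup>+\<omega>. indicator {\<omega>\<in>space M. S G \<omega> > e \<and> A G \<omega> \<le> d} \<omega> \<partial>M)"
      by (intro nn_integral_indicator[symmetric]) measurable
    also have "\<dots> \<le> (\<integral>\<^sup>+\<omega>. ennreal c * ennreal (exp (a * S G \<omega> - a\<^sup>2 * A G \<omega> / 2)) \<partial>M)"
    proof (intro nn_integral_mono)
      fix \<omega>
      have "1 \<le> c * exp (a * S G \<omega> - a\<^sup>2 * A G \<omega> / 2)" if "S G \<omega> > e" "A G \<omega> \<le> d"
      proof -
        have "a * e \<le> a * S G \<omega>" "a\<^sup>2 * A G \<omega> \<le> a\<^sup>2 * d"
          using that a by (auto intro!: mult_left_mono)
        moreover have "a * e - a\<^sup>2 * d / 2 = e\<^sup>2 / (2 * d)"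
          using d by (simp add: a_def field_simps power2_eq_square)
        ultimately have "0 \<le> - (e\<^sup>2 / (2 * d)) + (a * S G \<omega> - a\<^sup>2 * A G \<omega> / 2)" by linarith
        then show ?thesis unfolding c_def exp_add[symmetric] by simp
      qed
      then show "indicator {\<omega>\<in>space M. S G \<omega> > e \<and> A G \<omega> \<le> d} \<omega>
          \<le> ennreal c * ennreal (exp (a * S G \<omega> - a\<^sup>2 * A G \<omega> / 2))"
        by (auto simp: indicator_def c_def ennreal_mult[symmetric] simp del: ennreal_1 simp flip: ennreal_1)
    qed
    also have "\<dots> = ennreal c"
      using E1 by (simp add: nn_integral_cmult)
    finally show ?thesis
      by (simp add: emeasure_eq_measure c_def)
  qed
  have [measurable]: "S G \<in> borel_measurable M" "A G \<in> borel_measurable M"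
    using adapted_sums_measurable[where p=p and N=N and G=G, OF p0 p G] unfolding S_def A_def by (auto intro: measurable_F_M)
  have neg: "S (\<lambda>i \<omega>. - G i \<omega>) \<omega> = - S G \<omega>" "A (\<lambda>i \<omega>. - G i \<omega>) \<omega> = A G \<omega>" for \<omega>
    by (simp_all add: S_def A_def sum_negf)
  have "prob {\<omega>\<in>space M. \<bar>S G \<omega>\<bar> > e \<and> A G \<omega> \<le> d}
      = prob ({\<omega>\<in>space M. S G \<omega> > e \<and> A G \<omega> \<le> d} \<union> {\<omega>\<in>space M. - S G \<omega> > e \<and> A G \<omega> \<le> d})"
    by (rule arg_cong[where f=prob]) auto
  also have "\<dots> \<le> prob {\<omega>\<in>space M. S G \<omega> > e \<and> A G \<omega> \<le> d} + prob {\<omega>\<in>space M. - S G \<omega> > e \<and> A G \<omega> \<le> d}"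
    by (intro measure_Un_le) measurable
  also have "\<dots> \<le> exp (- (e\<^sup>2 / (2 * d))) + exp (- (e\<^sup>2 / (2 * d)))"
    using one[OF G] one[of "\<lambda>i \<omega>. - G i \<omega>"] G unfolding neg by (intro add_mono) auto
  finally show ?thesis unfolding S_def A_def by simp
qed

section \<open>Quadratic variation of Brownian paths\<close>

lemma increments_square_moment:
  fixes p :: "nat \<Rightarrow> real"
  assumes p0: "0 \<le> p 0" and h: "h > 0" and p: "\<And>i. i < N \<Longrightarrow> p (Suc i) = p i + h"
  shows "(\<integral>\<^sup>+\<omega>. ennreal ((\<Sum>i<N. (W (p (Suc i)) \<omega> - W (p i) \<omega>)\<^sup>2 - h)\<^sup>2) \<partial>M) = ennreal (2 * real N * h\<^sup>2)"
  using p
proof (induction N)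
  case (Suc N)
  have pj: "p j = p 0 + real j * h" if "j \<le> Suc N" for j
    using that
  proof (induction j)
    case (Suc j)
    then show ?case using Suc.prems \<open>\<And>i. i < Suc N \<Longrightarrow> p (Suc i) = p i + h\<close>[of j] by (simp add: algebra_simps)
  qed simp
  define Q where "Q \<omega> = (\<Sum>i<N. (W (p (Suc i)) \<omega> - W (p i) \<omega>)\<^sup>2 - h)" for \<omega>
  have W': "W (p i) \<in> borel_measurable (F (p N))" if "i \<le> N" for i
    using that p0 h pj[of i] pj[of N] by (intro W_measurable') (auto intro!: mult_right_mono add_nonneg_nonneg)
  have Q: "Q \<in> borel_measurable (F (p N))"
    unfolding Q_def by (intro borel_measurable_sum borel_measurable_power borel_measurable_diff W' measurable_const) auto
  have QM [measurable]: "Q \<in> borel_measurable M" by (rule measurable_F_M[OF Q])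
  have "(\<integral>\<^sup>+\<omega>. ennreal ((\<Sum>i<Suc N. (W (p (Suc i)) \<omega> - W (p i) \<omega>)\<^sup>2 - h)\<^sup>2) \<partial>M)
      = (\<integral>\<^sup>+\<omega>. (\<lambda>(q, z). ennreal ((q + (z\<^sup>2 - h))\<^sup>2)) (Q \<omega>, W (p (Suc N)) \<omega> - W (p N) \<omega>) \<partial>M)"
    by (simp add: Q_def)
  also have "\<dots> = (\<integral>\<^sup>+\<omega>. (\<integral>\<^sup>+z. (\<lambda>(q, z). ennreal ((q + (z\<^sup>2 - h))\<^sup>2)) (Q \<omega>, z) \<partial>gauss (p (Suc N) - p N)) \<partial>M)"
  proof (rule nn_integral_increment[where N=borel])
    show "0 \<le> p N" using p0 h pj[of N] by simp
    show "p N < p (Suc N)" using Suc.prems[of N] h by simp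
  qed (use Q in measurable)
  also have "\<dots> = (\<integral>\<^sup>+\<omega>. ennreal ((Q \<omega>)\<^sup>2) + ennreal (2 * h\<^sup>2) \<partial>M)"
    using Suc.prems[of N] gauss_centered_square_moment[OF h] by simp
  also have "\<dots> = (\<integral>\<^sup>+\<omega>. ennreal ((Q \<omega>)\<^sup>2) \<partial>M) + ennreal (2 * h\<^sup>2)"
    using emeasure_space_1 by (subst nn_integral_add) auto
  also have "(\<integral>\<^sup>+\<omega>. ennreal ((Q \<omega>)\<^sup>2) \<partial>M) = ennreal (2 * real N * h\<^sup>2)"
    unfolding Q_def using Suc.prems by (intro Suc.IH) auto
  also have "ennreal (2 * real N * h\<^sup>2) + ennreal (2 * h\<^sup>2) = ennreal (2 * real (Suc N) * h\<^sup>2)"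
    by (subst ennreal_plus[symmetric]) (auto simp: algebra_simps)
  finally show ?case .
qed simp

lemma AE_has_qv:
  assumes ab: "0 \<le> a" "a < b"
  shows "AE \<omega> in M. has_qv a b (\<lambda>t. W t \<omega>) 1"
proof -
  have "AE \<omega> in M. (\<lambda>n. \<Sum>i<j * 2 ^ n. (W (dpt a b (m + n) (Suc i)) \<omega> - W (dpt a b (m + n) i) \<omega>)\<^sup>2)
       \<longlonglongrightarrow> 1 * (b - a) * real j / 2 ^ m" for m j
  proof -
    define h where "h n = (b - a) / 2 ^ (m + n)" for n
    define Q where "Q n \<omega> = (\<Sum>i<j * 2 ^ n. (W (dpt a b (m + n) (Suc i)) \<omega> - W (dpt a b (m + n) i) \<omega>)\<^sup>2 - h n)" for n \<omega>
    have h: "h n > 0" for n using ab by (simp add: h_def)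
    have meas [measurable]: "W (dpt a b n i) \<in> borel_measurable M" for n i
      using ab dpt_ge[of a b n i] by (intro W_measurable_M) auto
    have [measurable]: "Q n \<in> borel_measurable M" for n
      unfolding Q_def by measurable
    have "(\<integral>\<^sup>+\<omega>. ennreal ((Q n \<omega>)\<^sup>2) \<partial>M) = ennreal (2 * real (j * 2 ^ n) * (h n)\<^sup>2)" for n
      unfolding Q_def using ab h by (intro increments_square_moment) (auto simp: dpt_Suc h_def)
    also have "2 * real (j * 2 ^ n) * (h n)\<^sup>2 = 2 * real j * (b - a)\<^sup>2 / 4 ^ m * (1 / 2) ^ n" for n
    proof -
      have "(2::real) ^ n * (1 / 2 ^ (m + n))\<^sup>2 = 1 / 4 ^ m * (1 / 2) ^ n"
        using power_mult_distrib[of "2::real" 2 m] by (simp add: power_add power2_eq_square field_simps)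
      then show ?thesis
        unfolding h_def by (simp add: power_divide field_simps)
    qed
    finally have EQ: "(\<integral>\<^sup>+\<omega>. ennreal ((Q n \<omega>)\<^sup>2) \<partial>M) = ennreal (2 * real j * (b - a)\<^sup>2 / 4 ^ m * (1 / 2) ^ n)" for n .
    have "(\<integral>\<^sup>+\<omega>. (\<Sum>n. ennreal ((Q n \<omega>)\<^sup>2)) \<partial>M) = (\<Sum>n. ennreal (2 * real j * (b - a)\<^sup>2 / 4 ^ m * (1 / 2) ^ n))"
      by (simp add: nn_integral_suminf EQ)
    also have "\<dots> \<noteq> \<infinity>"
      by (subst suminf_ennreal2) (auto intro!: summable_mult summable_geometric)
    finally have "AE \<omega> in M. (\<Sum>n. ennreal ((Q n \<omega>)\<^sup>2)) \<noteq> \<infinity>"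
      by (intro nn_integral_PInf_AE) auto
    then show ?thesis
    proof eventually_elim
      case (elim \<omega>)
      then have "summable (\<lambda>n. (Q n \<omega>)\<^sup>2)"
        by (intro summable_suminf_not_top) auto
      then have "(\<lambda>n. (Q n \<omega>)\<^sup>2) \<longlonglongrightarrow> 0"
        by (rule summable_LIMSEQ_zero)
      then have "(\<lambda>n. sqrt ((Q n \<omega>)\<^sup>2)) \<longlonglongrightarrow> sqrt 0"
        by (rule tendsto_real_sqrt)
      then have "(\<lambda>n. Q n \<omega>) \<longlonglongrightarrow> 0"
        by (simp add: tendsto_rabs_zero_iff)
      then have "(\<lambda>n. Q n \<omega> + 1 * (b - a) * real j / 2 ^ m) \<longlonglongrightarrow> 0 + 1 * (b - a) * real j / 2 ^ m"
        by (intro tendsto_intros)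
      moreover have "Q n \<omega> + 1 * (b - a) * real j / 2 ^ m
          = (\<Sum>i<j * 2 ^ n. (W (dpt a b (m + n) (Suc i)) \<omega> - W (dpt a b (m + n) i) \<omega>)\<^sup>2)" for n
        by (simp add: Q_def h_def sum_subtractf power_add)
      ultimately show ?case by simp
    qed
  qed
  then show ?thesis
    unfolding has_qv_def by (auto simp: AE_all_countable intro: AE_mp)
qed

end

section \<open>Simple integrals on a common refinement\<close>

lemma strict_chain_less:
  fixes p :: "nat \<Rightarrow> real"
  assumes p: "\<forall>i<N. p i < p (Suc i)" and ij: "i < j" and jN: "j \<le> N"
  shows "p i < p j"
  using ij jN
proof (induction j)
  case (Suc j)
  then show ?case using p by (cases "i = j") (auto intro: less_trans)
qed simp

lemma strict_chain_le:
  fixes p :: "nat \<Rightarrow> real"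
  assumes p: "\<forall>i<N. p i < p (Suc i)" and "i \<le> j" "j \<le> N"
  shows "p i \<le> p j"
  using strict_chain_less[OF p, of i j] assms(2,3) by (cases "i = j") auto

lemma strict_chain_cell:
  fixes p :: "nat \<Rightarrow> real"
  assumes p: "\<forall>i<N. p i < p (Suc i)" and a: "a \<le> N" and j: "j < N" and r: "r \<in> {p j<..p (Suc j)}"
  shows "p a < r \<longleftrightarrow> a \<le> j"
proof
  assume "a \<le> j"
  then have "p a \<le> p j" using p j by (intro strict_chain_le[of N p]) auto
  then show "p a < r" using r by simp
next
  assume *: "p a < r"
  show "a \<le> j"
  proof (rule ccontr)
    assume "\<not> a \<le> j"
    then have "p (Suc j) \<le> p a" using p a by (intro strict_chain_le[of N p]) auto
    then show False using * r by simp
  qed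
qed

lemma chain_cell_exists:
  fixes p :: "nat \<Rightarrow> real"
  shows "p 0 < r \<Longrightarrow> r \<le> p N \<Longrightarrow> \<exists>j<N. r \<in> {p j<..p (Suc j)}"
proof (induction N)
  case (Suc N)
  show ?case
  proof (cases "r \<le> p N")
    case True
    with Suc obtain j where "j < N" "r \<in> {p j<..p (Suc j)}" by blast
    then show ?thesis by (intro exI[of _ j]) auto
  next
    case False
    then show ?thesis using Suc.prems by (intro exI[of _ N]) auto
  qed
qed simp

lemma finite_set_as_chain:
  fixes P :: "real set"
  assumes P: "finite P" "P \<subseteq> {0..t}" "0 \<in> P" "t \<in> P"
  obtains p N where "p 0 = 0" "p N = t" "\<forall>i<N. p i < p (Suc i)" "P = p ` {..N::nat}"
proof -
  define xs where "xs = sorted_list_of_set P"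
  define N where "N = length xs - 1"
  have set: "set xs = P" using P by (simp add: xs_def)
  have ne: "xs \<noteq> []" using P set by auto
  have srt: "sorted_wrt (<) xs"
    unfolding xs_def by (rule strict_sorted_list_of_set)
  have less: "xs ! i < xs ! j" if "i < j" "j < length xs" for i j
    using srt that by (auto simp: sorted_wrt_iff_nth_less)
  have im: "P = (\<lambda>i. xs ! i) ` {..N}"
    using ne unfolding set[symmetric] N_def by (auto simp: in_set_conv_nth image_iff intro!: bexI) (metis One_nat_def Suc_pred atMost_iff length_greater_0_conv less_Suc_eq_le)
  obtain i where i: "i \<le> N" "xs ! i = 0" using P(3) unfolding im by auto
  obtain j where j: "j \<le> N" "xs ! j = t" using P(4) unfolding im by auto
  have len: "length xs = Suc N" using ne by (simp add: N_def)
  have "xs ! 0 \<in> {0..t}" "xs ! N \<in> {0..t}" using im P(2) by auto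
  have "xs ! 0 = 0"
    using less[of 0 i] i \<open>xs ! 0 \<in> {0..t}\<close> len by (cases "i = 0") auto
  moreover have "xs ! N = t"
    using less[of j N] j \<open>xs ! N \<in> {0..t}\<close> len by (cases "j = N") auto
  ultimately show thesis
    using less len im by (intro that[of "\<lambda>i. xs ! i" N]) auto
qed

lemma simple_process_index:
  fixes p \<tau> :: "nat \<Rightarrow> real"
  assumes p: "\<forall>i<N. p i < p (Suc i)" and pN: "p N = t"
    and a: "\<forall>i\<le>k. a i \<le> N \<and> p (a i) = min t (\<tau> i)"
    and i: "i < k" and j: "j < N" and r: "r \<in> {p j<..p (Suc j)}"
  shows "indicator {\<tau> i<..\<tau> (Suc i)} r = (if a i \<le> j \<and> j < a (Suc i) then 1 else 0 :: real)"
proof -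
  have rt: "r \<le> t"
    using r strict_chain_le[OF p, of "Suc j" N] j pN by auto
  have 1: "p (a i) < r \<longleftrightarrow> a i \<le> j"
    using a i by (intro strict_chain_cell[OF p _ j r]) auto
  have 2: "p (a (Suc i)) < r \<longleftrightarrow> a (Suc i) \<le> j"
    using a i by (intro strict_chain_cell[OF p _ j r]) auto
  have "\<tau> i < r \<longleftrightarrow> a i \<le> j"
    using 1 a[rule_format, of i] i rt by auto
  moreover have "r \<le> \<tau> (Suc i) \<longleftrightarrow> j < a (Suc i)"
    using 2 a[rule_format, of "Suc i"] i rt by auto
  ultimately show ?thesis by auto
qed

lemma sum_telescope_between:
  fixes f :: "nat \<Rightarrow> real"
  assumes "a \<le> b" "b \<le> N"
  shows "(\<Sum>j<N. (if a \<le> j \<and> j < b then 1 else 0) * (f (Suc j) - f j)) = f b - f a"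
proof -
  have "(\<Sum>j<N. (if a \<le> j \<and> j < b then 1 else 0) * (f (Suc j) - f j)) = (\<Sum>j=a..<b. f (Suc j) - f j)"
    using assms by (intro sum.mono_neutral_cong_right) auto
  also have "\<dots> = f b - f a" using assms(1) by (rule sum_Suc_diff')
  finally show ?thesis .
qed

lemma simple_integral_refine:
  fixes p \<tau> :: "nat \<Rightarrow> real"
  assumes p: "\<forall>i<N. p i < p (Suc i)" and pN: "p N = t"
    and \<tau>: "\<forall>i<k. \<tau> i < \<tau> (Suc i)" and P: "\<forall>i\<le>k. min t (\<tau> i) \<in> p ` {..N}"
  shows "simple_integral W k \<tau> \<xi> t \<omega>
    = (\<Sum>j<N. simple_process k \<tau> \<xi> (p (Suc j)) \<omega> * (W (p (Suc j)) \<omega> - W (p j) \<omega>))"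
proof -
  have "\<exists>b. b \<le> N \<and> p b = min t (\<tau> i)" if "i \<le> k" for i
    using P that by (force simp: image_iff)
  then have "\<forall>i. \<exists>b. i \<le> k \<longrightarrow> b \<le> N \<and> p b = min t (\<tau> i)" by blast
  from choice[OF this] obtain a where a: "\<forall>i\<le>k. a i \<le> N \<and> p (a i) = min t (\<tau> i)" by blast
  have mono: "a i \<le> a (Suc i)" if "i < k" for i
  proof (rule ccontr)
    assume "\<not> a i \<le> a (Suc i)"
    then have "p (a (Suc i)) < p (a i)"
      using a that p by (intro strict_chain_less[of N p]) auto
    then show False using a[rule_format, of i] a[rule_format, of "Suc i"] \<tau> that by (auto simp: min_def split: if_splits)
  qed
  have "(\<Sum>j<N. simple_process k \<tau> \<xi> (p (Suc j)) \<omega> * (W (p (Suc j)) \<omega> - W (p j) \<omega>))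
     = (\<Sum>j<N. \<Sum>i<k. \<xi> i \<omega> * ((if a i \<le> j \<and> j < a (Suc i) then 1 else 0) * (W (p (Suc j)) \<omega> - W (p j) \<omega>)))"
  proof (intro sum.cong refl)
    fix j assume "j \<in> {..<N}"
    then have j: "j < N" by simp
    have "simple_process k \<tau> \<xi> (p (Suc j)) \<omega> = (\<Sum>i<k. \<xi> i \<omega> * (if a i \<le> j \<and> j < a (Suc i) then 1 else 0))"
      unfolding simple_process_def
      by (intro sum.cong refl arg_cong2[where f="(*)"] simple_process_index[OF p pN a _ j]) (use p j in auto)
    then show "simple_process k \<tau> \<xi> (p (Suc j)) \<omega> * (W (p (Suc j)) \<omega> - W (p j) \<omega>)
        = (\<Sum>i<k. \<xi> i \<omega> * ((if a i \<le> j \<and> j < a (Suc i) then 1 else 0) * (W (p (Suc j)) \<omega> - W (p j) \<omega>)))"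
      by (simp only: sum_distrib_right mult.assoc)
  qed
  also have "\<dots> = (\<Sum>i<k. \<xi> i \<omega> * (\<Sum>j<N. (if a i \<le> j \<and> j < a (Suc i) then 1 else 0) * (W (p (Suc j)) \<omega> - W (p j) \<omega>)))"
    by (subst sum.swap) (simp only: sum_distrib_left)
  also have "\<dots> = (\<Sum>i<k. \<xi> i \<omega> * (W (p (a (Suc i))) \<omega> - W (p (a i)) \<omega>))"
  proof (intro sum.cong refl arg_cong2[where f="(*)"])
    fix i assume "i \<in> {..<k}"
    then have i: "i < k" by simp
    show "(\<Sum>j<N. (if a i \<le> j \<and> j < a (Suc i) then 1 else 0) * (W (p (Suc j)) \<omega> - W (p j) \<omega>))
        = W (p (a (Suc i))) \<omega> - W (p (a i)) \<omega>"
      using mono[OF i] a i by (intro sum_telescope_between[where f="\<lambda>j. W (p j) \<omega>"]) auto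
  qed
  also have "\<dots> = simple_integral W k \<tau> \<xi> t \<omega>"
    unfolding simple_integral_def using a by (intro sum.cong) auto
  finally show ?thesis ..
qed

lemma simple_process_const_on_cell:
  fixes p \<tau> :: "nat \<Rightarrow> real"
  assumes p: "\<forall>i<N. p i < p (Suc i)" and pN: "p N = t"
    and P: "\<forall>i\<le>k. min t (\<tau> i) \<in> p ` {..N}" and j: "j < N" and r: "r \<in> {p j<..p (Suc j)}"
  shows "simple_process k \<tau> \<xi> r \<omega> = simple_process k \<tau> \<xi> (p (Suc j)) \<omega>"
proof -
  have "\<exists>b. b \<le> N \<and> p b = min t (\<tau> i)" if "i \<le> k" for i
    using P that by (force simp: image_iff)
  then have "\<forall>i. \<exists>b. i \<le> k \<longrightarrow> b \<le> N \<and> p b = min t (\<tau> i)" by blast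
  from choice[OF this] obtain a where a: "\<forall>i\<le>k. a i \<le> N \<and> p (a i) = min t (\<tau> i)" by blast
  have "p (Suc j) \<in> {p j<..p (Suc j)}" using p j by simp
  note I = simple_process_index[OF p pN a _ j]
  show ?thesis
    unfolding simple_process_def
    using I[OF _ r] I[OF _ \<open>p (Suc j) \<in> {p j<..p (Suc j)}\<close>] by (intro sum.cong refl) auto
qed

lemma sum_indicator_chain:
  fixes p :: "nat \<Rightarrow> real" and c :: "nat \<Rightarrow> 'b::semiring_1"
  assumes p: "\<forall>i<N. p i < p (Suc i)" and j: "j < N" and r: "r \<in> {p j<..p (Suc j)}"
  shows "(\<Sum>i<N. c i * indicator {p i<..p (Suc i)} r) = c j"
proof -
  have "indicator {p i<..p (Suc i)} r = (if i = j then 1 else 0 :: 'b)" if "i < N" for i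
    using strict_chain_cell[OF p _ j r, of i] strict_chain_cell[OF p _ j r, of "Suc i"] that
    by (auto simp: indicator_def)
  then have "(\<Sum>i<N. c i * indicator {p i<..p (Suc i)} r) = (\<Sum>i<N. if i = j then c i else 0)"
    by (intro sum.cong) auto
  then show ?thesis using j by simp
qed

lemma energy_le_nn_integral:
  fixes p c :: "nat \<Rightarrow> real" and G :: "real \<Rightarrow> ennreal"
  assumes p0: "p 0 = 0" and pN: "p N = t" and p: "\<forall>i<N. p i < p (Suc i)"
    and G: "\<And>j r. j < N \<Longrightarrow> r \<in> {p j<..p (Suc j)} \<Longrightarrow> ennreal ((c j)\<^sup>2) \<le> G r"
  shows "ennreal (\<Sum>j<N. (c j)\<^sup>2 * (p (Suc j) - p j)) \<le> (\<integral>\<^sup>+r\<in>{0..t}. G r \<partial>lborel)"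
proof -
  have "ennreal (\<Sum>j<N. (c j)\<^sup>2 * (p (Suc j) - p j)) = (\<Sum>j<N. ennreal ((c j)\<^sup>2) * ennreal (p (Suc j) - p j))"
    using p by (subst sum_ennreal[symmetric]) (auto simp: ennreal_mult less_imp_le)
  also have "\<dots> = (\<Sum>j<N. \<integral>\<^sup>+r. ennreal ((c j)\<^sup>2) * indicator {p j<..p (Suc j)} r \<partial>lborel)"
    using p by (intro sum.cong refl) (simp add: nn_integral_cmult_indicator less_imp_le)
  also have "\<dots> = (\<integral>\<^sup>+r. (\<Sum>j<N. ennreal ((c j)\<^sup>2) * indicator {p j<..p (Suc j)} r) \<partial>lborel)"
    by (subst nn_integral_sum) auto
  also have "\<dots> \<le> (\<integral>\<^sup>+r\<in>{0..t}. G r \<partial>lborel)"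
  proof (intro nn_integral_mono)
    fix r :: real
    show "(\<Sum>j<N. ennreal ((c j)\<^sup>2) * indicator {p j<..p (Suc j)} r) \<le> G r * indicator {0..t} r"
    proof (cases "\<exists>j<N. r \<in> {p j<..p (Suc j)}")
      case True
      then obtain j where j: "j < N" "r \<in> {p j<..p (Suc j)}" by blast
      have "r \<in> {0..t}"
        using j strict_chain_le[OF p, of 0 j] strict_chain_le[OF p, of "Suc j" N] p0 pN by auto
      then show ?thesis
        using sum_indicator_chain[OF p j, of "\<lambda>j. ennreal ((c j)\<^sup>2)"] G[OF j] by simp
    next
      case False
      then have "(\<Sum>j<N. ennreal ((c j)\<^sup>2) * indicator {p j<..p (Suc j)} r) = 0"
        by (intro sum.neutral) (auto simp: indicator_def)
      then show ?thesis by simp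
    qed
  qed
  finally show ?thesis .
qed

lemma (in prob_space) prob_tendsto_0:
  assumes S: "\<And>n. S n \<in> events" and ev: "AE \<omega> in M. \<forall>\<^sub>F n in sequentially. \<omega> \<notin> S n"
  shows "(\<lambda>n. prob (S n)) \<longlonglongrightarrow> 0"
proof -
  have "(\<lambda>n. \<integral>\<omega>. indicator (S n) \<omega> \<partial>M) \<longlonglongrightarrow> (\<integral>\<omega>. 0 \<partial>M :: real)"
  proof (rule integral_dominated_convergence[where w="\<lambda>_. 1"])
    show "AE \<omega> in M. (\<lambda>n. indicator (S n) \<omega> :: real) \<longlonglongrightarrow> 0"
      using ev
    proof eventually_elim
      case (elim \<omega>)
      then have "\<forall>\<^sub>F n in sequentially. indicator (S n) \<omega> = (0::real)"
        by eventually_elim (simp add: indicator_def)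
      then show ?case by (rule tendsto_eventually)
    qed
  qed (use S in \<open>auto simp: indicator_def\<close>)
  then show ?thesis using S by simp
qed

section \<open>Uniqueness of the Ito integral\<close>

context brownian
begin

text \<open>Unlike \<^const>\<open>simple_data\<close> without boundedness, since \<open>\<eta>(X)\<close> is unbounded.\<close>

definition step_data :: "nat \<Rightarrow> (nat \<Rightarrow> real) \<Rightarrow> (nat \<Rightarrow> 'a \<Rightarrow> real) \<Rightarrow> bool" where
  "step_data k \<tau> \<xi> \<longleftrightarrow> 0 \<le> \<tau> 0 \<and> (\<forall>i<k. \<tau> i < \<tau> (Suc i)) \<and> (\<forall>i<k. \<xi> i \<in> borel_measurable (F (\<tau> i)))"

lemma step_data_nonneg:
  assumes "step_data k \<tau> \<xi>" "i \<le> k"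
  shows "0 \<le> \<tau> i"
  using assms strict_chain_le[of k \<tau> 0 i] unfolding step_data_def by auto

lemma simple_process_measurable_F:
  fixes p :: "nat \<Rightarrow> real"
  assumes sd: "step_data k \<tau> \<xi>" and p: "\<forall>i<N. p i < p (Suc i)" and pN: "p N = t"
    and P: "\<forall>i\<le>k. min t (\<tau> i) \<in> p ` {..N}" and j: "j < N"
  shows "simple_process k \<tau> \<xi> (p (Suc j)) \<in> borel_measurable (F (p j))"
proof -
  have "\<exists>b. b \<le> N \<and> p b = min t (\<tau> i)" if "i \<le> k" for i
    using P that by (force simp: image_iff)
  then have "\<forall>i. \<exists>b. i \<le> k \<longrightarrow> b \<le> N \<and> p b = min t (\<tau> i)" by blast
  from choice[OF this] obtain a where a: "\<forall>i\<le>k. a i \<le> N \<and> p (a i) = min t (\<tau> i)" by blast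
  have r: "p (Suc j) \<in> {p j<..p (Suc j)}" using p j by simp
  have eq: "simple_process k \<tau> \<xi> (p (Suc j))
      = (\<lambda>\<omega>. \<Sum>i<k. \<xi> i \<omega> * (if a i \<le> j \<and> j < a (Suc i) then 1 else 0))"
    unfolding simple_process_def
    using simple_process_index[OF p pN a _ j r] by (intro ext sum.cong refl) auto
  show ?thesis
    unfolding eq
  proof (intro borel_measurable_sum)
    fix i assume "i \<in> {..<k}"
    then have i: "i < k" by simp
    show "(\<lambda>\<omega>. \<xi> i \<omega> * (if a i \<le> j \<and> j < a (Suc i) then 1 else 0)) \<in> borel_measurable (F (p j))"
    proof (cases "a i \<le> j \<and> j < a (Suc i)")
      case True
      have "p j < t"
        using strict_chain_less[OF p, of j N] j pN by simp
      moreover have "p (a i) \<le> p j"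
        using True j p by (intro strict_chain_le[of N p]) auto
      ultimately have "\<tau> i \<le> p j" using a[rule_format, of i] i by auto
      moreover have "\<xi> i \<in> borel_measurable (F (\<tau> i))"
        using sd i by (simp add: step_data_def)
      ultimately have "\<xi> i \<in> borel_measurable (F (p j))"
        by (rule measurable_F_mono[rotated])
      then show ?thesis using True by simp
    next
      case False
      then show ?thesis by (simp only: if_False mult_zero_right) measurable
    qed
  qed
qed

lemma simple_integral_measurable:
  assumes sd: "step_data k \<tau> \<xi>" and t: "0 \<le> t"
  shows "simple_integral W k \<tau> \<xi> t \<in> borel_measurable M"
proof -
  have "W (min t (\<tau> i)) \<in> borel_measurable M" if "i \<le> k" for i
    using step_data_nonneg[OF sd that] t by (intro W_measurable_M) auto
  moreover have "\<xi> i \<in> borel_measurable M" if "i < k" for i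
    using sd that by (auto simp: step_data_def intro: measurable_F_M)
  ultimately show ?thesis
    unfolding simple_integral_def[abs_def]
    by (intro borel_measurable_sum borel_measurable_times borel_measurable_diff) auto
qed

text \<open>
  On a common refinement the difference of two simple integrals is a simple integral again, so the
  exponential Chebyshev inequality applies to it.
\<close>

lemma simple_integral_diff_bound:
  assumes sd: "step_data k \<tau> \<xi>" and sd': "step_data k' \<tau>' \<xi>'" and t: "0 < t"
    and e: "e > 0" and d: "d > 0"
  obtains E where "E \<in> borel_measurable M"
    "prob {\<omega>\<in>space M. \<bar>simple_integral W k \<tau> \<xi> t \<omega> - simple_integral W k' \<tau>' \<xi>' t \<omega>\<bar> > e \<and> E \<omega> \<le> d}
      \<le> 2 * exp (- (e\<^sup>2 / (2 * d)))"
    "\<And>\<omega> G. (\<And>r. ennreal ((simple_process k \<tau> \<xi> r \<omega> - simple_process k' \<tau>' \<xi>' r \<omega>)\<^sup>2) \<le> G r) \<Longrightarrow>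
       ennreal (E \<omega>) \<le> (\<integral>\<^sup>+r\<in>{0..t}. G r \<partial>lborel)"
proof -
  define P where "P = {0, t} \<union> (\<lambda>i. min t (\<tau> i)) ` {..k} \<union> (\<lambda>i. min t (\<tau>' i)) ` {..k'}"
  have "finite P" "P \<subseteq> {0..t}" "0 \<in> P" "t \<in> P"
    using t step_data_nonneg[OF sd] step_data_nonneg[OF sd'] by (auto simp: P_def)
  then obtain p N where p: "p 0 = 0" "p N = t" "\<forall>i<N. p i < p (Suc i)" "P = p ` {..N::nat}"
    by (rule finite_set_as_chain[of P t])
  have P1: "\<forall>i\<le>k. min t (\<tau> i) \<in> p ` {..N}" and P2: "\<forall>i\<le>k'. min t (\<tau>' i) \<in> p ` {..N}"
    unfolding p(4)[symmetric] by (auto simp: P_def)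
  have \<tau>: "\<forall>i<k. \<tau> i < \<tau> (Suc i)" and \<tau>': "\<forall>i<k'. \<tau>' i < \<tau>' (Suc i)"
    using sd sd' by (auto simp: step_data_def)
  define G where "G j \<omega> = simple_process k \<tau> \<xi> (p (Suc j)) \<omega> - simple_process k' \<tau>' \<xi>' (p (Suc j)) \<omega>" for j \<omega>
  define E where "E \<omega> = (\<Sum>j<N. (G j \<omega>)\<^sup>2 * (p (Suc j) - p j))" for \<omega>
  have G: "G j \<in> borel_measurable (F (p j))" if "j < N" for j
    unfolding G_def[abs_def]
    by (intro borel_measurable_diff simple_process_measurable_F[OF sd p(3,2) P1 that]
        simple_process_measurable_F[OF sd' p(3,2) P2 that])
  have p0: "0 \<le> p 0" using p(1) by simp
  have diff: "simple_integral W k \<tau> \<xi> t \<omega> - simple_integral W k' \<tau>' \<xi>' t \<omega>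
      = (\<Sum>j<N. G j \<omega> * (W (p (Suc j)) \<omega> - W (p j) \<omega>))" for \<omega>
    unfolding simple_integral_refine[OF p(3,2) \<tau> P1]
      simple_integral_refine[OF p(3,2) \<tau>' P2] G_def left_diff_distrib sum_subtractf by (rule refl)
  show thesis
  proof (rule that)
    show "E \<in> borel_measurable M"
      unfolding E_def[abs_def] by (rule measurable_F_M[OF adapted_sums_measurable(2)]) (use p0 p(3) G in auto)
    show "prob {\<omega>\<in>space M. \<bar>simple_integral W k \<tau> \<xi> t \<omega> - simple_integral W k' \<tau>' \<xi>' t \<omega>\<bar> > e \<and> E \<omega> \<le> d}
      \<le> 2 * exp (- (e\<^sup>2 / (2 * d)))"
      unfolding diff E_def by (rule exponential_chebyshev) (use p0 p(3) G e d in auto)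
    show "ennreal (E \<omega>) \<le> (\<integral>\<^sup>+r\<in>{0..t}. H r \<partial>lborel)"
      if "\<And>r. ennreal ((simple_process k \<tau> \<xi> r \<omega> - simple_process k' \<tau>' \<xi>' r \<omega>)\<^sup>2) \<le> H r" for \<omega> H
      unfolding E_def
    proof (rule energy_le_nn_integral[OF p(1,2,3)])
      fix j r assume j: "j < N" and r: "r \<in> {p j<..p (Suc j)}"
      have "G j \<omega> = simple_process k \<tau> \<xi> r \<omega> - simple_process k' \<tau>' \<xi>' r \<omega>"
        unfolding G_def simple_process_const_on_cell[OF p(3,2) P1 j r]
          simple_process_const_on_cell[OF p(3,2) P2 j r] ..
      then show "ennreal ((G j \<omega>)\<^sup>2) \<le> H r" using that[of r] by simp
    qed
  qed
qed

lemma ito_integral_limit_unique: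
  assumes t: "0 < t" and ito: "ito_integral M F W H t Y"
    and sd': "\<And>n. step_data (K n) (\<rho> n) (\<zeta> n)"
    and B: "AE \<omega> in M. (\<lambda>n. \<integral>\<^sup>+r\<in>{0..t}. ennreal ((simple_process (K n) (\<rho> n) (\<zeta> n) r \<omega> - H r \<omega>)\<^sup>2) \<partial>lborel) \<longlonglongrightarrow> 0"
    and J: "AE \<omega> in M. (\<lambda>n. simple_integral W (K n) (\<rho> n) (\<zeta> n) t \<omega>) \<longlonglongrightarrow> J \<omega>"
  shows "AE \<omega> in M. Y \<omega> = J \<omega>"
proof -
  define SJ where "SJ n \<omega> = simple_integral W (K n) (\<rho> n) (\<zeta> n) t \<omega>" for n \<omega>
  define J' where "J' \<omega> = lim (\<lambda>n. SJ n \<omega>)" for \<omega>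
  have SJ [measurable]: "SJ n \<in> borel_measurable M" for n
    unfolding SJ_def[abs_def] using simple_integral_measurable[OF sd'] t by simp
  have J'M [measurable]: "J' \<in> borel_measurable M"
    unfolding J'_def[abs_def] by (intro borel_measurable_lim_metric SJ)
  have JJ': "AE \<omega> in M. J \<omega> = J' \<omega>"
    using J by eventually_elim (simp add: J'_def SJ_def limI)
  have J': "AE \<omega> in M. (\<lambda>n. SJ n \<omega>) \<longlonglongrightarrow> J' \<omega>"
    using J JJ' by eventually_elim (simp add: SJ_def)
  have Hm: "(\<lambda>(r, \<omega>). H r \<omega>) \<in> borel_measurable (restrict_space borel {0..t} \<Otimes>\<^sub>M F t)"
    and YF: "Y \<in> borel_measurable (F t)"
    using ito by (auto simp: ito_integral_def)
  have YM [measurable]: "Y \<in> borel_measurable M" by (rule measurable_F_M[OF YF])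
  from ito obtain k \<tau> \<xi> where sd: "\<And>n. simple_data F (k n) (\<tau> n) (\<xi> n)"
    and An: "null_in_prob M (\<lambda>n \<omega>. \<integral>\<^sup>+ r \<in> {0..t}.
        ennreal ((simple_process (k n) (\<tau> n) (\<xi> n) r \<omega> - H r \<omega>)\<^sup>2) \<partial>lborel)"
    and Cn: "null_in_prob M (\<lambda>n \<omega>. ennreal \<bar>simple_integral W (k n) (\<tau> n) (\<xi> n) t \<omega> - Y \<omega>\<bar>)"
    unfolding ito_integral_def by blast
  define SI where "SI n \<omega> = simple_integral W (k n) (\<tau> n) (\<xi> n) t \<omega>" for n \<omega>
  define A where "A n \<omega> = (\<integral>\<^sup>+ r \<in> {0..t}.
        ennreal ((simple_process (k n) (\<tau> n) (\<xi> n) r \<omega> - H r \<omega>)\<^sup>2) \<partial>lborel)" for n \<omega>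
  define B' where "B' n \<omega> = (\<integral>\<^sup>+ r \<in> {0..t}.
        ennreal ((simple_process (K n) (\<rho> n) (\<zeta> n) r \<omega> - H r \<omega>)\<^sup>2) \<partial>lborel)" for n \<omega>
  have sdb: "step_data (k n) (\<tau> n) (\<xi> n)" for n
    using sd[of n] by (simp add: simple_data_def step_data_def)
  have SI [measurable]: "SI n \<in> borel_measurable M" for n
    unfolding SI_def[abs_def] using simple_integral_measurable[OF sdb] t by simp
  have A [measurable]: "A n \<in> borel_measurable M" for n
    using An unfolding null_in_prob_def A_def by blast
  have energy: "(\<integral>\<^sup>+r\<in>{0..t}. (2 * ennreal ((simple_process (k n) (\<tau> n) (\<xi> n) r \<omega> - H r \<omega>)\<^sup>2)
        + 2 * ennreal ((simple_process (K n) (\<rho> n) (\<zeta> n) r \<omega> - H r \<omega>)\<^sup>2)) \<partial>lborel)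
      = 2 * A n \<omega> + 2 * B' n \<omega>" if \<omega>: "\<omega> \<in> space M" for n \<omega>
  proof -
    let ?R = "restrict_space lborel {0..t} :: real measure"
    have R: "(\<integral>\<^sup>+r\<in>{0..t}. f r \<partial>lborel) = (\<integral>\<^sup>+r. f r \<partial>?R)" for f
      by (subst nn_integral_restrict_space) auto
    have "(\<lambda>r. (\<lambda>(r, \<omega>). H r \<omega>) (r, \<omega>)) \<in> borel_measurable (restrict_space borel {0..t})"
      using \<omega> space_F[of t] by (intro measurable_compose[OF _ Hm]) auto
    then have [measurable]: "(\<lambda>r. H r \<omega>) \<in> borel_measurable ?R"
      by (simp cong: measurable_cong_sets restrict_space_sets_cong)
    have [measurable]: "(\<lambda>r. simple_process k \<tau> \<xi> r \<omega>) \<in> borel_measurable ?R" for k \<tau> \<xi>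
      unfolding simple_process_def by (intro borel_measurable_sum borel_measurable_times measurable_restrict_space1) auto
    show ?thesis
      unfolding A_def B'_def R by (simp add: nn_integral_add nn_integral_cmult)
  qed
  have bound: "prob {\<omega>\<in>space M. \<bar>Y \<omega> - J' \<omega>\<bar> > 3 * e} \<le> 2 * exp (- real (Suc s))" if e: "e > 0" for e s
  proof -
    define d where "d = e\<^sup>2 / (2 * real (Suc s))"
    have d: "d > 0" using e by (simp add: d_def)
    have es: "e\<^sup>2 / (2 * d) = real (Suc s)" using e by (simp add: d_def)
    define Q where "Q n E \<longleftrightarrow> E \<in> borel_measurable M \<and>
      prob {\<omega>\<in>space M. \<bar>SI n \<omega> - SJ n \<omega>\<bar> > e \<and> E \<omega> \<le> d} \<le> 2 * exp (- real (Suc s)) \<and>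
      (\<forall>\<omega>\<in>space M. ennreal (E \<omega>) \<le> 2 * A n \<omega> + 2 * B' n \<omega>)" for n E
    have "\<exists>E. Q n E" for n
    proof (rule simple_integral_diff_bound[OF sdb[of n] sd'[of n] t e d])
      fix E assume E: "E \<in> borel_measurable M"
        "prob {\<omega> \<in> space M. e < \<bar>simple_integral W (k n) (\<tau> n) (\<xi> n) t \<omega> - simple_integral W (K n) (\<rho> n) (\<zeta> n) t \<omega>\<bar> \<and> E \<omega> \<le> d}
          \<le> 2 * exp (- (e\<^sup>2 / (2 * d)))"
        "\<And>\<omega> G. (\<And>r. ennreal ((simple_process (k n) (\<tau> n) (\<xi> n) r \<omega> - simple_process (K n) (\<rho> n) (\<zeta> n) r \<omega>)\<^sup>2) \<le> G r)
          \<Longrightarrow> ennreal (E \<omega>) \<le> (\<integral>\<^sup>+r\<in>{0..t}. G r \<partial>lborel)"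
      have "ennreal (E \<omega>) \<le> 2 * A n \<omega> + 2 * B' n \<omega>" if "\<omega> \<in> space M" for \<omega>
        unfolding energy[OF that, symmetric]
      proof (rule E(3))
        fix r
        define u v where "u = simple_process (k n) (\<tau> n) (\<xi> n) r \<omega> - H r \<omega>"
          and "v = simple_process (K n) (\<rho> n) (\<zeta> n) r \<omega> - H r \<omega>"
        have "(u - v)\<^sup>2 \<le> 2 * u\<^sup>2 + 2 * v\<^sup>2"
          using zero_le_power2[of "u + v"] by (simp add: power2_eq_square algebra_simps)
        then have "ennreal ((u - v)\<^sup>2) \<le> ennreal (2 * u\<^sup>2 + 2 * v\<^sup>2)"
          by (rule ennreal_leI)
        also have "\<dots> = 2 * ennreal (u\<^sup>2) + 2 * ennreal (v\<^sup>2)"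
          by (simp add: ennreal_mult)
        finally show "ennreal ((simple_process (k n) (\<tau> n) (\<xi> n) r \<omega> - simple_process (K n) (\<rho> n) (\<zeta> n) r \<omega>)\<^sup>2)
            \<le> 2 * ennreal ((simple_process (k n) (\<tau> n) (\<xi> n) r \<omega> - H r \<omega>)\<^sup>2)
              + 2 * ennreal ((simple_process (K n) (\<rho> n) (\<zeta> n) r \<omega> - H r \<omega>)\<^sup>2)"
          by (simp add: u_def v_def)
      qed
      then show "\<exists>E. Q n E"
        using E(1,2) unfolding Q_def es SI_def SJ_def by blast
    qed
    then obtain E where "\<And>n. Q n (E n)" by metis
    then have E [measurable]: "\<And>n. E n \<in> borel_measurable M"
      and DE: "\<And>n. prob {\<omega>\<in>space M. \<bar>SI n \<omega> - SJ n \<omega>\<bar> > e \<and> E n \<omega> \<le> d} \<le> 2 * exp (- real (Suc s))"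
      and EAB: "\<And>n \<omega>. \<omega> \<in> space M \<Longrightarrow> ennreal (E n \<omega>) \<le> 2 * A n \<omega> + 2 * B' n \<omega>"
      unfolding Q_def by auto
    define S1 where "S1 n = {\<omega>\<in>space M. ennreal \<bar>SI n \<omega> - Y \<omega>\<bar> > ennreal e}" for n
    define S2 where "S2 n = {\<omega>\<in>space M. \<bar>SI n \<omega> - SJ n \<omega>\<bar> > e \<and> E n \<omega> \<le> d}" for n
    define S3 where "S3 n = {\<omega>\<in>space M. A n \<omega> > ennreal (d / 4)}" for n
    define S4 where "S4 n = {\<omega>\<in>space M. E n \<omega> > d \<and> A n \<omega> \<le> ennreal (d / 4)}" for n
    define S5 where "S5 n = {\<omega>\<in>space M. \<bar>SJ n \<omega> - J' \<omega>\<bar> > e}" for n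
    have S [measurable]: "S1 n \<in> events" "S2 n \<in> events" "S3 n \<in> events" "S4 n \<in> events" "S5 n \<in> events" for n
      unfolding S1_def S2_def S3_def S4_def S5_def by measurable
    have "prob {\<omega>\<in>space M. \<bar>Y \<omega> - J' \<omega>\<bar> > 3 * e}
        \<le> prob (S1 n) + 2 * exp (- real (Suc s)) + prob (S3 n) + prob (S4 n) + prob (S5 n)" for n
    proof -
      have "{\<omega>\<in>space M. \<bar>Y \<omega> - J' \<omega>\<bar> > 3 * e} \<subseteq> S1 n \<union> S2 n \<union> S3 n \<union> S4 n \<union> S5 n"
      proof
        fix \<omega> assume "\<omega> \<in> {\<omega>\<in>space M. \<bar>Y \<omega> - J' \<omega>\<bar> > 3 * e}"
        then have \<omega>: "\<omega> \<in> space M" "\<bar>Y \<omega> - J' \<omega>\<bar> > 3 * e" by auto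
        then have "\<bar>SI n \<omega> - Y \<omega>\<bar> > e \<or> \<bar>SI n \<omega> - SJ n \<omega>\<bar> > e \<or> \<bar>SJ n \<omega> - J' \<omega>\<bar> > e" by linarith
        then show "\<omega> \<in> S1 n \<union> S2 n \<union> S3 n \<union> S4 n \<union> S5 n"
          using \<omega>(1) e by (auto simp: S1_def S2_def S3_def S4_def S5_def ennreal_less_iff not_less not_le)
      qed
      then have "prob {\<omega>\<in>space M. \<bar>Y \<omega> - J' \<omega>\<bar> > 3 * e} \<le> prob (S1 n \<union> S2 n \<union> S3 n \<union> S4 n \<union> S5 n)"
        by (intro finite_measure_mono) auto
      also have "\<dots> \<le> prob (S1 n) + prob (S2 n) + prob (S3 n) + prob (S4 n) + prob (S5 n)"
        by (intro order_trans[OF measure_Un_le] add_right_mono) auto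
      also have "prob (S2 n) \<le> 2 * exp (- real (Suc s))"
        unfolding S2_def by (rule DE)
      finally show ?thesis by simp
    qed
    moreover have "(\<lambda>n. prob (S1 n)) \<longlonglongrightarrow> 0"
      using Cn e unfolding null_in_prob_def S1_def SI_def by blast
    moreover have "(\<lambda>n. prob (S3 n)) \<longlonglongrightarrow> 0"
      using An d unfolding null_in_prob_def S3_def A_def by simp
    moreover have "(\<lambda>n. prob (S4 n)) \<longlonglongrightarrow> 0"
    proof (rule prob_tendsto_0)
      show "AE \<omega> in M. \<forall>\<^sub>F n in sequentially. \<omega> \<notin> S4 n"
        using B AE_space
      proof eventually_elim
        case (elim \<omega>)
        have "\<forall>\<^sub>F n in sequentially. B' n \<omega> < ennreal (d / 4)"
          using elim(1) d unfolding B'_def by (intro order_tendstoD) auto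
        then show ?case
        proof eventually_elim
          case (elim n)
          show ?case
          proof
            assume "\<omega> \<in> S4 n"
            then have *: "E n \<omega> > d" "A n \<omega> \<le> ennreal (d / 4)" by (auto simp: S4_def)
            have "ennreal (E n \<omega>) \<le> 2 * A n \<omega> + 2 * B' n \<omega>"
              by (rule EAB) fact
            also have "\<dots> \<le> 2 * ennreal (d / 4) + 2 * ennreal (d / 4)"
              using *(2) elim by (intro add_mono mult_left_mono) auto
            also have "2 * ennreal (d / 4) = ennreal (d / 2)"
              using ennreal_mult[of 2 "d / 4"] d by simp
            also have "ennreal (d / 2) + ennreal (d / 2) = ennreal d"
              using ennreal_plus[of "d / 2" "d / 2"] d by simp
            finally show False using *(1) d by (simp add: ennreal_le_iff)
          qed
        qed
      qed
    qed auto
    moreover have "(\<lambda>n. prob (S5 n)) \<longlonglongrightarrow> 0"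
    proof (rule prob_tendsto_0)
      show "AE \<omega> in M. \<forall>\<^sub>F n in sequentially. \<omega> \<notin> S5 n"
        using J'
      proof eventually_elim
        case (elim \<omega>)
        then have "\<forall>\<^sub>F n in sequentially. dist (SJ n \<omega>) (J' \<omega>) < e"
          using e by (rule tendstoD)
        then show ?case
          by eventually_elim (auto simp: S5_def dist_real_def)
      qed
    qed auto
    ultimately have "prob {\<omega>\<in>space M. \<bar>Y \<omega> - J' \<omega>\<bar> > 3 * e} \<le> 0 + 2 * exp (- real (Suc s)) + 0 + 0 + 0"
      by (intro LIMSEQ_le_const[where X="\<lambda>n. prob (S1 n) + 2 * exp (- real (Suc s)) + prob (S3 n) + prob (S4 n) + prob (S5 n)"]
        tendsto_add tendsto_const) auto
    then show ?thesis by simp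
  qed
  have "(\<lambda>s. 2 * exp (- real (Suc s))) \<longlonglongrightarrow> 2 * 0"
    by (intro tendsto_intros filterlim_compose[OF exp_at_bot] filterlim_compose[OF filterlim_uminus_at_bot_at_top]
        filterlim_compose[OF filterlim_real_sequentially filterlim_Suc])
  then have z: "prob {\<omega>\<in>space M. \<bar>Y \<omega> - J' \<omega>\<bar> > 3 * e} = 0" if "e > 0" for e
    using LIMSEQ_le_const[of "\<lambda>s. 2 * exp (- real (Suc s))" 0] bound[OF that] measure_nonneg
    by (metis (no_types, lifting) dual_order.antisym mult_zero_right)
  have "AE \<omega> in M. \<not> \<bar>Y \<omega> - J' \<omega>\<bar> > 3 * (1 / real (Suc n))" for n
  proof (subst prob_Collect_eq_0[symmetric])
    show "prob {\<omega>\<in>space M. \<bar>Y \<omega> - J' \<omega>\<bar> > 3 * (1 / real (Suc n))} = 0"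
      by (rule z) simp
  qed measurable
  then have "AE \<omega> in M. \<forall>n. \<not> \<bar>Y \<omega> - J' \<omega>\<bar> > 3 * (1 / real (Suc n))"
    by (simp add: AE_all_countable)
  then show ?thesis
    using JJ'
  proof eventually_elim
    case (elim \<omega>)
    have "(\<lambda>n. 3 * (1 / real (Suc n))) \<longlonglongrightarrow> 3 * 0"
      by (intro tendsto_intros lim_1_over_n[THEN LIMSEQ_Suc])
    then have "\<bar>Y \<omega> - J' \<omega>\<bar> \<le> 3 * 0"
      using elim(1) by (intro LIMSEQ_le_const) (auto simp: not_less)
    then show ?case using elim(2) by simp
  qed
qed

lemma ito_integral_0:
  assumes ito: "ito_integral M F W H 0 Y"
  shows "AE \<omega> in M. Y \<omega> = 0"
proof -
  from ito obtain k \<tau> \<xi> where sd: "\<And>n. simple_data F (k n) (\<tau> n) (\<xi> n)"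
    and Cn: "null_in_prob M (\<lambda>n \<omega>. ennreal \<bar>simple_integral W (k n) (\<tau> n) (\<xi> n) 0 \<omega> - Y \<omega>\<bar>)"
    and YF: "Y \<in> borel_measurable (F 0)"
    unfolding ito_integral_def by blast
  have YM [measurable]: "Y \<in> borel_measurable M" by (rule measurable_F_M[OF YF])
  have "simple_integral W (k n) (\<tau> n) (\<xi> n) 0 \<omega> = 0" for n \<omega>
  proof -
    have "step_data (k n) (\<tau> n) (\<xi> n)"
      using sd[of n] by (simp add: simple_data_def step_data_def)
    then have "min 0 (\<tau> n i) = 0" if "i \<le> k n" for i
      using step_data_nonneg[OF _ that] by (simp add: min_def)
    then show ?thesis unfolding simple_integral_def by simp
  qed
  then have z: "prob {\<omega>\<in>space M. ennreal \<bar>Y \<omega>\<bar> > ennreal e} = 0" if "e > 0" for e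
    using Cn that unfolding null_in_prob_def by (simp add: LIMSEQ_const_iff)
  have "AE \<omega> in M. \<not> ennreal \<bar>Y \<omega>\<bar> > ennreal (1 / real (Suc n))" for n
  proof (subst prob_Collect_eq_0[symmetric])
    show "prob {\<omega>\<in>space M. ennreal \<bar>Y \<omega>\<bar> > ennreal (1 / real (Suc n))} = 0"
      by (rule z) simp
  qed measurable
  then have "AE \<omega> in M. \<forall>n. \<not> ennreal \<bar>Y \<omega>\<bar> > ennreal (1 / real (Suc n))"
    by (simp only: AE_all_countable) blast
  then show ?thesis
  proof eventually_elim
    case (elim \<omega>)
    then have "\<bar>Y \<omega>\<bar> \<le> 1 / real (Suc n)" for n
      by (metis ennreal_less_iff abs_ge_zero divide_nonneg_nonneg of_nat_0_le_iff zero_le_one not_less)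
    moreover have "(\<lambda>n. 1 / real (Suc n)) \<longlonglongrightarrow> 0"
      by (intro lim_1_over_n[THEN LIMSEQ_Suc])
    ultimately have "\<bar>Y \<omega>\<bar> \<le> 0"
      by (intro LIMSEQ_le_const) auto
    then show ?case by simp
  qed
qed

end

section \<open>The density as a functional of the path\<close>

lemma LBINT_eq_integral:
  fixes f :: "real \<Rightarrow> real"
  assumes "continuous_on {a..b} f"
  shows "(LBINT r:{a..b}. f r) = integral {a..b} f"
  by (rule set_borel_integral_eq_integral(2)[OF borel_integrable_atLeastAtMost'[OF assms]])

lemma sde_path_sums:
  fixes X w lam lam' L :: "real \<Rightarrow> real"
  assumes ab: "a < b" and X: "continuous_on {a..b} X" and w: "continuous_on {a..b} w"
    and qv: "has_qv a b w 1"
    and lam: "\<And>v. (lam has_real_derivative lam' v) (at v)" and lam': "continuous_on UNIV lam'"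
    and L: "\<And>v. (L has_real_derivative lam v) (at v)"
    and incr: "\<forall>s t. a \<le> s \<and> s \<le> t \<and> t \<le> b \<longrightarrow>
        X t - X s = integral {s..t} (\<lambda>r. lam (X r)) + \<sigma> * (w t - w s)"
    and \<sigma>: "\<sigma> > 0"
  shows "(\<lambda>n. \<Sum>i<2 ^ n. lam (X (dpt a b n i)) * (w (dpt a b n (Suc i)) - w (dpt a b n i)))
      \<longlonglongrightarrow> (L (X b) - L (X a) - integral {a..b} (\<lambda>r. (lam (X r))\<^sup>2)
          - \<sigma>\<^sup>2 / 2 * integral {a..b} (\<lambda>r. lam' (X r))) / \<sigma>"
proof -
  let ?J = "\<lambda>n i. integral {dpt a b n i..dpt a b n (Suc i)} (\<lambda>r. lam (X r))"
  let ?dX = "\<lambda>n i. X (dpt a b n (Suc i)) - X (dpt a b n i)"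
  let ?dw = "\<lambda>n i. w (dpt a b n (Suc i)) - w (dpt a b n i)"
  have ab': "a \<le> b" using ab by simp
  have cl: "continuous_on {a..b} (\<lambda>r. lam (X r))"
    by (rule continuous_on_compose2[OF DERIV_continuous_on[of UNIV lam lam'] X]) (auto simp: lam)
  obtain B where B: "B > 0" "\<And>r. r \<in> {a..b} \<Longrightarrow> \<bar>lam (X r)\<bar> \<le> B"
    by (rule continuous_on_compact_abs_bound[OF cl compact_Icc]) (rule that)
  define g where "g t = X a - \<sigma> * w a + integral {a..t} (\<lambda>r. lam (X r))" for t
  have gdiff: "\<bar>g t - g s\<bar> \<le> B * \<bar>t - s\<bar>" if "s \<in> {a..b}" "t \<in> {a..b}" "s \<le> t" for s t
  proof -
    have "integral {a..s} (\<lambda>r. lam (X r)) + integral {s..t} (\<lambda>r. lam (X r)) = integral {a..t} (\<lambda>r. lam (X r))"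
      using that by (intro Henstock_Kurzweil_Integration.integral_combine integrable_continuous_interval continuous_on_subset[OF cl]) auto
    then have "\<bar>g t - g s\<bar> = norm (integral {s..t} (\<lambda>r. lam (X r)))"
      by (simp add: g_def)
    also have "\<dots> \<le> B * (t - s)"
      using that B(2) by (intro integral_bound continuous_on_subset[OF cl]) auto
    finally show ?thesis using that by simp
  qed
  have "B-lipschitz_on {a..b} g"
  proof (rule lipschitz_onI)
    fix s t assume st: "s \<in> {a..b}" "t \<in> {a..b}"
    show "dist (g s) (g t) \<le> B * dist s t"
    proof (cases "s \<le> t")
      case True
      then show ?thesis using gdiff[OF st] by (simp add: dist_real_def abs_minus_commute)
    next
      case False
      then show ?thesis using gdiff[OF st(2,1)] by (simp add: dist_real_def)
    qed
  qed (use B in auto)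
  moreover have "X t = g t + \<sigma> * w t" if "t \<in> {a..b}" for t
    using incr[rule_format, of a t] that by (simp add: g_def algebra_simps)
  ultimately have qvX: "has_qv a b X (\<sigma>\<^sup>2 * 1)"
    by (intro has_qv_add_lipschitz[OF ab' w qv])
  have F: "(\<lambda>n. \<Sum>i<2 ^ n. lam (X (dpt a b n i)) * ?dX n i)
      \<longlonglongrightarrow> L (X b) - L (X a) - \<sigma>\<^sup>2 * 1 / 2 * integral {a..b} (\<lambda>r. lam' (X r))"
    by (rule foellmer_ito[OF ab' X qvX L lam lam'])
  have R: "(\<lambda>n. \<Sum>i<2 ^ n. lam (X (dpt a b n i)) * ?J n i)
      \<longlonglongrightarrow> integral {a..b} (\<lambda>r. lam (X r) * lam (X r))"
    by (rule weighted_riemann_sum_tendsto[OF ab' cl cl])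
  have "(\<Sum>i<2 ^ n. lam (X (dpt a b n i)) * ?dw n i)
      = ((\<Sum>i<2 ^ n. lam (X (dpt a b n i)) * ?dX n i)
        - (\<Sum>i<2 ^ n. lam (X (dpt a b n i)) * ?J n i)) / \<sigma>" for n
  proof -
    have "lam (X (dpt a b n i)) * ?dw n i
       = (lam (X (dpt a b n i)) * ?dX n i
        - lam (X (dpt a b n i)) * ?J n i) / \<sigma>"
      if i: "i < 2 ^ n" for i
    proof -
      have "X (dpt a b n (Suc i)) - X (dpt a b n i) = ?J n i
          + \<sigma> * ?dw n i"
        using incr dpt_ge[OF ab', of n i] dpt_mono[OF ab', of i "Suc i" n] dpt_le[OF ab', of "Suc i" n] i by auto
      then show ?thesis using \<sigma> by (simp add: right_diff_distrib[symmetric])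
    qed
    then show ?thesis
      by (simp add: sum_subtractf[symmetric] sum_divide_distrib)
  qed
  moreover have "(\<lambda>n. ((\<Sum>i<2 ^ n. lam (X (dpt a b n i)) * ?dX n i)
        - (\<Sum>i<2 ^ n. lam (X (dpt a b n i)) * ?J n i)) / \<sigma>)
      \<longlonglongrightarrow> (L (X b) - L (X a) - \<sigma>\<^sup>2 * 1 / 2 * integral {a..b} (\<lambda>r. lam' (X r))
        - integral {a..b} (\<lambda>r. lam (X r) * lam (X r))) / \<sigma>"
    using \<sigma> by (intro tendsto_divide tendsto_diff F R tendsto_const) auto
  moreover have "L (X b) - L (X a) - \<sigma>\<^sup>2 * 1 / 2 * integral {a..b} (\<lambda>r. lam' (X r))
        - integral {a..b} (\<lambda>r. lam (X r) * lam (X r))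
      = L (X b) - L (X a) - integral {a..b} (\<lambda>r. (lam (X r))\<^sup>2)
        - \<sigma>\<^sup>2 / 2 * integral {a..b} (\<lambda>r. lam' (X r))"
    by (simp add: power2_eq_square)
  ultimately show ?thesis by (simp only:)
qed

locale sde = brownian M F W
  for M :: "'a measure" and F :: "real \<Rightarrow> 'a measure" and W :: "real \<Rightarrow> 'a \<Rightarrow> real" +
  fixes \<sigma> x :: real and lam lam' L :: "real \<Rightarrow> real" and X :: "real \<Rightarrow> 'a \<Rightarrow> real"
  assumes \<sigma>: "\<sigma> > 0"
    and lam: "\<And>v. (lam has_real_derivative lam' v) (at v)" and lam': "continuous_on UNIV lam'"
    and L: "\<And>v. (L has_real_derivative lam v) (at v)"
    and sol: "sde_solution M F W lam \<sigma> x X"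
begin

lemma lam_cont: "continuous_on S lam"
  using DERIV_continuous_on[of UNIV lam lam'] lam by (blast intro: continuous_on_subset)

lemma L_cont: "continuous_on S L"
  using DERIV_continuous_on[of UNIV L lam] L by (blast intro: continuous_on_subset)

lemma X_measurable: "0 \<le> t \<Longrightarrow> X t \<in> borel_measurable (F t)"
  using sol unfolding sde_solution_def continuous_adapted_def by blast

lemma X_cont: "\<omega> \<in> space M \<Longrightarrow> 0 \<le> a \<Longrightarrow> continuous_on {a..b} (\<lambda>t. X t \<omega>)"
  by (rule continuous_on_subset[of "{0..}"])
    (use sol in \<open>auto simp: sde_solution_def continuous_adapted_def\<close>)

lemma comp_X_cont:
  assumes "continuous_on UNIV f" "\<omega> \<in> space M" "0 \<le> a"
  shows "continuous_on {a..b} (\<lambda>t. f (X t \<omega>) :: real)"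
  by (rule continuous_on_compose2[OF assms(1) X_cont[OF assms(2,3)]]) auto

definition good :: "'a \<Rightarrow> bool" where
  "good \<omega> \<longleftrightarrow> \<omega> \<in> space M \<and> X 0 \<omega> = x \<and> (\<forall>s t. 0 \<le> s \<and> s \<le> t \<longrightarrow>
     X t \<omega> - X s \<omega> = integral {s..t} (\<lambda>r. lam (X r \<omega>)) + \<sigma> * (W t \<omega> - W s \<omega>))"

lemma AE_good: "AE \<omega> in M. good \<omega>"
proof -
  have "AE \<omega> in M. \<forall>t\<ge>0. X t \<omega> = x + (LBINT r:{0..t}. lam (X r \<omega>)) + \<sigma> * W t \<omega>"
    using sol by (simp add: sde_solution_def)
  moreover have "AE \<omega> in M. W 0 \<omega> = 0"
    using brownian by (simp add: brownian_motion_def)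
  ultimately show ?thesis
    using AE_space
  proof eventually_elim
    case (elim \<omega>)
    have X: "X t \<omega> = x + integral {0..t} (\<lambda>r. lam (X r \<omega>)) + \<sigma> * W t \<omega>" if "t \<ge> 0" for t
      using elim(1) that LBINT_eq_integral[OF comp_X_cont[OF lam_cont elim(3)], of 0 t] by simp
    have "X t \<omega> - X s \<omega> = integral {s..t} (\<lambda>r. lam (X r \<omega>)) + \<sigma> * (W t \<omega> - W s \<omega>)"
      if st: "0 \<le> s" "s \<le> t" for s t
    proof -
      have "integral {0..s} (\<lambda>r. lam (X r \<omega>)) + integral {s..t} (\<lambda>r. lam (X r \<omega>)) = integral {0..t} (\<lambda>r. lam (X r \<omega>))"
        using st by (intro Henstock_Kurzweil_Integration.integral_combine integrable_continuous_interval comp_X_cont lam_cont elim) auto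
      then show ?thesis
        using X[of s] X[of t] st by (simp add: right_diff_distrib)
    qed
    moreover have "X 0 \<omega> = x" using X[of 0] elim(2) by simp
    ultimately show ?case using elim(3) by (simp add: good_def)
  qed
qed

definition V :: "real \<Rightarrow> real" where
  "V y = (lam y)\<^sup>2 / \<sigma>\<^sup>2 + lam' y"

lemma V_cont: "continuous_on UNIV V"
  unfolding V_def[abs_def] using \<sigma> by (intro continuous_intros lam_cont lam') auto

lemma AE_ito_sums:
  assumes ab: "0 \<le> a" "a < b"
  shows "AE \<omega> in M. (\<lambda>n. \<Sum>i<2 ^ n. lam (X (dpt a b n i) \<omega>) * (W (dpt a b n (Suc i)) \<omega> - W (dpt a b n i) \<omega>))
      \<longlonglongrightarrow> (L (X b \<omega>) - L (X a \<omega>) - integral {a..b} (\<lambda>r. (lam (X r \<omega>))\<^sup>2)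
          - \<sigma>\<^sup>2 / 2 * integral {a..b} (\<lambda>r. lam' (X r \<omega>))) / \<sigma>"
  using AE_good AE_has_qv[OF ab]
proof eventually_elim
  case (elim \<omega>)
  then have \<omega>: "\<omega> \<in> space M" by (simp add: good_def)
  have w: "continuous_on {a..b} (\<lambda>t. W t \<omega>)"
    by (rule continuous_on_subset[OF W_continuous[OF \<omega>]]) (use ab in auto)
  show ?case
  proof (rule sde_path_sums[OF ab(2) X_cont[OF \<omega> ab(1)] w elim(2) lam lam' L _ \<sigma>])
    show "\<forall>s t. a \<le> s \<and> s \<le> t \<and> t \<le> b \<longrightarrow>
        X t \<omega> - X s \<omega> = integral {s..t} (\<lambda>r. lam (X r \<omega>)) + \<sigma> * (W t \<omega> - W s \<omega>)"
      using elim(1) ab(1) unfolding good_def by auto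
  qed
qed

lemma step_process_L2_tendsto:
  assumes t: "0 < t" and H: "continuous_on {0..t} H"
  shows "(\<lambda>n. \<integral>\<^sup>+r\<in>{0..t}. ennreal ((simple_process (2 ^ n) (dpt 0 t n) (\<lambda>i _. H (dpt 0 t n i)) r \<omega> - H r)\<^sup>2) \<partial>lborel)
      \<longlonglongrightarrow> 0"
proof (rule tendsto_zero_ennreal)
  let ?h = "\<lambda>n r. simple_process (2 ^ n) (dpt 0 t n) (\<lambda>i _. H (dpt 0 t n i)) r \<omega>"
  fix e :: real assume e: "0 < e"
  define \<epsilon> where "\<epsilon> = sqrt (e / (2 * t))"
  have \<epsilon>: "\<epsilon> > 0" "\<epsilon>\<^sup>2 * t < e" using e t by (auto simp: \<epsilon>_def)
  have t': "0 \<le> t" using t by simp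
  show "\<forall>\<^sub>F n in sequentially. (\<integral>\<^sup>+r\<in>{0..t}. ennreal ((?h n r - H r)\<^sup>2) \<partial>lborel)
      < ennreal e"
    using dyadic_oscillation[OF t' H \<epsilon>(1)]
  proof eventually_elim
    case (elim n)
    have chain: "\<forall>i<2 ^ n. dpt 0 t n i < dpt 0 t n (Suc i)"
      using t by (auto intro: dpt_strict_mono)
    have "ennreal ((?h n r - H r)\<^sup>2) * indicator {0..t} r
        \<le> ennreal (\<epsilon>\<^sup>2) * indicator {0..t} r" if "r \<noteq> 0" for r
    proof (cases "r \<in> {0..t}")
      case True
      then have "0 < r" "r \<le> t" using that by auto
      then obtain j where j: "j < 2 ^ n" "r \<in> {dpt 0 t n j<..dpt 0 t n (Suc j)}"
        using chain_cell_exists[of "dpt 0 t n" r "2 ^ n"] by auto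
      have "?h n r = H (dpt 0 t n j)"
        unfolding simple_process_def by (rule sum_indicator_chain[OF chain j])
      moreover have "\<bar>H (dpt 0 t n j) - H r\<bar> < \<epsilon>"
        using elim j dpt_mono[OF t', of j "Suc j" n] by auto
      then have "(H (dpt 0 t n j) - H r)\<^sup>2 \<le> \<epsilon>\<^sup>2"
        by (intro abs_le_square_iff[THEN iffD1]) auto
      ultimately show ?thesis
        by (intro mult_right_mono ennreal_leI) auto
    qed simp
    then have "(\<integral>\<^sup>+r\<in>{0..t}. ennreal ((?h n r - H r)\<^sup>2) \<partial>lborel)
        \<le> (\<integral>\<^sup>+r\<in>{0..t}. ennreal (\<epsilon>\<^sup>2) \<partial>lborel)"
      by (intro nn_integral_mono_AE eventually_mono[OF AE_lborel_singleton[of "0::real"]])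
    also have "\<dots> = ennreal (\<epsilon>\<^sup>2 * t)"
      using t by (subst nn_integral_cmult_indicator) (auto simp: ennreal_mult)
    also have "\<dots> < ennreal e"
      using \<epsilon>(2) e by (intro ennreal_lessI) auto
    finally show ?case .
  qed
qed

lemma eta_cont: "continuous_on UNIV (eta lam \<sigma>)"
  unfolding eta_def[abs_def] using \<sigma> by (intro continuous_intros lam_cont) auto

lemma ito_integral_explicit:
  assumes t: "0 \<le> t" and ito: "ito_integral M F W (\<lambda>r \<omega>. eta lam \<sigma> (X r \<omega>)) t Y"
  shows "AE \<omega> in M. Y \<omega> = (L (X t \<omega>) - L x - integral {0..t} (\<lambda>r. (lam (X r \<omega>))\<^sup>2)
          - \<sigma>\<^sup>2 / 2 * integral {0..t} (\<lambda>r. lam' (X r \<omega>))) / \<sigma>\<^sup>2"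
proof (cases "t = 0")
  case True
  then show ?thesis
    using ito_integral_0[of "\<lambda>r \<omega>. eta lam \<sigma> (X r \<omega>)" Y] ito AE_good
    by (auto simp: good_def elim: AE_mp)
next
  case False
  then have t: "0 < t" using t by simp
  have t': "0 \<le> t" using t by simp
  define \<xi> where "\<xi> n i \<omega> = eta lam \<sigma> (X (dpt 0 t n i) \<omega>)" for n i \<omega>
  show ?thesis
  proof (rule ito_integral_limit_unique[OF t ito])
    show "step_data (2 ^ n) (dpt 0 t n) (\<xi> n)" for n
      unfolding step_data_def
    proof (intro conjI allI impI)
      fix i :: nat
      have "X (dpt 0 t n i) \<in> borel_measurable (F (dpt 0 t n i))"
        by (intro X_measurable dpt_ge t')
      then show "\<xi> n i \<in> borel_measurable (F (dpt 0 t n i))"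
        unfolding \<xi>_def[abs_def] eta_def[abs_def]
        by (intro borel_measurable_divide measurable_const borel_measurable_continuous_on[OF lam_cont]) auto
      show "dpt 0 t n i < dpt 0 t n (Suc i)" using t by (intro dpt_strict_mono) auto
    qed simp
    show "AE \<omega> in M. (\<lambda>n. \<integral>\<^sup>+r\<in>{0..t}. ennreal ((simple_process (2 ^ n) (dpt 0 t n) (\<xi> n) r \<omega> - eta lam \<sigma> (X r \<omega>))\<^sup>2) \<partial>lborel) \<longlonglongrightarrow> 0"
    proof (rule AE_I2)
      fix \<omega> assume "\<omega> \<in> space M"
      from step_process_L2_tendsto[OF t comp_X_cont[OF eta_cont this order_refl]]
      show "(\<lambda>n. \<integral>\<^sup>+r\<in>{0..t}. ennreal ((simple_process (2 ^ n) (dpt 0 t n) (\<xi> n) r \<omega> - eta lam \<sigma> (X r \<omega>))\<^sup>2) \<partial>lborel) \<longlonglongrightarrow> 0"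
        unfolding \<xi>_def[abs_def] simple_process_def by simp
    qed
    show "AE \<omega> in M. (\<lambda>n. simple_integral W (2 ^ n) (dpt 0 t n) (\<xi> n) t \<omega>)
        \<longlonglongrightarrow> (L (X t \<omega>) - L x - integral {0..t} (\<lambda>r. (lam (X r \<omega>))\<^sup>2)
          - \<sigma>\<^sup>2 / 2 * integral {0..t} (\<lambda>r. lam' (X r \<omega>))) / \<sigma>\<^sup>2"
      using AE_ito_sums[OF order_refl t] AE_good
    proof eventually_elim
      case (elim \<omega>)
      have "simple_integral W (2 ^ n) (dpt 0 t n) (\<xi> n) t \<omega>
          = (\<Sum>i<2 ^ n. lam (X (dpt 0 t n i) \<omega>) * (W (dpt 0 t n (Suc i)) \<omega> - W (dpt 0 t n i) \<omega>)) / \<sigma>" for n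
        unfolding simple_integral_def \<xi>_def eta_def sum_divide_distrib
      proof (intro sum.cong refl)
        fix i :: nat assume "i \<in> {..<2 ^ n}"
        then have "min t (dpt 0 t n (Suc i)) = dpt 0 t n (Suc i)" "min t (dpt 0 t n i) = dpt 0 t n i"
          using dpt_le[OF t', of "Suc i" n] dpt_le[OF t', of i n] by auto
        then show "lam (X (dpt 0 t n i) \<omega>) / \<sigma> * (W (min t (dpt 0 t n (Suc i))) \<omega> - W (min t (dpt 0 t n i)) \<omega>)
           = lam (X (dpt 0 t n i) \<omega>) * (W (dpt 0 t n (Suc i)) \<omega> - W (dpt 0 t n i) \<omega>) / \<sigma>" by simp
      qed
      moreover have "(\<lambda>n. (\<Sum>i<2 ^ n. lam (X (dpt 0 t n i) \<omega>) * (W (dpt 0 t n (Suc i)) \<omega> - W (dpt 0 t n i) \<omega>)) / \<sigma>)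
        \<longlonglongrightarrow> (L (X t \<omega>) - L (X 0 \<omega>) - integral {0..t} (\<lambda>r. (lam (X r \<omega>))\<^sup>2)
          - \<sigma>\<^sup>2 / 2 * integral {0..t} (\<lambda>r. lam' (X r \<omega>))) / \<sigma> / \<sigma>"
        using elim(1) \<sigma> by (intro tendsto_divide tendsto_const) auto
      ultimately show ?case
        using elim(2) by (simp add: good_def power2_eq_square)
    qed
  qed
qed

lemma integral_V:
  assumes "\<omega> \<in> space M" "0 \<le> a"
  shows "integral {a..b} (\<lambda>r. V (X r \<omega>))
    = integral {a..b} (\<lambda>r. (lam (X r \<omega>))\<^sup>2) / \<sigma>\<^sup>2 + integral {a..b} (\<lambda>r. lam' (X r \<omega>))"
proof -
  have "integral {a..b} (\<lambda>r. V (X r \<omega>))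
      = integral {a..b} (\<lambda>r. (lam (X r \<omega>))\<^sup>2 / \<sigma>\<^sup>2) + integral {a..b} (\<lambda>r. lam' (X r \<omega>))"
    unfolding V_def
    by (intro Henstock_Kurzweil_Integration.integral_add integrable_continuous_interval continuous_on_divide
        continuous_on_power comp_X_cont assms lam_cont lam' continuous_on_const) (use \<sigma> in auto)
  then show ?thesis by simp
qed

lemma dens_explicit:
  assumes t: "0 \<le> t" and ito: "ito_integral M F W (\<lambda>r \<omega>. eta lam \<sigma> (X r \<omega>)) t (I t)"
  shows "AE \<omega> in M. dens lam \<sigma> X I t \<omega>
    = exp (- (L (X t \<omega>) - L x) / \<sigma>\<^sup>2 + integral {0..t} (\<lambda>r. V (X r \<omega>)) / 2)"
  using ito_integral_explicit[OF t ito] AE_space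
proof eventually_elim
  case (elim \<omega>)
  have "(LBINT r:{0..t}. (eta lam \<sigma> (X r \<omega>))\<^sup>2) = integral {0..t} (\<lambda>r. (eta lam \<sigma> (X r \<omega>))\<^sup>2)"
    by (intro LBINT_eq_integral continuous_on_power comp_X_cont[OF eta_cont elim(2)]) auto
  also have "\<dots> = integral {0..t} (\<lambda>r. (lam (X r \<omega>))\<^sup>2) / \<sigma>\<^sup>2"
    by (simp add: eta_def power_divide)
  finally have 1: "(LBINT r:{0..t}. (eta lam \<sigma> (X r \<omega>))\<^sup>2) = integral {0..t} (\<lambda>r. (lam (X r \<omega>))\<^sup>2) / \<sigma>\<^sup>2" .
  have "- ((l - A - \<sigma>\<^sup>2 / 2 * B) / \<sigma>\<^sup>2) - 1 / 2 * (A / \<sigma>\<^sup>2) = - l / \<sigma>\<^sup>2 + (A / \<sigma>\<^sup>2 + B) / 2" for l A B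
    using \<sigma> by (simp add: field_simps)
  then show ?case
    unfolding dens_def 1 elim(1) integral_V[OF elim(2) order_refl] by (rule arg_cong)
qed

lemma dens_measurable:
  assumes ito: "ito_integral M F W (\<lambda>r \<omega>. eta lam \<sigma> (X r \<omega>)) t (I t)"
  shows "dens lam \<sigma> X I t \<in> borel_measurable (F t)"
proof -
  let ?R = "restrict_space lborel {0..t} :: real measure"
  interpret R: sigma_finite_measure ?R
    by (rule sigma_finite_measure_restrict_space) (auto simp: sigma_finite_lborel)
  have [measurable]: "I t \<in> borel_measurable (F t)"
    using ito by (simp add: ito_integral_def)
  have "(\<lambda>(r, \<omega>). eta lam \<sigma> (X r \<omega>)) \<in> borel_measurable (restrict_space borel {0..t} \<Otimes>\<^sub>M F t)"
    using ito by (simp add: ito_integral_def)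
  also have "sets (restrict_space borel {0..t} \<Otimes>\<^sub>M F t) = sets (?R \<Otimes>\<^sub>M F t)"
    by (intro sets_pair_measure_cong restrict_space_sets_cong) auto
  then have "borel_measurable (restrict_space borel {0..t} \<Otimes>\<^sub>M F t) = borel_measurable (?R \<Otimes>\<^sub>M F t)"
    by (rule measurable_cong_sets) simp
  finally have m: "(\<lambda>(r, \<omega>). eta lam \<sigma> (X r \<omega>)) \<in> borel_measurable (?R \<Otimes>\<^sub>M F t)" .
  have "(\<lambda>p. (\<lambda>(r, \<omega>). eta lam \<sigma> (X r \<omega>)) (snd p, fst p)) \<in> borel_measurable (F t \<Otimes>\<^sub>M ?R)"
    by (rule measurable_compose[OF _ m]) measurable
  then have [measurable]: "(\<lambda>(\<omega>, r). eta lam \<sigma> (X r \<omega>)) \<in> borel_measurable (F t \<Otimes>\<^sub>M ?R)"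
    by (simp add: case_prod_unfold)
  have "(LBINT r:{0..t}. (eta lam \<sigma> (X r \<omega>))\<^sup>2) = (\<integral>r. (eta lam \<sigma> (X r \<omega>))\<^sup>2 \<partial>?R)" for \<omega>
    by (subst integral_restrict_space) (auto simp: set_lebesgue_integral_def)
  then show ?thesis
    unfolding dens_def[abs_def] by simp measurable
qed

text \<open>Fatou's lemma along dyadic partitions of \<open>[s, t]\<close>.\<close>

lemma dens_supermartingale:
  assumes st: "0 \<le> s" "s < t"
    and itos: "ito_integral M F W (\<lambda>r \<omega>. eta lam \<sigma> (X r \<omega>)) s (I s)"
    and itot: "ito_integral M F W (\<lambda>r \<omega>. eta lam \<sigma> (X r \<omega>)) t (I t)"
    and A: "A \<in> sets (F s)"
  shows "(\<integral>\<^sup>+\<omega>\<in>A. ennreal (dens lam \<sigma> X I t \<omega>) \<partial>M) \<le> (\<integral>\<^sup>+\<omega>\<in>A. ennreal (dens lam \<sigma> X I s \<omega>) \<partial>M)"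
proof -
  have st': "s \<le> t" using st by simp
  define G where "G n i \<omega> = - lam (X (dpt s t n i) \<omega>) / \<sigma>" for n i \<omega>
  define R where "R n \<omega> = (\<Sum>i<2 ^ n. G n i \<omega> * (W (dpt s t n (Suc i)) \<omega> - W (dpt s t n i) \<omega>))
      - (\<Sum>i<2 ^ n. (G n i \<omega>)\<^sup>2 * (dpt s t n (Suc i) - dpt s t n i)) / 2" for n \<omega>
  define H where "H \<omega> = ennreal (dens lam \<sigma> X I s \<omega>) * indicator A \<omega>" for \<omega>
  have Gm: "G n i \<in> borel_measurable (F (dpt s t n i))" for n i
  proof -
    have "X (dpt s t n i) \<in> borel_measurable (F (dpt s t n i))"
      using st dpt_ge[OF st', of n i] by (intro X_measurable) auto
    then show ?thesis
      unfolding G_def[abs_def]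
      by (intro borel_measurable_divide borel_measurable_uminus measurable_const borel_measurable_continuous_on[OF lam_cont]) auto
  qed
  have Hm: "H \<in> borel_measurable (F s)"
    unfolding H_def[abs_def] using dens_measurable[of s I, OF itos] A by measurable
  have chain: "dpt s t n i < dpt s t n (Suc i)" for n i
    using st by (intro dpt_strict_mono) auto
  have ER: "(\<integral>\<^sup>+\<omega>. H \<omega> * ennreal (exp (R n \<omega>)) \<partial>M) = (\<integral>\<^sup>+\<omega>. H \<omega> \<partial>M)" for n
    unfolding R_def using st chain Gm Hm
    by (intro nn_integral_exp_martingale) auto
  have Rm [measurable]: "R n \<in> borel_measurable M" for n
  proof -
    have "G n i \<in> borel_measurable M" for i by (rule measurable_F_M[OF Gm])
    moreover have "W (dpt s t n i) \<in> borel_measurable M" for i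
      using st dpt_ge[OF st', of n i] by (intro W_measurable_M) auto
    ultimately show ?thesis unfolding R_def[abs_def] by measurable
  qed
  have [measurable]: "H \<in> borel_measurable M" by (rule measurable_F_M[OF Hm])
  have "AE \<omega> in M. (\<lambda>n. H \<omega> * ennreal (exp (R n \<omega>))) \<longlonglongrightarrow> ennreal (dens lam \<sigma> X I t \<omega>) * indicator A \<omega>"
    using AE_ito_sums[OF st] AE_good dens_explicit[where I=I, OF st(1) itos]
      dens_explicit[where I=I, OF order_trans[OF st(1) st'] itot]
  proof eventually_elim
    case (elim \<omega>)
    then have \<omega>: "\<omega> \<in> space M" by (simp add: good_def)
    let ?A = "integral {s..t} (\<lambda>r. (lam (X r \<omega>))\<^sup>2)" and ?B = "integral {s..t} (\<lambda>r. lam' (X r \<omega>))"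
    let ?S = "\<lambda>n. \<Sum>i<2 ^ n. lam (X (dpt s t n i) \<omega>) * (W (dpt s t n (Suc i)) \<omega> - W (dpt s t n i) \<omega>)"
    let ?Q = "\<lambda>n. \<Sum>i<2 ^ n. (lam (X (dpt s t n i) \<omega>))\<^sup>2 * ((t - s) / 2 ^ n)"
    have "?Q \<longlonglongrightarrow> ?A"
      by (intro riemann_sum_tendsto[OF st'] continuous_on_power comp_X_cont lam_cont \<omega> st)
    then have "(\<lambda>n. - ?S n / \<sigma> - (?Q n / \<sigma>\<^sup>2) / 2) \<longlonglongrightarrow>
        - ((L (X t \<omega>) - L (X s \<omega>) - ?A - \<sigma>\<^sup>2 / 2 * ?B) / \<sigma>) / \<sigma> - (?A / \<sigma>\<^sup>2) / 2"
      using elim(1) \<sigma> by (intro tendsto_intros) auto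
    moreover have "- ?S n / \<sigma> - (?Q n / \<sigma>\<^sup>2) / 2 = R n \<omega>" for n
      unfolding R_def G_def
      by (simp add: sum_divide_distrib sum_negf power_divide dpt_Suc mult.commute[of "\<sigma>\<^sup>2"] flip: sum_negf)
    moreover have "- ((L (X t \<omega>) - L (X s \<omega>) - ?A - \<sigma>\<^sup>2 / 2 * ?B) / \<sigma>) / \<sigma> - (?A / \<sigma>\<^sup>2) / 2
        = - (L (X t \<omega>) - L (X s \<omega>)) / \<sigma>\<^sup>2 + integral {s..t} (\<lambda>r. V (X r \<omega>)) / 2"
      unfolding integral_V[OF \<omega> st(1)] using \<sigma> by (simp add: field_simps power2_eq_square)
    ultimately have R: "(\<lambda>n. R n \<omega>) \<longlonglongrightarrow> - (L (X t \<omega>) - L (X s \<omega>)) / \<sigma>\<^sup>2 + integral {s..t} (\<lambda>r. V (X r \<omega>)) / 2"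
      by simp
    have "integral {0..s} (\<lambda>r. V (X r \<omega>)) + integral {s..t} (\<lambda>r. V (X r \<omega>)) = integral {0..t} (\<lambda>r. V (X r \<omega>))"
      using st by (intro Henstock_Kurzweil_Integration.integral_combine integrable_continuous_interval comp_X_cont V_cont \<omega>) auto
    then have split: "dens lam \<sigma> X I s \<omega> * exp (- (L (X t \<omega>) - L (X s \<omega>)) / \<sigma>\<^sup>2 + integral {s..t} (\<lambda>r. V (X r \<omega>)) / 2)
        = dens lam \<sigma> X I t \<omega>"
      unfolding elim(3,4) exp_add[symmetric]
      by (intro arg_cong[where f=exp]) (simp add: diff_divide_distrib add_divide_distrib)
    have "(\<lambda>n. ennreal (dens lam \<sigma> X I s \<omega> * exp (R n \<omega>)) * indicator A \<omega>)
        \<longlonglongrightarrow> ennreal (dens lam \<sigma> X I t \<omega>) * indicator A \<omega>"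
      unfolding split[symmetric]
      by (intro tendsto_mult_ennreal tendsto_ennrealI tendsto_mult tendsto_exp R tendsto_const) (auto simp: indicator_def)
    moreover have "ennreal (dens lam \<sigma> X I s \<omega> * exp (R n \<omega>)) * indicator A \<omega> = H \<omega> * ennreal (exp (R n \<omega>))" for n
      by (simp add: H_def ennreal_mult dens_def mult_ac)
    ultimately show ?case by simp
  qed
  then have "AE \<omega> in M. ennreal (dens lam \<sigma> X I t \<omega>) * indicator A \<omega> = liminf (\<lambda>n. H \<omega> * ennreal (exp (R n \<omega>)))"
    by eventually_elim (simp add: lim_imp_Liminf)
  then have "(\<integral>\<^sup>+\<omega>\<in>A. ennreal (dens lam \<sigma> X I t \<omega>) \<partial>M) = (\<integral>\<^sup>+\<omega>. liminf (\<lambda>n. H \<omega> * ennreal (exp (R n \<omega>))) \<partial>M)"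
    by (rule nn_integral_cong_AE)
  also have "\<dots> \<le> liminf (\<lambda>n. \<integral>\<^sup>+\<omega>. H \<omega> * ennreal (exp (R n \<omega>)) \<partial>M)"
    by (intro nn_integral_liminf) measurable
  also have "\<dots> = (\<integral>\<^sup>+\<omega>. H \<omega> \<partial>M)"
    unfolding ER by (simp add: Liminf_const)
  also have "\<dots> = (\<integral>\<^sup>+\<omega>\<in>A. ennreal (dens lam \<sigma> X I s \<omega>) \<partial>M)"
    by (simp only: H_def)
  finally show ?thesis .
qed

end

section \<open>The Euler scheme and the change of measure\<close>

primrec evolve :: "('s \<Rightarrow> real \<Rightarrow> 's) \<Rightarrow> 's \<Rightarrow> (nat \<Rightarrow> real) \<Rightarrow> (real \<Rightarrow> real) \<Rightarrow> nat \<Rightarrow> 's" where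
  "evolve \<phi> s0 p w 0 = s0"
| "evolve \<phi> s0 p w (Suc i) = \<phi> (evolve \<phi> s0 p w i) (w (p (Suc i)) - w (p i))"

context brownian
begin

lemma evolve_measurable:
  assumes s0: "s0 \<in> space S" and \<phi>: "case_prod \<phi> \<in> measurable (S \<Otimes>\<^sub>M borel) S"
    and p0: "0 \<le> p 0" and p: "\<forall>i<N. p i < p (Suc i)" and iN: "i \<le> N"
  shows "(\<lambda>\<omega>. evolve \<phi> s0 p (\<lambda>t. W t \<omega>) i) \<in> measurable (F (p i)) S"
  using iN
proof (induction i)
  case 0
  then show ?case using s0 by simp
next
  case (Suc i)
  have lt: "p i < p (Suc i)" and ge: "0 \<le> p i"
    using p Suc.prems strict_chain_le[OF p, of 0 i] p0 by auto
  have [measurable]: "(\<lambda>\<omega>. evolve \<phi> s0 p (\<lambda>t. W t \<omega>) i) \<in> measurable (F (p (Suc i))) S"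
    using Suc lt by (intro measurable_F_mono[OF Suc.IH]) auto
  have [measurable]: "W (p i) \<in> borel_measurable (F (p (Suc i)))" "W (p (Suc i)) \<in> borel_measurable (F (p (Suc i)))"
    using ge lt by (auto intro: W_measurable')
  have "(\<lambda>\<omega>. case_prod \<phi> (evolve \<phi> s0 p (\<lambda>t. W t \<omega>) i, W (p (Suc i)) \<omega> - W (p i) \<omega>)) \<in> measurable (F (p (Suc i))) S"
    by (rule measurable_compose[OF _ \<phi>]) measurable
  then show ?case by simp
qed

lemma nn_integral_evolve_change:
  assumes s0: "s0 \<in> space S"
    and \<phi>: "case_prod \<phi> \<in> measurable (S \<Otimes>\<^sub>M borel) S" and \<psi>: "case_prod \<psi> \<in> measurable (S \<Otimes>\<^sub>M borel) S"
    and e: "case_prod e \<in> borel_measurable (S \<Otimes>\<^sub>M borel)"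
    and p0: "0 \<le> p 0" and h: "h > 0" and p: "\<forall>i<N. p (Suc i) - p i = h"
    and kernel: "\<And>f s. f \<in> borel_measurable S \<Longrightarrow> s \<in> space S \<Longrightarrow>
      (\<integral>\<^sup>+z. f (\<phi> s z) \<partial>gauss h) = (\<integral>\<^sup>+z. f (\<psi> s z) * e s z \<partial>gauss h)"
    and f: "f \<in> borel_measurable S"
  shows "(\<integral>\<^sup>+\<omega>. f (evolve \<phi> s0 p (\<lambda>t. W t \<omega>) N) \<partial>M)
    = (\<integral>\<^sup>+\<omega>. f (evolve \<psi> s0 p (\<lambda>t. W t \<omega>) N)
        * (\<Prod>i<N. e (evolve \<psi> s0 p (\<lambda>t. W t \<omega>) i) (W (p (Suc i)) \<omega> - W (p i) \<omega>)) \<partial>M)"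
  using p f
proof (induction N arbitrary: f)
  case (Suc N)
  note [measurable] = \<phi> \<psi> e Suc.prems(2)
  interpret g: prob_space "gauss h" by (rule prob_space_gauss[OF h])
  have hN: "p (Suc N) - p N = h" using Suc.prems(1) by simp
  have chain: "\<forall>i<Suc N. p i < p (Suc i)" using Suc.prems(1) h by (metis diff_gt_0_iff_gt)
  have lt: "p N < p (Suc N)" and ge: "0 \<le> p N"
    using chain strict_chain_le[OF chain, of 0 N] p0 by auto
  define A where "A \<omega> = evolve \<phi> s0 p (\<lambda>t. W t \<omega>) N" for \<omega>
  define B where "B i \<omega> = evolve \<psi> s0 p (\<lambda>t. W t \<omega>) i" for i \<omega>
  define D where "D \<omega> = (\<Prod>i<N. e (B i \<omega>) (W (p (Suc i)) \<omega> - W (p i) \<omega>))" for \<omega>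
  have A: "A \<in> measurable (F (p N)) S"
    unfolding A_def[abs_def] by (rule evolve_measurable[OF s0 \<phi> p0 chain]) simp
  have Bi: "B i \<in> measurable (F (p i)) S" if "i \<le> N" for i
    unfolding B_def[abs_def] by (rule evolve_measurable[OF s0 \<psi> p0 chain]) (use that in simp)
  have D: "D \<in> borel_measurable (F (p N))"
    unfolding D_def[abs_def]
  proof (rule borel_measurable_prod_ennreal)
    fix i assume i: "i \<in> {..<N}"
    have pi: "p i \<le> p N" "p (Suc i) \<le> p N" "0 \<le> p i" "0 \<le> p (Suc i)"
      using i strict_chain_le[OF chain, of i N] strict_chain_le[OF chain, of "Suc i" N]
        strict_chain_le[OF chain, of 0 i] strict_chain_le[OF chain, of 0 "Suc i"] p0 by auto
    have [measurable]: "B i \<in> measurable (F (p N)) S"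
      using i pi by (intro measurable_F_mono[OF Bi]) auto
    have [measurable]: "W (p i) \<in> borel_measurable (F (p N))" "W (p (Suc i)) \<in> borel_measurable (F (p N))"
      using pi by (auto intro: W_measurable')
    have "(\<lambda>\<omega>. case_prod e (B i \<omega>, W (p (Suc i)) \<omega> - W (p i) \<omega>)) \<in> borel_measurable (F (p N))"
      by (rule measurable_compose[OF _ e]) measurable
    then show "(\<lambda>\<omega>. e (B i \<omega>) (W (p (Suc i)) \<omega> - W (p i) \<omega>)) \<in> borel_measurable (F (p N))" by simp
  qed
  let ?k = "\<lambda>q. f (case_prod \<psi> (fst (fst q), snd q)) * case_prod e (fst (fst q), snd q) * snd (fst q)"
  define P where "P s = (\<integral>\<^sup>+z. f (\<phi> s z) \<partial>gauss h)" for s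
  have Pm: "P \<in> borel_measurable S"
    unfolding P_def[abs_def] by measurable
  have "(\<integral>\<^sup>+\<omega>. f (evolve \<phi> s0 p (\<lambda>t. W t \<omega>) (Suc N)) \<partial>M)
      = (\<integral>\<^sup>+\<omega>. (\<lambda>q. f (case_prod \<phi> q)) (A \<omega>, W (p (Suc N)) \<omega> - W (p N) \<omega>) \<partial>M)"
    by (simp add: A_def)
  also have "\<dots> = (\<integral>\<^sup>+\<omega>. (\<integral>\<^sup>+z. (\<lambda>q. f (case_prod \<phi> q)) (A \<omega>, z) \<partial>gauss (p (Suc N) - p N)) \<partial>M)"
    by (rule nn_integral_increment[OF ge lt A]) measurable
  also have "\<dots> = (\<integral>\<^sup>+\<omega>. P (A \<omega>) \<partial>M)"
    by (simp add: hN P_def)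
  also have "\<dots> = (\<integral>\<^sup>+\<omega>. P (B N \<omega>) * D \<omega> \<partial>M)"
    unfolding A_def B_def D_def using Suc.prems(1) by (intro Suc.IH Pm) auto
  also have "\<dots> = (\<integral>\<^sup>+\<omega>. (\<integral>\<^sup>+z. ?k
        ((B N \<omega>, D \<omega>), z) \<partial>gauss (p (Suc N) - p N)) \<partial>M)"
  proof (intro nn_integral_cong)
    fix \<omega> assume \<omega>: "\<omega> \<in> space M"
    have BN: "B N \<omega> \<in> space S"
      using measurable_space[OF Bi[OF order_refl]] \<omega> space_F by simp
    note [measurable] = measurable_Pair1'[OF BN]
    have m1: "(\<lambda>z. case_prod \<psi> (B N \<omega>, z)) \<in> measurable borel S"
      by (rule measurable_compose[OF _ \<psi>]) (use BN in measurable)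
    have m2: "(\<lambda>z. case_prod e (B N \<omega>, z)) \<in> borel_measurable borel"
      by (rule measurable_compose[OF _ e]) (use BN in measurable)
    have "(\<lambda>z. f (\<psi> (B N \<omega>) z)) \<in> borel_measurable borel" "(\<lambda>z. e (B N \<omega>) z) \<in> borel_measurable borel"
      using measurable_compose[OF m1 Suc.prems(2)] m2 by (simp_all only: prod.case)
    moreover have "borel_measurable (gauss h) = (borel_measurable borel :: (real \<Rightarrow> ennreal) set)"
      by (rule measurable_cong_sets) simp_all
    ultimately have "(\<lambda>z. f (\<psi> (B N \<omega>) z) * e (B N \<omega>) z) \<in> borel_measurable (gauss h)"
      by (simp only: borel_measurable_times_ennreal)
    then show "P (B N \<omega>) * D \<omega> = (\<integral>\<^sup>+z. ?k
        ((B N \<omega>, D \<omega>), z) \<partial>gauss (p (Suc N) - p N))"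
      unfolding P_def kernel[OF Suc.prems(2) BN] hN by (simp only: nn_integral_multc prod.case fst_conv snd_conv)
  qed
  also have "\<dots> = (\<integral>\<^sup>+\<omega>. ?k
        ((B N \<omega>, D \<omega>), W (p (Suc N)) \<omega> - W (p N) \<omega>) \<partial>M)"
  proof (rule nn_integral_increment[OF ge lt, where N="S \<Otimes>\<^sub>M borel", symmetric])
    show "(\<lambda>\<omega>. (B N \<omega>, D \<omega>)) \<in> measurable (F (p N)) (S \<Otimes>\<^sub>M borel)"
      using Bi[OF order_refl] D by measurable
  qed measurable
  also have "\<dots> = (\<integral>\<^sup>+\<omega>. f (evolve \<psi> s0 p (\<lambda>t. W t \<omega>) (Suc N))
        * (\<Prod>i<Suc N. e (evolve \<psi> s0 p (\<lambda>t. W t \<omega>) i) (W (p (Suc i)) \<omega> - W (p i) \<omega>)) \<partial>M)"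
    by (intro nn_integral_cong) (simp add: B_def D_def mult_ac)
  finally show ?case .
qed simp

end

context sde
begin

definition euler_step :: "real \<Rightarrow> real \<times> real \<Rightarrow> real \<Rightarrow> real \<times> real" where
  "euler_step h s z = (fst s + lam (fst s) * h + \<sigma> * z, snd s + V (fst s) * h)"

definition free_step :: "real \<Rightarrow> real \<times> real \<Rightarrow> real \<Rightarrow> real \<times> real" where
  "free_step h s z = (fst s + \<sigma> * z, snd s + V (fst s) * h)"

definition step_weight :: "real \<Rightarrow> real \<times> real \<Rightarrow> real \<Rightarrow> ennreal" where
  "step_weight h s z = ennreal (exp (lam (fst s) / \<sigma> * z - (lam (fst s) / \<sigma>)\<^sup>2 * h / 2))"

lemma lam_borel [measurable]: "lam \<in> borel_measurable borel"
  by (intro borel_measurable_continuous_onI lam_cont)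

lemma L_borel [measurable]: "L \<in> borel_measurable borel"
  by (intro borel_measurable_continuous_onI L_cont)

lemma V_borel [measurable]: "V \<in> borel_measurable borel"
  by (intro borel_measurable_continuous_onI V_cont)

lemma nn_integral_euler_scheme:
  assumes h: "h > 0" and p0: "0 \<le> p 0" and p: "\<forall>i<N. p (Suc i) - p i = h"
    and f: "f \<in> borel_measurable (borel \<Otimes>\<^sub>M borel)"
  shows "(\<integral>\<^sup>+\<omega>. f (evolve (euler_step h) (x, 0) p (\<lambda>t. W t \<omega>) N) \<partial>M)
    = (\<integral>\<^sup>+\<omega>. f (evolve (free_step h) (x, 0) p (\<lambda>t. W t \<omega>) N)
        * (\<Prod>i<N. step_weight h (evolve (free_step h) (x, 0) p (\<lambda>t. W t \<omega>) i) (W (p (Suc i)) \<omega> - W (p i) \<omega>)) \<partial>M)"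
proof (rule nn_integral_evolve_change[where S="borel \<Otimes>\<^sub>M borel", OF _ _ _ _ p0 h p _ f])
  fix f :: "real \<times> real \<Rightarrow> ennreal" and s :: "real \<times> real"
  assume f [measurable]: "f \<in> borel_measurable (borel \<Otimes>\<^sub>M borel)"
  have "(\<integral>\<^sup>+z. f (fst s + \<sigma> * (z + lam (fst s) / \<sigma> * h), snd s + V (fst s) * h) \<partial>gauss h)
      = (\<integral>\<^sup>+z. f (fst s + \<sigma> * z, snd s + V (fst s) * h)
          * ennreal (exp (lam (fst s) / \<sigma> * z - (lam (fst s) / \<sigma>)\<^sup>2 * h / 2)) \<partial>gauss h)"
    by (rule gauss_shift[OF h, of "\<lambda>z. f (fst s + \<sigma> * z, snd s + V (fst s) * h)"]) measurable
  then show "(\<integral>\<^sup>+z. f (euler_step h s z) \<partial>gauss h) = (\<integral>\<^sup>+z. f (free_step h s z) * step_weight h s z \<partial>gauss h)"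
    using \<sigma> by (simp add: euler_step_def free_step_def step_weight_def distrib_left ac_simps)
qed (simp_all add: euler_step_def[abs_def] free_step_def[abs_def] step_weight_def[abs_def] space_pair_measure case_prod_unfold)

lemma evolve_euler_fst:
  "fst (evolve (euler_step h) (x, 0) p w (Suc i))
    = fst (evolve (euler_step h) (x, 0) p w i) + lam (fst (evolve (euler_step h) (x, 0) p w i)) * h
      + \<sigma> * (w (p (Suc i)) - w (p i))"
  by (simp add: euler_step_def)

lemma evolve_euler_snd:
  "snd (evolve (euler_step h) (x, 0) p w N) = (\<Sum>i<N. V (fst (evolve (euler_step h) (x, 0) p w i)) * h)"
  by (induction N) (simp_all add: euler_step_def)

lemma evolve_free_fst: "fst (evolve (free_step h) (x, 0) p w i) = x + \<sigma> * (w (p i) - w (p 0))"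
  by (induction i) (simp_all add: free_step_def algebra_simps)

lemma evolve_free_snd:
  "snd (evolve (free_step h) (x, 0) p w N) = (\<Sum>i<N. V (x + \<sigma> * (w (p i) - w (p 0))) * h)"
proof (induction N)
  case (Suc N)
  have "snd (evolve (free_step h) (x, 0) p w (Suc N))
      = snd (evolve (free_step h) (x, 0) p w N) + V (fst (evolve (free_step h) (x, 0) p w N)) * h"
    by (simp only: evolve.simps free_step_def snd_conv)
  then show ?case unfolding Suc.IH evolve_free_fst by simp
qed simp

text \<open>
  The law of \<open>X\<close> on paths over \<open>[0, T]\<close> has density \<open>exp (- log_weight T)\<close> with respect to the law
  of \<open>Y\<close>, and \<open>log_weight T\<close> is the logarithm of \<open>Z\<close> read off along \<open>Y\<close> instead of \<open>X\<close>.
\<close>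

definition Y :: "real \<Rightarrow> 'a \<Rightarrow> real" where
  "Y t \<omega> = x + \<sigma> * (W t \<omega> - W 0 \<omega>)"

definition log_weight :: "real \<Rightarrow> 'a \<Rightarrow> real" where
  "log_weight T \<omega> = - (L (Y T \<omega>) - L x) / \<sigma>\<^sup>2 + integral {0..T} (\<lambda>r. V (Y r \<omega>)) / 2"

lemma Y_cont: "\<omega> \<in> space M \<Longrightarrow> continuous_on {0..T} (\<lambda>t. Y t \<omega>)"
  unfolding Y_def by (intro continuous_intros continuous_on_subset[OF W_continuous]) auto

lemma AE_free_limit:
  assumes T: "0 < T"
  shows "AE \<omega> in M. (\<lambda>n. snd (evolve (free_step (T / 2 ^ n)) (x, 0) (dpt 0 T n) (\<lambda>t. W t \<omega>) (2 ^ n)))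
        \<longlonglongrightarrow> integral {0..T} (\<lambda>r. V (Y r \<omega>)) \<and>
      (\<lambda>n. \<Prod>i<2 ^ n. step_weight (T / 2 ^ n) (evolve (free_step (T / 2 ^ n)) (x, 0) (dpt 0 T n) (\<lambda>t. W t \<omega>) i)
          (W (dpt 0 T n (Suc i)) \<omega> - W (dpt 0 T n i) \<omega>)) \<longlonglongrightarrow> ennreal (exp (- log_weight T \<omega>))"
  using AE_has_qv[OF order_refl T] AE_space
proof eventually_elim
  case (elim \<omega>)
  have T': "0 \<le> T" using T by simp
  let ?ev = "\<lambda>n i. evolve (free_step (T / 2 ^ n)) (x, 0) (dpt 0 T n) (\<lambda>t. W t \<omega>) i"
  let ?dW = "\<lambda>n i. W (dpt 0 T n (Suc i)) \<omega> - W (dpt 0 T n i) \<omega>"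
  let ?dY = "\<lambda>n i. Y (dpt 0 T n (Suc i)) \<omega> - Y (dpt 0 T n i) \<omega>"
  note Yc = Y_cont[OF elim(2), of T]
  have w: "continuous_on {0..T} (\<lambda>t. W t \<omega>)"
    by (rule continuous_on_subset[OF W_continuous[OF elim(2)]]) auto
  have "0-lipschitz_on {0..T} (\<lambda>t. x - \<sigma> * W 0 \<omega>)"
    by (rule lipschitz_onI) auto
  then have qv: "has_qv 0 T (\<lambda>t. Y t \<omega>) (\<sigma>\<^sup>2 * 1)"
    by (rule has_qv_add_lipschitz[OF T' w elim(1)]) (simp add: Y_def algebra_simps)
  have VY: "continuous_on {0..T} (\<lambda>r. V (Y r \<omega>))"
    by (rule continuous_on_compose2[OF V_cont Yc]) auto
  have lY: "continuous_on {0..T} (\<lambda>r. lam (Y r \<omega>))"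
    by (rule continuous_on_compose2[OF lam_cont[of UNIV] Yc]) auto
  have l'Y: "continuous_on {0..T} (\<lambda>r. lam' (Y r \<omega>))"
    by (rule continuous_on_compose2[OF lam' Yc]) auto
  have pos: "fst (?ev n i) = Y (dpt 0 T n i) \<omega>" for n i
    unfolding evolve_free_fst Y_def by simp
  have "(\<lambda>n. \<Sum>i<2 ^ n. V (Y (dpt 0 T n i) \<omega>) * (T / 2 ^ n)) \<longlonglongrightarrow> integral {0..T} (\<lambda>r. V (Y r \<omega>))"
    using riemann_sum_tendsto[OF T' VY] by simp
  then have 1: "(\<lambda>n. snd (?ev n (2 ^ n)))
        \<longlonglongrightarrow> integral {0..T} (\<lambda>r. V (Y r \<omega>))"
    unfolding evolve_free_snd Y_def by simp
  let ?S = "\<lambda>n. \<Sum>i<2 ^ n. lam (Y (dpt 0 T n i) \<omega>) * (?dY n i)"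
  let ?Q = "\<lambda>n. \<Sum>i<2 ^ n. (lam (Y (dpt 0 T n i) \<omega>))\<^sup>2 * (T / 2 ^ n)"
  let ?A = "integral {0..T} (\<lambda>r. (lam (Y r \<omega>))\<^sup>2)" and ?B = "integral {0..T} (\<lambda>r. lam' (Y r \<omega>))"
  have S: "?S \<longlonglongrightarrow> L (Y T \<omega>) - L (Y 0 \<omega>) - \<sigma>\<^sup>2 * 1 / 2 * ?B"
    by (rule foellmer_ito[OF T' Yc qv L lam lam'])
  have Q: "?Q \<longlonglongrightarrow> ?A"
    using riemann_sum_tendsto[OF T' continuous_on_power[OF lY], of 2] by simp
  have "integral {0..T} (\<lambda>r. V (Y r \<omega>)) = integral {0..T} (\<lambda>r. (lam (Y r \<omega>))\<^sup>2 / \<sigma>\<^sup>2) + ?B"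
    unfolding V_def
    by (intro Henstock_Kurzweil_Integration.integral_add integrable_continuous_interval continuous_on_divide
        continuous_on_power lY l'Y continuous_on_const) (use \<sigma> in auto)
  then have VAB: "integral {0..T} (\<lambda>r. V (Y r \<omega>)) = ?A / \<sigma>\<^sup>2 + ?B" by simp
  have "(\<lambda>n. ?S n / \<sigma>\<^sup>2 - ?Q n / \<sigma>\<^sup>2 / 2) \<longlonglongrightarrow> (L (Y T \<omega>) - L (Y 0 \<omega>) - \<sigma>\<^sup>2 * 1 / 2 * ?B) / \<sigma>\<^sup>2 - ?A / \<sigma>\<^sup>2 / 2"
    using \<sigma> by (intro tendsto_intros S Q) auto
  also have "(L (Y T \<omega>) - L (Y 0 \<omega>) - \<sigma>\<^sup>2 * 1 / 2 * ?B) / \<sigma>\<^sup>2 - ?A / \<sigma>\<^sup>2 / 2 = - log_weight T \<omega>"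
    unfolding log_weight_def VAB using \<sigma> by (simp add: Y_def field_simps)
  finally have "(\<lambda>n. ennreal (exp (?S n / \<sigma>\<^sup>2 - ?Q n / \<sigma>\<^sup>2 / 2))) \<longlonglongrightarrow> ennreal (exp (- log_weight T \<omega>))"
    by (intro tendsto_ennrealI tendsto_exp)
  moreover have "(\<Prod>i<2 ^ n. step_weight (T / 2 ^ n) (?ev n i)
          (?dW n i)) = ennreal (exp (?S n / \<sigma>\<^sup>2 - ?Q n / \<sigma>\<^sup>2 / 2))" for n
  proof -
    have "(\<Prod>i<2 ^ n. step_weight (T / 2 ^ n) (?ev n i)
          (?dW n i))
        = (\<Prod>i<2 ^ n. ennreal (exp (lam (Y (dpt 0 T n i) \<omega>) * (?dY n i) / \<sigma>\<^sup>2
            - (lam (Y (dpt 0 T n i) \<omega>))\<^sup>2 * (T / 2 ^ n) / \<sigma>\<^sup>2 / 2)))"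
    proof (intro prod.cong refl)
      fix i
      have "Y (dpt 0 T n (Suc i)) \<omega> - Y (dpt 0 T n i) \<omega> = \<sigma> * (?dW n i)"
        by (simp add: Y_def algebra_simps)
      then have "lam (Y (dpt 0 T n i) \<omega>) / \<sigma> * (?dW n i)
          = lam (Y (dpt 0 T n i) \<omega>) * (?dY n i) / \<sigma>\<^sup>2"
        using \<sigma> by (simp add: power2_eq_square)
      then show "step_weight (T / 2 ^ n) (?ev n i)
          (?dW n i)
        = ennreal (exp (lam (Y (dpt 0 T n i) \<omega>) * (?dY n i) / \<sigma>\<^sup>2
            - (lam (Y (dpt 0 T n i) \<omega>))\<^sup>2 * (T / 2 ^ n) / \<sigma>\<^sup>2 / 2))"
        unfolding step_weight_def pos by (simp add: power_divide)
    qed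
    also have "\<dots> = ennreal (exp (?S n / \<sigma>\<^sup>2 - ?Q n / \<sigma>\<^sup>2 / 2))"
      by (simp add: prod_ennreal exp_sum[symmetric] sum_subtractf sum_divide_distrib)
    finally show ?thesis .
  qed
  ultimately show ?case using 1 by simp
qed

lemma W_borel: "0 \<le> t \<Longrightarrow> (\<lambda>\<omega>. W t \<omega>) \<in> borel_measurable M"
  using W_measurable_M by simp

lemma Y_borel: "0 \<le> t \<Longrightarrow> Y t \<in> borel_measurable M"
  unfolding Y_def[abs_def] by (intro borel_measurable_add borel_measurable_times borel_measurable_diff W_borel) auto

lemma log_weight_borel:
  assumes T: "0 < T"
  shows "log_weight T \<in> borel_measurable M"
proof -
  have T': "0 \<le> T" using T by simp
  have "(\<lambda>\<omega>. integral {0..T} (\<lambda>r. V (Y r \<omega>))) \<in> borel_measurable M"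
  proof (rule borel_measurable_LIMSEQ_real)
    fix \<omega> assume "\<omega> \<in> space M"
    then have "continuous_on {0..T} (\<lambda>r. V (Y r \<omega>))"
      by (intro continuous_on_compose2[OF V_cont Y_cont]) auto
    from riemann_sum_tendsto[OF T' this]
    show "(\<lambda>n. \<Sum>i<2 ^ n. V (Y (dpt 0 T n i) \<omega>) * ((T - 0) / 2 ^ n)) \<longlonglongrightarrow> integral {0..T} (\<lambda>r. V (Y r \<omega>))" .
  next
    fix n
    have "(\<lambda>\<omega>. V (Y (dpt 0 T n i) \<omega>)) \<in> borel_measurable M" for i
      using Y_borel[OF dpt_ge[OF T']] by measurable
    then show "(\<lambda>\<omega>. \<Sum>i<2 ^ n. V (Y (dpt 0 T n i) \<omega>) * ((T - 0) / 2 ^ n)) \<in> borel_measurable M"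
      by (intro borel_measurable_sum borel_measurable_times) auto
  qed
  moreover have "(\<lambda>\<omega>. L (Y T \<omega>)) \<in> borel_measurable M"
    using Y_borel[OF T'] by measurable
  ultimately show ?thesis
    unfolding log_weight_def[abs_def] by measurable
qed

lemma AE_euler_limit:
  assumes T: "0 < T"
  shows "AE \<omega> in M. (\<lambda>n. fst (evolve (euler_step (T / 2 ^ n)) (x, 0) (dpt 0 T n) (\<lambda>t. W t \<omega>) (2 ^ n))) \<longlonglongrightarrow> X T \<omega> \<and>
    (\<lambda>n. snd (evolve (euler_step (T / 2 ^ n)) (x, 0) (dpt 0 T n) (\<lambda>t. W t \<omega>) (2 ^ n))) \<longlonglongrightarrow> integral {0..T} (\<lambda>r. V (X r \<omega>))"
  using AE_good
proof eventually_elim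
  case (elim \<omega>)
  then have \<omega>: "\<omega> \<in> space M" and X0: "X 0 \<omega> = x"
    and incr: "\<And>s t. 0 \<le> s \<Longrightarrow> s \<le> t \<Longrightarrow> t \<le> T \<Longrightarrow>
     X t \<omega> - X s \<omega> = integral {s..t} (\<lambda>r. lam (X r \<omega>)) + \<sigma> * (W t \<omega> - W s \<omega>)"
    by (auto simp: good_def)
  have T': "0 \<le> T" using T by simp
  define E where "E n i = fst (evolve (euler_step (T / 2 ^ n)) (x, 0) (dpt 0 T n) (\<lambda>t. W t \<omega>) i)" for n i
  have conv: "\<forall>\<^sub>F n in sequentially. \<forall>i\<le>2 ^ n. \<bar>E n i - X (dpt 0 T n i) \<omega>\<bar> < \<epsilon>" if "\<epsilon> > 0" for \<epsilon>
  proof (rule euler_scheme_converges[OF T' lam lam' X_cont[OF \<omega> order_refl] _ _ _ that])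
    show "\<And>s t. 0 \<le> s \<Longrightarrow> s \<le> t \<Longrightarrow> t \<le> T \<Longrightarrow>
     X t \<omega> - X s \<omega> = integral {s..t} (\<lambda>r. lam (X r \<omega>)) + \<sigma> * (W t \<omega> - W s \<omega>)" by (rule incr)
    show "E n 0 = X 0 \<omega>" for n by (simp add: E_def X0)
    show "E n (Suc i) = E n i + lam (E n i) * (T / 2 ^ n) + \<sigma> * (W (dpt 0 T n (Suc i)) \<omega> - W (dpt 0 T n i) \<omega>)" for n i
      unfolding E_def by (rule evolve_euler_fst)
  qed
  have "(\<lambda>n. E n (2 ^ n)) \<longlonglongrightarrow> X T \<omega>"
  proof (rule tendstoI)
    fix \<epsilon> :: real assume "\<epsilon> > 0"
    from conv[OF this] show "\<forall>\<^sub>F n in sequentially. dist (E n (2 ^ n)) (X T \<omega>) < \<epsilon>"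
    proof eventually_elim
      case (elim n)
      from elim[rule_format, of "2 ^ n"] show ?case by (simp add: dist_real_def)
    qed
  qed
  moreover have "(\<lambda>n. \<Sum>i<2 ^ n. V (E n i) * (T / 2 ^ n)) \<longlonglongrightarrow> integral {0..T} (\<lambda>r. V (X r \<omega>))"
    by (rule euler_riemann_sum_tendsto[OF T' X_cont[OF \<omega> order_refl] V_cont conv])
  ultimately show ?case
    unfolding evolve_euler_snd E_def by simp
qed

lemma dyadic_steps:
  assumes "0 < T"
  shows "\<forall>i<N. dpt 0 T n (Suc i) - dpt 0 T n i = T / 2 ^ n" "\<forall>i<N. dpt 0 T n i < dpt 0 T n (Suc i)"
  using assms by (auto simp: dpt_Suc)

lemma evolve_borel:
  assumes T: "0 < T" and \<phi>: "case_prod \<phi> \<in> measurable ((borel \<Otimes>\<^sub>M borel) \<Otimes>\<^sub>M borel) (borel \<Otimes>\<^sub>M borel)"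
  shows "(\<lambda>\<omega>. evolve \<phi> (x, 0::real) (dpt 0 T n) (\<lambda>t. W t \<omega>) i) \<in> measurable M (borel \<Otimes>\<^sub>M borel)"
  by (rule measurable_F_M[OF evolve_measurable[OF _ \<phi> _ dyadic_steps(2)[OF T] order_refl]])
    (simp_all add: space_pair_measure)

text \<open>
  The Euler scheme carries the change of measure to the limit. On the side of \<open>Y\<close> it is Fatou's
  lemma, on the side of \<open>X\<close> dominated convergence, so no uniform integrability is needed.
\<close>

lemma truncated_moment_lower_bound:
  assumes T: "0 < T" and ito: "ito_integral M F W (\<lambda>r \<omega>. eta lam \<sigma> (X r \<omega>)) T (I T)" and \<kappa>: "\<kappa> > 0"
  shows "(\<integral>\<^sup>+\<omega>. ennreal (min \<kappa> (exp (m * log_weight T \<omega>))) * ennreal (exp (- log_weight T \<omega>)) \<partial>M)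
    \<le> (\<integral>\<^sup>+\<omega>. ennreal (dens lam \<sigma> X I T \<omega> powr m) \<partial>M)"
proof -
  have T': "0 \<le> T" using T by simp
  define g where "g s = min \<kappa> (exp (m * (- (L (fst s) - L x) / \<sigma>\<^sup>2 + snd s / 2)))" for s :: "real \<times> real"
  have g_meas [measurable]: "g \<in> borel_measurable (borel \<Otimes>\<^sub>M borel)"
    unfolding g_def[abs_def] by measurable
  have g_tendsto: "(\<lambda>n. g (s n)) \<longlonglongrightarrow> min \<kappa> (exp (m * (- (L y - L x) / \<sigma>\<^sup>2 + v / 2)))"
    if "(\<lambda>n. fst (s n)) \<longlonglongrightarrow> y" "(\<lambda>n. snd (s n)) \<longlonglongrightarrow> v" for s y v
  proof -
    have "(\<lambda>n. L (fst (s n))) \<longlonglongrightarrow> L y"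
      using L_cont[of UNIV] that(1) by (intro continuous_on_tendsto_compose[of UNIV L]) auto
    then show ?thesis
      unfolding g_def using that(2) \<sigma> by (intro tendsto_intros) auto
  qed
  define \<Phi> where "\<Phi> n \<omega> = evolve (euler_step (T / 2 ^ n)) (x, 0) (dpt 0 T n) (\<lambda>t. W t \<omega>) (2 ^ n)" for n \<omega>
  define \<Psi> where "\<Psi> n i \<omega> = evolve (free_step (T / 2 ^ n)) (x, 0) (dpt 0 T n) (\<lambda>t. W t \<omega>) i" for n i \<omega>
  define D where "D n \<omega> = (\<Prod>i<2 ^ n. step_weight (T / 2 ^ n) (\<Psi> n i \<omega>) (W (dpt 0 T n (Suc i)) \<omega> - W (dpt 0 T n i) \<omega>))" for n \<omega>
  have [measurable]: "\<Phi> n \<in> measurable M (borel \<Otimes>\<^sub>M borel)" for n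
    unfolding \<Phi>_def[abs_def] by (rule evolve_borel[OF T]) (simp add: euler_step_def[abs_def] case_prod_unfold)
  have \<Psi> [measurable]: "\<Psi> n i \<in> measurable M (borel \<Otimes>\<^sub>M borel)" for n i
    unfolding \<Psi>_def[abs_def] by (rule evolve_borel[OF T]) (simp add: free_step_def[abs_def] case_prod_unfold)
  have [measurable]: "D n \<in> borel_measurable M" for n
    unfolding D_def[abs_def]
  proof (rule borel_measurable_prod_ennreal)
    fix i
    have [measurable]: "(\<lambda>\<omega>. W (dpt 0 T n (Suc i)) \<omega> - W (dpt 0 T n i) \<omega>) \<in> borel_measurable M"
      by (intro borel_measurable_diff W_borel dpt_ge T')
    show "(\<lambda>\<omega>. step_weight (T / 2 ^ n) (\<Psi> n i \<omega>) (W (dpt 0 T n (Suc i)) \<omega> - W (dpt 0 T n i) \<omega>)) \<in> borel_measurable M"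
      unfolding step_weight_def by measurable
  qed
  have change: "(\<integral>\<^sup>+\<omega>. ennreal (g (\<Phi> n \<omega>)) \<partial>M) = (\<integral>\<^sup>+\<omega>. ennreal (g (\<Psi> n (2 ^ n) \<omega>)) * D n \<omega> \<partial>M)" for n
    unfolding \<Phi>_def \<Psi>_def D_def
    by (rule nn_integral_euler_scheme[where f="\<lambda>s. ennreal (g s)"]) (use T dyadic_steps(1)[OF T] in auto)
  have densm [measurable]: "dens lam \<sigma> X I T \<in> borel_measurable M"
    by (rule measurable_F_M[OF dens_measurable[of T I, OF ito]])
  have X_side: "(\<lambda>n. \<integral>\<^sup>+\<omega>. ennreal (g (\<Phi> n \<omega>)) \<partial>M) \<longlonglongrightarrow> (\<integral>\<^sup>+\<omega>. ennreal (min \<kappa> (dens lam \<sigma> X I T \<omega> powr m)) \<partial>M)"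
  proof (rule nn_integral_dominated_convergence[where w="\<lambda>_. ennreal \<kappa>"])
    show "AE \<omega> in M. (\<lambda>n. ennreal (g (\<Phi> n \<omega>))) \<longlonglongrightarrow> ennreal (min \<kappa> (dens lam \<sigma> X I T \<omega> powr m))"
      using AE_euler_limit[OF T] dens_explicit[where I=I, OF T' ito]
    proof eventually_elim
      case (elim \<omega>)
      have "(\<lambda>n. g (\<Phi> n \<omega>)) \<longlonglongrightarrow> min \<kappa> (exp (m * (- (L (X T \<omega>) - L x) / \<sigma>\<^sup>2 + integral {0..T} (\<lambda>r. V (X r \<omega>)) / 2)))"
        unfolding \<Phi>_def using elim(1) by (intro g_tendsto) auto
      then show ?case
        unfolding elim(2) by (intro tendsto_ennrealI) (simp add: powr_def)
    qed
    show "AE \<omega> in M. ennreal (g (\<Phi> n \<omega>)) \<le> ennreal \<kappa>" for n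
      by (intro AE_I2 ennreal_leI) (simp add: g_def)
  qed (auto simp: emeasure_space_1)
  have "AE \<omega> in M. (\<lambda>n. ennreal (g (\<Psi> n (2 ^ n) \<omega>)) * D n \<omega>)
      \<longlonglongrightarrow> ennreal (min \<kappa> (exp (m * log_weight T \<omega>))) * ennreal (exp (- log_weight T \<omega>))"
    using AE_free_limit[OF T]
  proof eventually_elim
    case (elim \<omega>)
    have "fst (\<Psi> n (2 ^ n) \<omega>) = Y T \<omega>" for n
      unfolding \<Psi>_def evolve_free_fst Y_def by simp
    then have "(\<lambda>n. g (\<Psi> n (2 ^ n) \<omega>)) \<longlonglongrightarrow> min \<kappa> (exp (m * log_weight T \<omega>))"
      unfolding log_weight_def using elim by (intro g_tendsto) (auto simp: \<Psi>_def)
    moreover have "(\<lambda>n. D n \<omega>) \<longlonglongrightarrow> ennreal (exp (- log_weight T \<omega>))"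
      using elim unfolding D_def \<Psi>_def by simp
    ultimately show ?case
      by (intro tendsto_mult_ennreal tendsto_ennrealI) auto
  qed
  then have "AE \<omega> in M. ennreal (min \<kappa> (exp (m * log_weight T \<omega>))) * ennreal (exp (- log_weight T \<omega>))
      = liminf (\<lambda>n. ennreal (g (\<Psi> n (2 ^ n) \<omega>)) * D n \<omega>)"
    by eventually_elim (simp add: lim_imp_Liminf)
  then have "(\<integral>\<^sup>+\<omega>. ennreal (min \<kappa> (exp (m * log_weight T \<omega>))) * ennreal (exp (- log_weight T \<omega>)) \<partial>M)
      = (\<integral>\<^sup>+\<omega>. liminf (\<lambda>n. ennreal (g (\<Psi> n (2 ^ n) \<omega>)) * D n \<omega>) \<partial>M)"
    by (rule nn_integral_cong_AE)
  also have "\<dots> \<le> liminf (\<lambda>n. \<integral>\<^sup>+\<omega>. ennreal (g (\<Psi> n (2 ^ n) \<omega>)) * D n \<omega> \<partial>M)"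
    by (intro nn_integral_liminf) measurable
  also have "\<dots> = (\<integral>\<^sup>+\<omega>. ennreal (min \<kappa> (dens lam \<sigma> X I T \<omega> powr m)) \<partial>M)"
    unfolding change[symmetric] using X_side by (intro lim_imp_Liminf) auto
  also have "\<dots> \<le> (\<integral>\<^sup>+\<omega>. ennreal (dens lam \<sigma> X I T \<omega> powr m) \<partial>M)"
    by (intro nn_integral_mono ennreal_leI) auto
  finally show ?thesis .
qed

lemma moment_lower_bound:
  assumes T: "0 < T" and ito: "ito_integral M F W (\<lambda>r \<omega>. eta lam \<sigma> (X r \<omega>)) T (I T)"
  shows "(\<integral>\<^sup>+\<omega>. ennreal (exp ((m - 1) * log_weight T \<omega>)) \<partial>M)
    \<le> (\<integral>\<^sup>+\<omega>. ennreal (dens lam \<sigma> X I T \<omega> powr m) \<partial>M)"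
proof -
  note [measurable] = log_weight_borel[OF T]
  let ?u = "\<lambda>k \<omega>. ennreal (min (real (Suc k)) (exp (m * log_weight T \<omega>))) * ennreal (exp (- log_weight T \<omega>))"
  have "ennreal (exp ((m - 1) * log_weight T \<omega>)) = liminf (\<lambda>k. ?u k \<omega>)" for \<omega>
  proof -
    have "\<forall>\<^sub>F k in sequentially. exp (m * log_weight T \<omega>) \<le> real k"
      using filterlim_real_sequentially unfolding filterlim_at_top by blast
    then have "\<forall>\<^sub>F k in sequentially. ?u k \<omega> = ennreal (exp ((m - 1) * log_weight T \<omega>))"
    proof eventually_elim
      case (elim k)
      then have "min (real (Suc k)) (exp (m * log_weight T \<omega>)) = exp (m * log_weight T \<omega>)" by simp
      moreover have "exp (m * log_weight T \<omega>) * exp (- log_weight T \<omega>) = exp ((m - 1) * log_weight T \<omega>)"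
        by (simp add: exp_add[symmetric] algebra_simps)
      ultimately show ?case by (simp only: ennreal_mult[symmetric] exp_ge_zero)
    qed
    then have "(\<lambda>k. ?u k \<omega>) \<longlonglongrightarrow> ennreal (exp ((m - 1) * log_weight T \<omega>))"
      by (rule tendsto_eventually)
    then show ?thesis by (intro lim_imp_Liminf[symmetric]) auto
  qed
  then have "(\<integral>\<^sup>+\<omega>. ennreal (exp ((m - 1) * log_weight T \<omega>)) \<partial>M) = (\<integral>\<^sup>+\<omega>. liminf (\<lambda>k. ?u k \<omega>) \<partial>M)"
    by (simp only:)
  also have "\<dots> \<le> liminf (\<lambda>k. \<integral>\<^sup>+\<omega>. ?u k \<omega> \<partial>M)"
    by (intro nn_integral_liminf) measurable
  also have "\<dots> \<le> liminf (\<lambda>k. \<integral>\<^sup>+\<omega>. ennreal (dens lam \<sigma> X I T \<omega> powr m) \<partial>M)"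
    by (intro Liminf_mono always_eventually allI truncated_moment_lower_bound[OF T, of I] ito) simp
  also have "\<dots> = (\<integral>\<^sup>+\<omega>. ennreal (dens lam \<sigma> X I T \<omega> powr m) \<partial>M)"
    by (simp add: Liminf_const)
  finally show ?thesis .
qed

lemma exp_log_weight_infinite:
  assumes T: "0 < T" and c: "c > 0" and V: "\<And>y. V y \<ge> C"
    and quad: "\<And>A. A > 0 \<Longrightarrow> \<exists>B. \<forall>y. - L y \<ge> A * (y - \<theta>)\<^sup>2 + B"
  shows "(\<integral>\<^sup>+\<omega>. ennreal (exp (c * log_weight T \<omega>)) \<partial>M) = \<infinity>"
proof -
  define A where "A = 1 / (c * T)"
  have A: "A > 0" using c T by (simp add: A_def)
  obtain B where B: "\<And>y. - L y \<ge> A * (y - \<theta>)\<^sup>2 + B" using quad[OF A] by blast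
  define d where "d = x - \<theta>"
  define k where "k = c * ((- A * d\<^sup>2 + B + L x) / \<sigma>\<^sup>2 + C * T / 2)"
  have bound: "(W T \<omega> - W 0 \<omega>)\<^sup>2 / (2 * T) + k \<le> c * log_weight T \<omega>" if \<omega>: "\<omega> \<in> space M" for \<omega>
  proof -
    define z where "z = W T \<omega> - W 0 \<omega>"
    have "\<sigma>\<^sup>2 * z\<^sup>2 / 2 - d\<^sup>2 \<le> (d + \<sigma> * z)\<^sup>2"
      using zero_le_power2[of "2 * d + \<sigma> * z"] by (simp add: power2_eq_square algebra_simps)
    also have "d + \<sigma> * z = Y T \<omega> - \<theta>" by (simp add: Y_def z_def d_def)
    finally have "A * (\<sigma>\<^sup>2 * z\<^sup>2 / 2 - d\<^sup>2) \<le> A * (Y T \<omega> - \<theta>)\<^sup>2"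
      using A by (intro mult_left_mono) auto
    then have "A * (\<sigma>\<^sup>2 * z\<^sup>2 / 2 - d\<^sup>2) + B + L x \<le> - (L (Y T \<omega>) - L x)"
      using B[of "Y T \<omega>"] by linarith
    then have "(A * (\<sigma>\<^sup>2 * z\<^sup>2 / 2 - d\<^sup>2) + B + L x) / \<sigma>\<^sup>2 \<le> - (L (Y T \<omega>) - L x) / \<sigma>\<^sup>2"
      by (rule divide_right_mono) simp
    moreover have "(A * (\<sigma>\<^sup>2 * z\<^sup>2 / 2 - d\<^sup>2) + B + L x) / \<sigma>\<^sup>2 = A * z\<^sup>2 / 2 + (- A * d\<^sup>2 + B + L x) / \<sigma>\<^sup>2"
      using \<sigma> by (simp add: field_simps)
    moreover have "C * T \<le> integral {0..T} (\<lambda>r. V (Y r \<omega>))"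
    proof -
      have "continuous_on {0..T} (\<lambda>r. V (Y r \<omega>))"
        by (rule continuous_on_compose2[OF V_cont Y_cont[OF \<omega>]]) auto
      then have "integral {0..T} (\<lambda>_. C) \<le> integral {0..T} (\<lambda>r. V (Y r \<omega>))"
        using V by (intro integral_le integrable_continuous_interval continuous_on_const) auto
      then show ?thesis using T by (simp add: mult.commute)
    qed
    ultimately have "A * z\<^sup>2 / 2 + ((- A * d\<^sup>2 + B + L x) / \<sigma>\<^sup>2 + C * T / 2) \<le> log_weight T \<omega>"
      unfolding log_weight_def by linarith
    then have "c * (A * z\<^sup>2 / 2) + k \<le> c * log_weight T \<omega>"
      unfolding k_def distrib_left[symmetric] using c by (intro mult_left_mono) auto
    moreover have "c * (A * z\<^sup>2 / 2) = z\<^sup>2 / (2 * T)" using c T by (simp add: A_def)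
    ultimately show ?thesis by (simp add: z_def)
  qed
  have [measurable]: "(\<lambda>\<omega>. W T \<omega> - W 0 \<omega>) \<in> borel_measurable M"
    using T by (intro borel_measurable_diff W_borel) auto
  have "\<infinity> = (\<integral>\<^sup>+z. ennreal (exp k / sqrt (2 * pi * T)) \<partial>(lborel :: real measure))"
    using T by (simp add: ennreal_mult_top)
  also have "\<dots> = (\<integral>\<^sup>+z. ennreal (normal_density 0 (sqrt T) z) * ennreal (exp (z\<^sup>2 / (2 * T) + k)) \<partial>lborel)"
  proof (intro nn_integral_cong)
    fix z :: real
    have "normal_density 0 (sqrt T) z * exp (z\<^sup>2 / (2 * T) + k) = exp k / sqrt (2 * pi * T)"
    proof -
      have "exp (- (z\<^sup>2 / (2 * T))) * exp (z\<^sup>2 / (2 * T) + k) = exp k"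
        by (simp add: exp_add[symmetric])
      then show ?thesis using T by (simp add: normal_density_def)
    qed
    then show "ennreal (exp k / sqrt (2 * pi * T)) = ennreal (normal_density 0 (sqrt T) z) * ennreal (exp (z\<^sup>2 / (2 * T) + k))"
      by (simp add: ennreal_mult[symmetric])
  qed
  also have "\<dots> = (\<integral>\<^sup>+z. ennreal (exp (z\<^sup>2 / (2 * T) + k)) \<partial>gauss T)"
    by (intro nn_integral_gauss[symmetric]) measurable
  also have "\<dots> = (\<integral>\<^sup>+z. ennreal (exp (z\<^sup>2 / (2 * T) + k)) \<partial>distr M borel (\<lambda>\<omega>. W T \<omega> - W 0 \<omega>))"
    using increment_distr[OF order_refl T] by simp
  also have "\<dots> = (\<integral>\<^sup>+\<omega>. ennreal (exp ((W T \<omega> - W 0 \<omega>)\<^sup>2 / (2 * T) + k)) \<partial>M)"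
    by (subst nn_integral_distr) auto
  also have "\<dots> \<le> (\<integral>\<^sup>+\<omega>. ennreal (exp (c * log_weight T \<omega>)) \<partial>M)"
    using bound by (intro nn_integral_mono ennreal_leI) simp
  finally show ?thesis by (simp add: top_unique)
qed

lemma nn_integral_dens_0:
  assumes "ito_integral M F W (\<lambda>r \<omega>. eta lam \<sigma> (X r \<omega>)) 0 (I 0)"
  shows "(\<integral>\<^sup>+\<omega>. ennreal (dens lam \<sigma> X I 0 \<omega>) \<partial>M) = 1"
proof -
  have "AE \<omega> in M. ennreal (dens lam \<sigma> X I 0 \<omega>) = 1"
    using dens_explicit[where I=I, OF order_refl assms] AE_good
    by eventually_elim (simp add: good_def)
  then have "(\<integral>\<^sup>+\<omega>. ennreal (dens lam \<sigma> X I 0 \<omega>) \<partial>M) = (\<integral>\<^sup>+\<omega>. 1 \<partial>M)"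
    by (rule nn_integral_cong_AE)
  then show ?thesis by (simp add: emeasure_space_1)
qed

text \<open>
  A nonnegative supermartingale with constant expectation is a martingale; the expectation at time
  \<open>T\<close> is at least \<open>1\<close> by the case \<open>m = 1\<close> of the lower bound for moments.
\<close>

lemma dens_martingale:
  assumes T: "0 < T" and ito: "\<And>s. s \<in> {0..T} \<Longrightarrow> ito_integral M F W (\<lambda>r \<omega>. eta lam \<sigma> (X r \<omega>)) s (I s)"
  shows "martingale_upto M F T (dens lam \<sigma> X I)"
proof -
  define Z where "Z = dens lam \<sigma> X I"
  have Zpos: "0 \<le> Z t \<omega>" for t \<omega> by (simp add: Z_def dens_def)
  have ZF: "Z t \<in> borel_measurable (F t)" if "t \<in> {0..T}" for t
    unfolding Z_def by (rule dens_measurable[of t I, OF ito[OF that]])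
  have ZM: "Z t \<in> borel_measurable M" if "t \<in> {0..T}" for t
    by (rule measurable_F_M[OF ZF[OF that]])
  define N where "N t A = (\<integral>\<^sup>+\<omega>\<in>A. ennreal (Z t \<omega>) \<partial>M)" for t A
  have super: "N t A \<le> N s A" if "0 \<le> s" "s < t" "t \<le> T" "A \<in> sets (F s)" for s t A
    unfolding N_def Z_def using that by (intro dens_supermartingale ito) auto
  have N_space: "N t (space M) = (\<integral>\<^sup>+\<omega>. ennreal (Z t \<omega>) \<partial>M)" for t
    unfolding N_def by (intro nn_integral_cong) simp
  have space_in: "space M \<in> sets (F s)" for s
    using sets.top[of "F s"] space_F[of s] by simp
  have N0: "N 0 (space M) = 1"
    unfolding N_space Z_def using T by (intro nn_integral_dens_0 ito) auto
  have NT: "1 \<le> N T (space M)"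
  proof -
    have "(\<integral>\<^sup>+\<omega>. ennreal (exp ((1 - 1) * log_weight T \<omega>)) \<partial>M) \<le> (\<integral>\<^sup>+\<omega>. ennreal (Z T \<omega> powr 1) \<partial>M)"
      unfolding Z_def using T by (intro moment_lower_bound ito) auto
    then show ?thesis
      unfolding N_space using Zpos by (simp add: emeasure_space_1)
  qed
  have N1: "N t (space M) = 1" if t: "t \<in> {0..T}" for t
  proof (rule antisym)
    show "N t (space M) \<le> 1"
      using super[of 0 t "space M", OF _ _ _ space_in] t N0 by (cases "t = 0") auto
    show "1 \<le> N t (space M)"
      using super[of t T "space M", OF _ _ _ space_in] t NT by (cases "t = T") (auto intro: order_trans)
  qed
  have int: "integrable M (Z t)" if t: "t \<in> {0..T}" for t
    using ZM[OF t] N1[OF t] Zpos unfolding N_space by (intro integrableI_nonneg) auto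
  have eq: "N t A = N s A" if st: "0 \<le> s" "s < t" "t \<le> T" and A: "A \<in> sets (F s)" for s t A
  proof (rule antisym)
    show "N t A \<le> N s A" by (rule super[OF st A])
    have AM: "A \<in> sets M" using A subalgebra_F[of s] by (auto simp: subalgebra_def)
    have Ac: "space M - A \<in> sets (F s)" using A space_in by auto
    have split: "N r A + N r (space M - A) = 1" if "r \<in> {0..T}" for r
    proof -
      have "N r A + N r (space M - A) = N r (space M)"
        unfolding N_def using AM ZM[OF that]
        by (subst nn_integral_add[symmetric]) (auto intro!: nn_integral_cong simp: indicator_def)
      then show ?thesis using N1[OF that] by simp
    qed
    have le: "N t (space M - A) \<le> N s (space M - A)" by (rule super[OF st Ac])
    have fin: "N s (space M - A) \<noteq> \<infinity>"
      using split[of s] st by (metis add.commute ennreal_add_eq_top ennreal_one_neq_top atLeastAtMost_iff infinity_ennreal_def less_le_trans less_imp_le)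
    have "N s (space M - A) + N s A = N t (space M - A) + N t A"
      using split[of s] split[of t] st by (simp add: add.commute)
    also have "\<dots> \<le> N s (space M - A) + N t A"
      using le by (rule add_right_mono)
    finally show "N s A \<le> N t A"
      using fin by (simp add: ennreal_add_left_cancel_le)
  qed
  have ce: "AE \<omega> in M. real_cond_exp M (F s) (Z t) \<omega> = Z s \<omega>" if st: "0 \<le> s" "s \<le> t" "t \<le> T" for s t
  proof -
    interpret S: finite_measure_subalgebra M "F s"
      by unfold_locales (rule subalgebra_F)
    have s: "s \<in> {0..T}" and t: "t \<in> {0..T}" using st by auto
    show ?thesis
    proof (cases "s = t")
      case True
      then show ?thesis using S.real_cond_exp_F_meas[OF int[OF t]] ZF[OF t] by simp
    next
      case False
      show ?thesis
      proof (rule S.real_cond_exp_charact[OF _ int[OF t] int[OF s] ZF[OF s]])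
        fix A assume A: "A \<in> sets (F s)"
        then have AM: "A \<in> sets M" using subalgebra_F[of s] by (auto simp: subalgebra_def)
        have N_eq: "(\<integral>\<omega>\<in>A. Z r \<omega> \<partial>M) = enn2real (N r A)" if r: "r \<in> {0..T}" for r
        proof -
          have "(\<integral>\<omega>\<in>A. Z r \<omega> \<partial>M) = enn2real (\<integral>\<^sup>+\<omega>. ennreal (indicator A \<omega> *\<^sub>R Z r \<omega>) \<partial>M)"
            unfolding set_lebesgue_integral_def using AM ZM[OF r] Zpos
            by (intro integral_eq_nn_integral) auto
          also have "(\<integral>\<^sup>+\<omega>. ennreal (indicator A \<omega> *\<^sub>R Z r \<omega>) \<partial>M) = N r A"
            unfolding N_def by (intro nn_integral_cong) (simp add: indicator_def)
          finally show ?thesis .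
        qed
        show "(\<integral>\<omega>\<in>A. Z t \<omega> \<partial>M) = (\<integral>\<omega>\<in>A. Z s \<omega> \<partial>M)"
          unfolding N_eq[OF t] N_eq[OF s] using eq[of s t A] st False A by simp
      qed
    qed
  qed
  show ?thesis
    unfolding martingale_upto_def Z_def[symmetric] using ZF int ce by auto
qed

end

theorem theorem5p1:
  fixes M :: "'a measure" and F :: "real \<Rightarrow> 'a measure"
    and W X I :: "real \<Rightarrow> 'a \<Rightarrow> real"
    and lam :: "real \<Rightarrow> real" and \<sigma> x T :: real
  assumes "\<sigma> > 0" and "lam \<in> classD" and "superlinear lam" and "rho \<sigma> lam < 1"
    and "T > 0"
    and "filtered_prob_space M F" and "brownian_motion M F W"
    and "sde_solution M F W lam \<sigma> x X"
    and "\<And>s. s \<in> {0..T} \<Longrightarrow> ito_integral M F W (\<lambda>r \<omega>. eta lam \<sigma> (X r \<omega>)) s (I s)"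
  shows "martingale_upto M F T (dens lam \<sigma> X I) \<and>
    (\<forall>m::real. m > 1 \<longrightarrow>
      (\<integral>\<^sup>+ \<omega>. ennreal (dens lam \<sigma> X I T \<omega> powr m) \<partial>M) = \<infinity> \<and>
      \<not> in_Lp M m (dens lam \<sigma> X I T))"
proof (intro conjI allI impI)
  note D = classD_derivative[OF assms(2)]
  have "continuous_on UNIV lam"
    by (rule DERIV_continuous_on) (rule has_field_derivative_at_within[OF D(1)])
  then obtain L where L: "\<And>v. (L has_real_derivative lam v) (at v)"
    using antiderivative_exists by blast
  interpret filtered_prob_space M F by fact
  interpret sde M F W \<sigma> x lam "deriv lam" L X
    by unfold_locales (use assms D L in auto)
  show "martingale_upto M F T (dens lam \<sigma> X I)"
    by (rule dens_martingale[OF assms(5,9)])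
  fix m :: real assume m: "m > 1"
  obtain C where "\<And>y. V y \<ge> C"
    using killing_rate_bounded_below[OF assms(1,2,4)] unfolding V_def by blast
  then have "(\<integral>\<^sup>+\<omega>. ennreal (exp ((m - 1) * log_weight T \<omega>)) \<partial>M) = \<infinity>"
    using m by (intro exp_log_weight_infinite[where \<theta>="zero_of lam", OF assms(5)] potential_superquadratic[OF assms(2,3) _ L]) auto
  moreover have "(\<integral>\<^sup>+\<omega>. ennreal (exp ((m - 1) * log_weight T \<omega>)) \<partial>M)
      \<le> (\<integral>\<^sup>+\<omega>. ennreal (dens lam \<sigma> X I T \<omega> powr m) \<partial>M)"
    using assms(5) by (intro moment_lower_bound assms(9)) auto
  ultimately show inf: "(\<integral>\<^sup>+\<omega>. ennreal (dens lam \<sigma> X I T \<omega> powr m) \<partial>M) = \<infinity>"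
    by (simp add: top_unique)
  show "\<not> in_Lp M m (dens lam \<sigma> X I T)"
  proof
    assume "in_Lp M m (dens lam \<sigma> X I T)"
    then have "integrable M (\<lambda>\<omega>. dens lam \<sigma> X I T \<omega> powr m)"
      by (simp add: in_Lp_def dens_def)
    then have "(\<integral>\<^sup>+\<omega>. ennreal (dens lam \<sigma> X I T \<omega> powr m) \<partial>M) < \<infinity>"
      by (simp add: integrable_iff_bounded)
    then show False using inf by simp
  qed
qed

end
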